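(* Let $r\in(0,1)$. For any probability distribution $\mu$ on $\mathbb{R}_+=[0,\infty)$, the sequence $\nu_t^*$ of empirical distributions of opinions in the quantile admission process with veto power with parameters $\mu,r$ converges weakly, almost surely, to a (possibly random) distribution $\nu_\infty$ on $\mathbb{R}_+$. Moreover, the limit distribution $\nu_\infty$ satisfies one of the following forms (where $X,Y$ are independent $\mu$-distributed random variables): (i) $\nu_\infty((s,\infty))=\mathbb{P}(X>s,\,Y>s\mid X+Y\ge 2m)$ for some $m<\mu_{\max}$ which satisfies $\rho(m)\le 0\le \lim_{q\to m-}\rho(q)$; (ii) $\nu_\infty((s,\infty))=\mathbb{P}(X>s,\,Y>s\mid X+Y>2m)$ for some $m<\mu_{\max}$ which satisfies $\rho(m)\le 0=\lim_{q\to m+}\rho(q)$; (iii) $\nu_\infty=\delta_{\mu_{\max}}$, and $0\le\lim_{q\to\mu_{\max}}\rho(q)$.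
   Context: Process. Let $(X_t,Y_t)_{t\ge 1}$ be independent pairs of independent $\mu$-distributed random variables. Let $\mathcal{S}_0=\emptyset$, a multiset of reals. For $t\ge1$ let $\mathcal{S}^+_{t-1}=\{s\in\mathcal{S}_{t-1}: |s-\min(X_t,Y_t)|\le|s-\max(X_t,Y_t)|\}$ (with multiplicity). If $|\mathcal{S}^+_{t-1}|\ge r|\mathcal{S}_{t-1}|$, then $\mathcal{S}_t$ is $\mathcal{S}_{t-1}$ with one additional copy of $\min(X_t,Y_t)$; otherwise $\mathcal{S}_t=\mathcal{S}_{t-1}$. Put $\nu^*_t=\frac{1}{|\mathcal{S}_t|}\sum_{s\in\mathcal{S}_t}\delta_s$, where $\delta_s$ is the Dirac measure at $s$. Notation. $\mu_{\max}$ is the supremum of the support of $\mu$ (possibly $\infty$). For $m<\mu_{\max}$, $$\rho(m)=\frac{\mu((m,\infty))^2}{(\mu*\mu)([2m,\infty))}-(1-r)=\mathbb{P}(X>m,\,Y>m\mid X+Y\ge 2m)-(1-r),$$ where $\mu*\mu$ is the convolution of $\mu$ with itself.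
   Formalization: When X_t = Y_t, members count in S^+ only if s ≤ X_t (a midpoint vote), since always admitting ties makes the claim false for μ with atoms; in (iii) the limit of ρ at μ_max, which need not exist, is replaced by the lower limit. *)

theory Defs
  imports "HOL-Probability.Probability"
begin

text \<open>
  A member with opinion \<open>s\<close> prefers the smaller of two candidate opinions \<open>x\<close>, \<open>y\<close> when it is at
  least as close to the minimum as to the maximum.

  Equal candidates need a convention, because for \<open>x = y\<close> the comparison of distances holds for every
  \<open>s\<close> and the pair would always be admitted, which makes the description of the limit false when the
  opinion distribution has atoms. Take mass 1/2 at 0, mass 1/2 at 10, and \<open>r = 9/10\<close>. Under the
  unconditional admission of ties the proportion of 0s in the club tends to 1/2, but the laws of
  \<open>min X Y\<close> conditioned on \<open>X + Y \<ge> 2 * m\<close> or on \<open>X + Y > 2 * m\<close> give 0 the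
  mass 3/4, 2/3 or 0 only, and the unit mass at 10 gives it mass 0.
  As in those conditional laws, the vote is taken relative to the midpoint of the two candidates,
  see \<open>prefers_min_iff_midpoint\<close>. If the opinion distribution has no atoms, ties almost surely
  do not occur and the convention is immaterial.
\<close>

definition prefers_min :: "real \<Rightarrow> real \<Rightarrow> real \<Rightarrow> bool" where
  "prefers_min x y s \<longleftrightarrow>
     (if x = y then s \<le> x else \<bar>s - min x y\<bar> \<le> \<bar>s - max x y\<bar>)"

lemma prefers_min_iff_midpoint: "prefers_min x y s \<longleftrightarrow> s \<le> (x + y) / 2"
  by (auto simp: prefers_min_def min_def max_def abs_if field_simps)

text \<open>The candidates of round \<open>t \<ge> 1\<close> are \<open>x t\<close> and \<open>y t\<close>; the values at 0 are not used.\<close>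

primrec club :: "real \<Rightarrow> (nat \<Rightarrow> real) \<Rightarrow> (nat \<Rightarrow> real) \<Rightarrow> nat \<Rightarrow> real multiset" where
  "club r x y 0 = {#}"
| "club r x y (Suc t) =
     (let S = club r x y t;
          Splus = filter_mset (prefers_min (x (Suc t)) (y (Suc t))) S
      in if real (size Splus) \<ge> r * real (size S)
         then add_mset (min (x (Suc t)) (y (Suc t))) S
         else S)"

text \<open>The first round always admits, so the multiset is nonempty for \<open>t \<ge> 1\<close>;
  the value at the empty multiset is unspecified.\<close>

definition empirical :: "real multiset \<Rightarrow> real measure" where
  "empirical S = distr (measure_pmf (pmf_of_multiset S)) borel (\<lambda>s. s)"

definition measure_support :: "real measure \<Rightarrow> real set" where
  "measure_support \<mu> = {x. \<forall>U. open U \<and> x \<in> U \<longrightarrow> emeasure \<mu> U > 0}"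

definition mu_max :: "real measure \<Rightarrow> ereal" where
  "mu_max \<mu> = (SUP x\<in>measure_support \<mu>. ereal x)"

definition rho :: "real \<Rightarrow> real measure \<Rightarrow> real \<Rightarrow> real" where
  "rho r \<mu> m = (measure \<mu> {m<..})\<^sup>2 / measure (\<mu> \<star> \<mu>) {2 * m..} - (1 - r)"

definition limit_form_i :: "real \<Rightarrow> real measure \<Rightarrow> real measure \<Rightarrow> bool" where
  "limit_form_i r \<mu> \<nu> \<longleftrightarrow>
     (\<exists>m. ereal m < mu_max \<mu> \<and> rho r \<mu> m \<le> 0 \<and>
          (\<exists>l. (rho r \<mu> \<longlongrightarrow> l) (at_left m) \<and> 0 \<le> l) \<and>
          (\<forall>s. measure \<nu> {s<..} =
             \<P>(z in \<mu> \<Otimes>\<^sub>M \<mu>. fst z > s \<and> snd z > s \<bar> fst z + snd z \<ge> 2 * m)))"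

definition limit_form_ii :: "real \<Rightarrow> real measure \<Rightarrow> real measure \<Rightarrow> bool" where
  "limit_form_ii r \<mu> \<nu> \<longleftrightarrow>
     (\<exists>m. ereal m < mu_max \<mu> \<and> rho r \<mu> m \<le> 0 \<and>
          (rho r \<mu> \<longlongrightarrow> 0) (at_right m) \<and>
          (\<forall>s. measure \<nu> {s<..} =
             \<P>(z in \<mu> \<Otimes>\<^sub>M \<mu>. fst z > s \<and> snd z > s \<bar> fst z + snd z > 2 * m)))"

text \<open>
  One-sided limits of \<open>rho\<close> always exist at points below \<open>mu_max\<close>, where the denominator stays positive.
  At \<open>mu_max\<close> itself the denominator may tend to 0 and the limit need not exist, even when the empirical
  distributions do converge to the unit mass there: let \<open>\<mu>\<close> on [0,1] satisfy
  \<open>\<mu> {1 - u..} = u * (1 + c * sin (ln u))\<close> for \<open>0 < u \<le> 1\<close> and a small \<open>c > 0\<close>. The quotient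
  in \<open>rho\<close> then oscillates near 1 but is bounded away from 0 below 1, so for \<open>r\<close> close to 1
  \<open>rho\<close> is positive below 1 and the first two forms are excluded.
  Hence the limit at \<open>mu_max\<close> is taken as a lower limit, which is the limit whenever that exists.
\<close>

definition limit_form_iii :: "real \<Rightarrow> real measure \<Rightarrow> real measure \<Rightarrow> bool" where
  "limit_form_iii r \<mu> \<nu> \<longleftrightarrow>
     (\<exists>b. mu_max \<mu> = ereal b \<and> \<nu> = return borel b \<and>
          0 \<le> Liminf (at_left b) (\<lambda>q. ereal (rho r \<mu> q)))"

end

theory Submission
  imports Defs
begin

text \<open>
A pair of candidates is admitted exactly when its midpoint is at least the \<open>r\<close>-quantile of the
club. One real number therefore drives the dynamics, and the theorem follows once this quantile is
known to converge almost surely. If it tends to some \<open>m\<close> below the supremum of the support, then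
in the long run the admitted pairs are those with \<open>X + Y \<ge> 2m\<close> or those with
\<open>X + Y > 2m\<close>. The law of large numbers (\<open>frequency_tendsto\<close>) then gives the limit of the
empirical distributions, and comparing the limiting share of members above levels close to
\<open>m\<close> with \<open>1 - r\<close> gives the conditions on \<open>rho\<close>
(\<open>limit_closed_form\<close>, \<open>limit_open_form\<close>). If the quantile tends to the supremum itself, so do
all late members (\<open>limit_top_form\<close>).

To follow the quantile, fix a level \<open>m\<close> and consider the excess: the number of members above
\<open>m\<close> minus \<open>1 - r\<close> times the size of the club. The quantile is at most \<open>m\<close> if and only if
the excess is at most 0. If \<open>rho m < 0\<close>, the excess has a negative drift as long as it is at
most 0, so from any such state it stays there forever with a probability that is bounded below. By
a zero-one law (\<open>recurrence_zero_one\<close>), a quantile that is at most \<open>m\<close> infinitely often is so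
eventually (\<open>AE_stay_below\<close>). In the same way a quantile above \<open>m\<close> stays there if the excess
drifts upwards at all quantiles that can occur (\<open>AE_stay_above\<close>).

The delicate case is that \<open>rho\<close> vanishes on an interval. Then the excess at each single level
behaves like a random walk without drift, which returns to 0 infinitely often, and the limit of the
quantile is random. Here \<open>AE_cross_below\<close> lets the level move. A pair of candidates that both
exceed a level is admitted whenever the quantile is at most that level, so the number of members
between two levels grows linearly in time, while the walks fluctuate only like the square root of
time. Raising the level by summable amounts at geometrically growing times keeps the excess
negative with positive probability, and the quantile never gets above the limit of the levels.

Suppose now that the lower limit \<open>l\<close> and the upper limit \<open>u\<close> of the quantile differ. By
\<open>AE_stay_below\<close> the function \<open>rho\<close> is nonnegative at the levels between them. If it is positive at
one of them, \<open>uniform_drift\<close> turns this into an upward drift of the excess at that level for all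
quantiles up to \<open>u\<close>, and if it vanishes at all of them, \<open>AE_cross_below\<close> applies. In both cases
the quantile cannot oscillate (\<open>quantile_convergent\<close>).

It remains to see that the quantile does not escape. If the support is unbounded, there are
arbitrarily large levels with \<open>rho\<close> close to \<open>r - 1\<close> (\<open>ratio_small_at_infinity\<close>), and one of them
is a barrier (\<open>AE_stay_below_some\<close>). The same argument shows that the quantile tends to the supremum
of a bounded support only if the lower limit of \<open>rho\<close> there is nonnegative.
\<close>

section \<open>The club as a driven dynamical system\<close>

definition above :: "real \<Rightarrow> real multiset \<Rightarrow> real" where
  "above m S = real (size (filter_mset (\<lambda>s. m < s) S))"

text \<open>
The set of levels at which the excess is at most 0 is, for a nonempty club, the half-line that starts
at the quantile. Unlike the quantile, the excess at a fixed level changes by \<open>r\<close> or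
\<open>r - 1\<close> with each admission, so that it can be treated as a random walk.
\<close>

definition excess :: "real \<Rightarrow> real \<Rightarrow> real multiset \<Rightarrow> real" where
  "excess r m S = above m S - (1 - r) * real (size S)"

definition low :: "real \<times> real \<Rightarrow> real" where
  "low z = min (fst z) (snd z)"

definition mid :: "real \<times> real \<Rightarrow> real" where
  "mid z = (fst z + snd z) / 2"

definition admits :: "real \<Rightarrow> real multiset \<Rightarrow> real \<times> real \<Rightarrow> bool" where
  "admits r S z \<longleftrightarrow> excess r (mid z) S \<le> 0"

definition step :: "real \<Rightarrow> real multiset \<Rightarrow> real \<times> real \<Rightarrow> real multiset" where
  "step r S z = (if admits r S z then add_mset (low z) S else S)"

primrec run :: "real \<Rightarrow> real multiset \<Rightarrow> (nat \<Rightarrow> real \<times> real) \<Rightarrow> nat \<Rightarrow> real multiset" where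
  "run r S z 0 = S"
| "run r S z (Suc t) = step r (run r S z t) (z t)"

lemma low_le_mid: "low z \<le> mid z"
  by (auto simp: low_def mid_def min_def)

lemma above_le_size: "above m S \<le> real (size S)"
  unfolding above_def by (metis of_nat_mono size_filter_mset_lesseq)

lemma above_antimono: "m \<le> m' \<Longrightarrow> above m' S \<le> above m S"
proof -
  assume "m \<le> m'"
  then have "filter_mset (\<lambda>s. m' < s) S = filter_mset (\<lambda>s. m' < s) (filter_mset (\<lambda>s. m < s) S)"
    by (auto simp: filter_filter_mset intro!: filter_mset_cong)
  then show ?thesis
    unfolding above_def by (metis of_nat_mono size_filter_mset_lesseq)
qed

lemma above_add: "above m (add_mset x S) = above m S + (if m < x then 1 else 0)"
  by (simp add: above_def)

lemma above_empty [simp]: "above m {#} = 0"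
  by (simp add: above_def)

lemma excess_empty [simp]: "excess r m {#} = 0"
  by (simp add: excess_def)

lemma excess_antimono: "m \<le> m' \<Longrightarrow> excess r m' S \<le> excess r m S"
  by (simp add: excess_def above_antimono)

lemma excess_add:
  "excess r m (add_mset x S) = excess r m S + (if m < x then r else - (1 - r))"
  by (simp add: excess_def above_add algebra_simps)

lemma excess_step:
  "excess r m (step r S z) =
     excess r m S + (if admits r S z then (if m < low z then r else - (1 - r)) else 0)"
  by (simp add: step_def excess_add)

text \<open>
The candidates of round \<open>t + 1\<close> become the draw with index \<open>t\<close>, so that states and draws are
both numbered from 0. Starting a run from an arbitrary club makes the Markov property
(\<open>run_comb_seq\<close>) available.
\<close>

lemma club_eq_run:
  "club r x y t = run r {#} (\<lambda>k. (x (Suc k), y (Suc k))) t"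
proof (induction t)
  case (Suc t)
  let ?S = "club r x y t" and ?z = "(x (Suc t), y (Suc t))"
  have "size ?S = size (filter_mset (\<lambda>s. s \<le> mid ?z) ?S) + size (filter_mset (\<lambda>s. mid ?z < s) ?S)"
    by (subst multiset_partition[of ?S "\<lambda>s. s \<le> mid ?z"]) (simp add: not_le)
  then have "real (size (filter_mset (prefers_min (x (Suc t)) (y (Suc t))) ?S)) \<ge> r * real (size ?S)
     \<longleftrightarrow> admits r ?S ?z"
    by (simp add: prefers_min_iff_midpoint admits_def excess_def above_def mid_def algebra_simps
        cong: filter_mset_cong)
  then show ?case
    using Suc by (simp add: step_def low_def Let_def)
qed simp

lemma run_add:
  "run r S z (t + j) = run r (run r S z t) (\<lambda>i. z (t + i)) j"
  by (induction j) simp_all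

lemma run_comb_seq:
  "run r S (comb_seq t \<omega> \<omega>') (t + j) = run r (run r S \<omega> t) \<omega>' j"
proof -
  have 1: "run r S (comb_seq t \<omega> \<omega>') i = run r S \<omega> i" if "i \<le> t" for i
    using that by (induction i) (simp_all add: comb_seq_less)
  have 2: "(\<lambda>i. comb_seq t \<omega> \<omega>' (t + i)) = \<omega>'"
    by (simp add: fun_eq_iff comb_seq_def)
  show ?thesis
    unfolding run_add 2 by (simp add: 1)
qed

lemma run_comb_seq_le:
  "i \<le> t \<Longrightarrow> run r S (comb_seq t \<omega> \<omega>') i = run r S \<omega> i"
  by (induction i) (simp_all add: comb_seq_less)

lemma run_case_nat: "run r S (case_nat z \<omega>) (Suc j) = run r (step r S z) \<omega> j"
  by (induction j) simp_all

lemma run_size_mono: "i \<le> j \<Longrightarrow> size (run r S z i) \<le> size (run r S z j)"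
  by (induction rule: dec_induct) (auto simp: step_def)

definition quantile :: "real \<Rightarrow> real multiset \<Rightarrow> real" where
  "quantile r S = Min {s \<in> set_mset S. excess r s S \<le> 0}"

lemma quantile_props:
  assumes "S \<noteq> {#}" "0 < r" "r < 1"
  shows quantile_in: "quantile r S \<in># S"
    and quantile_le_iff: "quantile r S \<le> m \<longleftrightarrow> excess r m S \<le> 0"
proof -
  let ?A = "{s \<in> set_mset S. excess r s S \<le> 0}"
  have "above (Max (set_mset S)) S = 0"
    by (auto simp: above_def filter_mset_eq_conv not_less)
  then have "Max (set_mset S) \<in> ?A"
    using assms by (auto simp: excess_def)
  then have ne: "?A \<noteq> {}" by blast
  have fin: "finite ?A" by simp
  have q: "quantile r S \<in> ?A"
    unfolding quantile_def by (rule Min_in[OF fin ne])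
  then show "quantile r S \<in># S" by simp
  show "quantile r S \<le> m \<longleftrightarrow> excess r m S \<le> 0"
  proof
    assume "quantile r S \<le> m"
    then show "excess r m S \<le> 0"
      using q excess_antimono[of "quantile r S" m r S] by simp
  next
    assume m: "excess r m S \<le> 0"
    define B where "B = {s \<in> set_mset S. s \<le> m}"
    have "B \<noteq> {}"
    proof
      assume "B = {}"
      then have "filter_mset (\<lambda>s. m < s) S = S"
        by (auto simp: B_def filter_mset_eq_conv not_le)
      then have "excess r m S = r * real (size S)"
        by (simp add: excess_def above_def algebra_simps)
      moreover have "real (size S) > 0"
        using assms(1) by (simp add: nonempty_has_size)
      ultimately show False
        using m assms(2) by (simp add: mult_le_0_iff)
    qed
    moreover have finB: "finite B" by (simp add: B_def)
    ultimately have s: "Max B \<in> B" by (rule Max_in[rotated])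
    have "filter_mset (\<lambda>s. Max B < s) S = filter_mset (\<lambda>s. m < s) S"
    proof (rule filter_mset_cong[OF refl])
      fix x assume "x \<in># S"
      show "Max B < x \<longleftrightarrow> m < x"
      proof
        assume "Max B < x"
        then have "x \<notin> B"
          using Max_ge[OF finB, of x] by linarith
        then show "m < x"
          using \<open>x \<in># S\<close> by (simp add: B_def)
      next
        assume "m < x" then show "Max B < x"
          using s by (auto simp: B_def)
      qed
    qed
    then have "excess r (Max B) S \<le> 0"
      using m by (simp add: excess_def above_def)
    then have "quantile r S \<le> Max B"
      unfolding quantile_def using s by (intro Min_le[OF fin]) (auto simp: B_def)
    also have "\<dots> \<le> m" using s by (auto simp: B_def)
    finally show "quantile r S \<le> m" .
  qed
qed

lemma admits_iff_quantile:
  assumes "S \<noteq> {#}" "0 < r" "r < 1"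
  shows "admits r S z \<longleftrightarrow> quantile r S \<le> mid z"
  using quantile_le_iff[OF assms] by (simp add: admits_def)

lemma run_nonempty: "t \<ge> 1 \<Longrightarrow> run r S z t \<noteq> {#}"
proof -
  assume "t \<ge> 1"
  have "run r S z (Suc 0) \<noteq> {#}"
    by (auto simp: step_def admits_def)
  with run_size_mono[OF \<open>t \<ge> 1\<close>, of r S z] show ?thesis
    by auto
qed

section \<open>Sequences of independent draws\<close>

text \<open>
For negative \<open>x\<close> this follows from the lower bound \<open>1 + y + y\<^sup>2 / 2 \<le> exp y\<close> at \<open>y = - x\<close>, since
\<open>(1 + y + y\<^sup>2 / 2) * (1 - y + y\<^sup>2) \<ge> 1\<close>.
\<close>

lemma exp_le_quadratic:
  fixes x :: real
  assumes "\<bar>x\<bar> \<le> 1"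
  shows "exp x \<le> 1 + x + x\<^sup>2"
proof (cases "0 \<le> x")
  case True
  then show ?thesis using exp_bound[of x] assms by simp
next
  case False
  define y where "y = - x"
  have y: "0 < y" using False by (simp add: y_def)
  have "1 + y + y\<^sup>2 / 2 \<le> exp y"
    using exp_lower_Taylor_quadratic[of y] y by simp
  moreover have "1 \<le> (1 + y + y\<^sup>2 / 2) * (1 - y + y\<^sup>2)"
  proof -
    have "(1 + y + y\<^sup>2 / 2) * (1 - y + y\<^sup>2) = 1 + y\<^sup>2 / 2 + y ^ 3 / 2 + y ^ 4 / 2"
      by (simp add: power2_eq_square power3_eq_cube power4_eq_xxxx field_simps)
    then show ?thesis using y by simp
  qed
  moreover have "0 \<le> 1 - y + y\<^sup>2"
    using assms y by (simp add: y_def)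
  ultimately have "1 \<le> exp y * (1 - y + y\<^sup>2)"
    using mult_right_mono[of "1 + y + y\<^sup>2 / 2" "exp y" "1 - y + y\<^sup>2"] by linarith
  then show ?thesis
    by (simp add: y_def exp_minus field_simps)
qed

context sequence_space
begin

text \<open>
The future after time \<open>t\<close> is an independent copy of the whole sequence. This identity plays the
role of the Markov property.
\<close>

lemma emeasure_comb_seq:
  assumes [measurable]: "B \<in> sets S"
  shows "emeasure S B = (\<integral>\<^sup>+\<omega>. emeasure S {\<omega>' \<in> space S. comb_seq t \<omega> \<omega>' \<in> B} \<partial>S)"
proof -
  have "emeasure S B = emeasure (distr (S \<Otimes>\<^sub>M S) S (\<lambda>(\<omega>, \<omega>'). comb_seq t \<omega> \<omega>')) B"
    by (simp add: PiM_comb_seq)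
  also have "\<dots> = emeasure (S \<Otimes>\<^sub>M S) ((\<lambda>(\<omega>, \<omega>'). comb_seq t \<omega> \<omega>') -` B \<inter> space (S \<Otimes>\<^sub>M S))"
    by (intro emeasure_distr) auto
  also have "\<dots> = (\<integral>\<^sup>+\<omega>. emeasure S (Pair \<omega> -` ((\<lambda>(\<omega>, \<omega>'). comb_seq t \<omega> \<omega>') -` B \<inter> space (S \<Otimes>\<^sub>M S))) \<partial>S)"
    by (intro P.emeasure_pair_measure_alt) measurable
  also have "\<dots> = (\<integral>\<^sup>+\<omega>. emeasure S {\<omega>' \<in> space S. comb_seq t \<omega> \<omega>' \<in> B} \<partial>S)"
    by (intro nn_integral_cong arg_cong[where f = "emeasure S"]) (auto simp: space_pair_measure)
  finally show ?thesis .
qed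

lemma emeasure_case_nat:
  assumes [measurable]: "B \<in> sets S"
  shows "emeasure S B = (\<integral>\<^sup>+z. emeasure S {\<omega> \<in> space S. case_nat z \<omega> \<in> B} \<partial>M)"
proof -
  have "emeasure S B = emeasure (distr (M \<Otimes>\<^sub>M S) S (\<lambda>(s, \<omega>). case_nat s \<omega>)) B"
    by (simp add: PiM_iter)
  also have "\<dots> = emeasure (M \<Otimes>\<^sub>M S) ((\<lambda>(s, \<omega>). case_nat s \<omega>) -` B \<inter> space (M \<Otimes>\<^sub>M S))"
    by (intro emeasure_distr) auto
  also have "\<dots> = (\<integral>\<^sup>+s. emeasure S (Pair s -` ((\<lambda>(s, \<omega>). case_nat s \<omega>) -` B \<inter> space (M \<Otimes>\<^sub>M S))) \<partial>M)"
    by (intro P.emeasure_pair_measure_alt) measurable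
  also have "\<dots> = (\<integral>\<^sup>+z. emeasure S {\<omega> \<in> space S. case_nat z \<omega> \<in> B} \<partial>M)"
    by (intro nn_integral_cong arg_cong[where f = "emeasure S"]) (auto simp: space_pair_measure)
  finally show ?thesis .
qed

text \<open>
An event depends only on the first \<open>T\<close> draws. Replacing the later draws by those of another
sequence expresses this without a filtration.
\<close>

definition determined :: "nat \<Rightarrow> (nat \<Rightarrow> 'a) set \<Rightarrow> bool" where
  "determined T A \<longleftrightarrow> A \<in> sets S \<and>
     (\<forall>\<omega>\<in>space S. \<forall>\<omega>'\<in>space S. comb_seq T \<omega> \<omega>' \<in> A \<longleftrightarrow> \<omega> \<in> A)"

lemma determined_sets: "determined T A \<Longrightarrow> A \<in> sets S"
  by (simp add: determined_def)

lemma comb_seq_space: "\<omega> \<in> space S \<Longrightarrow> \<omega>' \<in> space S \<Longrightarrow> comb_seq T \<omega> \<omega>' \<in> space S"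
  by (auto simp: space_PiM PiE_iff split: split_comb_seq)

lemma determined_mono:
  assumes "determined T A" "T \<le> T'"
  shows "determined T' A"
proof -
  have "comb_seq T' \<omega> \<omega>' \<in> A \<longleftrightarrow> \<omega> \<in> A" if w: "\<omega> \<in> space S" "\<omega>' \<in> space S" for \<omega> \<omega>'
  proof -
    have eq: "comb_seq T (comb_seq T' \<omega> \<omega>') \<omega> = comb_seq T \<omega> \<omega>"
      using assms(2) by (auto simp: comb_seq_def fun_eq_iff)
    have "comb_seq T' \<omega> \<omega>' \<in> A \<longleftrightarrow> comb_seq T (comb_seq T' \<omega> \<omega>') \<omega> \<in> A"
      using assms(1) w comb_seq_space[OF w] by (simp add: determined_def)
    also have "\<dots> \<longleftrightarrow> \<omega> \<in> A"
      unfolding eq using assms(1) w by (simp add: determined_def)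
    finally show ?thesis .
  qed
  then show ?thesis using assms(1) by (simp add: determined_def)
qed

lemma determined_Diff: "determined T A \<Longrightarrow> determined T B \<Longrightarrow> determined T (A - B)"
  by (auto simp: determined_def)

lemma determined_Int: "determined T A \<Longrightarrow> determined T B \<Longrightarrow> determined T (A \<inter> B)"
  by (auto simp: determined_def)

lemma determined_space: "determined T (space S)"
  by (auto simp: determined_def comb_seq_space)

lemma determined_UN:
  "finite I \<Longrightarrow> (\<And>i. i \<in> I \<Longrightarrow> determined T (A i)) \<Longrightarrow> determined T (\<Union>i\<in>I. A i)"
  unfolding determined_def by (intro conjI sets.finite_UN) auto

text \<open>
Every event is, up to small probability, decided by finitely many draws: such events generate the
product \<open>\<sigma>\<close>-algebra, and the property is stable under complements and countable unions.
\<close>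

lemma determined_approx:
  assumes "B \<in> sets S" "e > 0"
  shows "\<exists>T A. determined T A \<and> P.prob ((A - B) \<union> (B - A)) < e"
proof -
  define \<Omega> where "\<Omega> = (UNIV \<rightarrow>\<^sub>E space M :: (nat \<Rightarrow> 'a) set)"
  have sp: "space S = \<Omega>" by (simp add: space_PiM \<Omega>_def)
  have gen: "sets S = sigma_sets \<Omega> {{f \<in> \<Omega>. f i \<in> A} |i A. i \<in> UNIV \<and> A \<in> sets M}"
    unfolding sets_PiM_single \<Omega>_def ..
  show ?thesis
    using assms(1)[unfolded gen] assms(2)
  proof (induction arbitrary: e)
    case (Basic B)
    then obtain i A where B: "B = {f \<in> \<Omega>. f i \<in> A}" "A \<in> sets M" by auto
    have "B \<in> sets S" unfolding B(1) sp[symmetric] using B(2) by measurable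
    then have "determined (Suc i) B"
      by (auto simp: determined_def comb_seq_less comb_seq_space B(1) sp[symmetric])
    with Basic show ?case
      by (intro exI[of _ "Suc i"] exI[of _ B]) simp
  next
    case Empty
    then show ?case by (intro exI[of _ 0] exI[of _ "{}"]) (simp add: determined_def)
  next
    case (Compl B)
    then obtain T A where A: "determined T A" "P.prob ((A - B) \<union> (B - A)) < e" by blast
    have Bs: "B \<in> sets S" using Compl gen by auto
    have "(\<Omega> - A - (\<Omega> - B)) \<union> (\<Omega> - B - (\<Omega> - A)) = (A - B) \<union> (B - A)"
      using determined_sets[OF A(1), THEN sets.sets_into_space] sets.sets_into_space[OF Bs] sp by auto
    with A show ?case
      using determined_Diff[OF determined_space A(1)]
      by (intro exI[of _ T] exI[of _ "\<Omega> - A"]) (auto simp: sp)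
  next
    case (Union B)
    have Bs[measurable]: "B i \<in> sets S" for i using Union gen by auto
    have "(\<lambda>n. P.prob (\<Union>i<n. B i)) \<longlonglongrightarrow> P.prob (\<Union>n. \<Union>i<n. B i)"
      by (intro P.finite_Lim_measure_incseq) (auto simp: incseq_def intro: less_le_trans)
    moreover have "(\<Union>n. \<Union>i<n. B i) = (\<Union>i. B i)" by auto
    ultimately have "\<forall>\<^sub>F n in sequentially. P.prob (\<Union>i. B i) - e / 2 < P.prob (\<Union>i<n. B i)"
      using \<open>e > 0\<close> by (intro order_tendstoD) auto
    then obtain n where n: "P.prob (\<Union>i. B i) - e / 2 < P.prob (\<Union>i<n. B i)"
      by (auto simp: eventually_sequentially)
    have e': "e / (2 * (real n + 1)) > 0" using \<open>e > 0\<close> by simp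
    have "\<exists>T A. determined T A \<and> P.prob ((A - B i) \<union> (B i - A)) < e / (2 * (real n + 1))" for i
      using Union.IH[OF e'] .
    then obtain T A where TA: "\<And>i. determined (T i) (A i)"
      "\<And>i. P.prob ((A i - B i) \<union> (B i - A i)) < e / (2 * (real n + 1))" by metis
    have [measurable]: "A i \<in> sets S" for i using TA(1) by (rule determined_sets)
    define T' where "T' = Max (insert 0 (T ` {..<n}))"
    have "T i \<le> T'" if "i < n" for i
      unfolding T'_def using that by (intro Max_ge) auto
    then have det: "determined T' (\<Union>i<n. A i)"
      by (intro determined_UN) (auto intro: determined_mono[OF TA(1)])
    let ?U = "\<Union>i<n. A i" and ?V = "\<Union>i<n. B i" and ?W = "\<Union>i. B i"
    have "P.prob ((?U - ?W) \<union> (?W - ?U)) \<le> P.prob ((\<Union>i<n. (A i - B i) \<union> (B i - A i)) \<union> (?W - ?V))"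
      by (intro P.finite_measure_mono) auto
    also have "\<dots> \<le> P.prob (\<Union>i<n. (A i - B i) \<union> (B i - A i)) + P.prob (?W - ?V)"
      by (intro measure_Un_le) auto
    also have "P.prob (\<Union>i<n. (A i - B i) \<union> (B i - A i)) \<le> (\<Sum>i<n. P.prob ((A i - B i) \<union> (B i - A i)))"
      by (intro P.finite_measure_subadditive_finite) auto
    also have "\<dots> \<le> (\<Sum>i<n. e / (2 * (real n + 1)))"
      by (intro sum_mono less_imp_le TA(2))
    also have "\<dots> \<le> e / 2"
      using \<open>e > 0\<close> by (simp add: field_simps)
    also have "P.prob (?W - ?V) = P.prob ?W - P.prob ?V"
      by (intro P.finite_measure_Diff) auto
    finally have "P.prob ((?U - ?W) \<union> (?W - ?U)) < e"
      using n by simp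
    with det show ?case by blast
  qed
qed

text \<open>
This is Levy's zero-one law in the form in which it is used below. If from every good state the event
\<open>E\<close> has conditional probability at least \<open>c\<close>, then good states do not recur forever outside of
\<open>E\<close>. To prove it, approximate the set of sequences that have infinitely many good times
but lie outside of \<open>E\<close> by an event \<open>A\<close> decided at some time \<open>T\<close>. Splitting \<open>A\<close> by the first good
time after \<open>T\<close> shows that a share of at least \<open>c\<close> of it lies in \<open>E\<close>, although \<open>A\<close> is almost
disjoint from \<open>E\<close>.
\<close>

lemma recurrence_zero_one:
  assumes E [measurable]: "E \<in> sets S" and Good: "\<And>t. determined t (Good t)"
    and c: "0 < c" "\<And>t \<omega>. \<omega> \<in> Good t \<Longrightarrow> c \<le> P.prob {\<omega>' \<in> space S. comb_seq t \<omega> \<omega>' \<in> E}"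
  shows "AE \<omega> in S. (\<exists>\<^sub>\<infinity>t. \<omega> \<in> Good t) \<longrightarrow> \<omega> \<in> E"
proof -
  have [measurable]: "Good t \<in> sets S" for t using Good by (rule determined_sets)
  define G where "G = {\<omega> \<in> space S. \<exists>\<^sub>\<infinity>t. \<omega> \<in> Good t}"
  have [measurable]: "G \<in> sets S" unfolding G_def INFM_nat by measurable
  have one: "c * P.prob F \<le> P.prob (F \<inter> E)" if F: "determined t F" "F \<subseteq> Good t" for t F
  proof -
    note [measurable] = determined_sets[OF F(1)]
    have "ennreal c * emeasure S F = (\<integral>\<^sup>+\<omega>. ennreal c * indicator F \<omega> \<partial>S)"
      by (simp add: nn_integral_cmult)
    also have "\<dots> \<le> (\<integral>\<^sup>+\<omega>. emeasure S {\<omega>' \<in> space S. comb_seq t \<omega> \<omega>' \<in> F \<inter> E} \<partial>S)"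
    proof (intro nn_integral_mono)
      fix \<omega> assume w: "\<omega> \<in> space S"
      show "ennreal c * indicator F \<omega> \<le> emeasure S {\<omega>' \<in> space S. comb_seq t \<omega> \<omega>' \<in> F \<inter> E}"
      proof (cases "\<omega> \<in> F")
        case True
        have "{\<omega>' \<in> space S. comb_seq t \<omega> \<omega>' \<in> F \<inter> E} = {\<omega>' \<in> space S. comb_seq t \<omega> \<omega>' \<in> E}"
          using F(1) True w by (auto simp: determined_def)
        moreover have "c \<le> P.prob {\<omega>' \<in> space S. comb_seq t \<omega> \<omega>' \<in> E}"
          using True F(2) by (intro c(2)) auto
        ultimately show ?thesis
          using True by (simp add: P.emeasure_eq_measure)
      qed simp
    qed
    also have "\<dots> = emeasure S (F \<inter> E)"
      by (intro emeasure_comb_seq[symmetric]) measurable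
    finally show ?thesis
      using c(1) by (simp add: P.emeasure_eq_measure ennreal_mult[symmetric])
  qed
  have two: "c * P.prob (A \<inter> G) \<le> P.prob (A \<inter> E)" if A: "determined T A" for T A
  proof -
    note [measurable] = determined_sets[OF A]
    define F where "F n = A \<inter> Good (T + n) \<inter> (space S - (\<Union>k<n. Good (T + k)))" for n
    have det: "determined (T + n) (F n)" for n
      unfolding F_def
      by (intro determined_Int determined_Diff determined_space determined_UN Good
          determined_mono[OF A] determined_mono[OF Good]) auto
    note [measurable] = determined_sets[OF det]
    have disj: "disjoint_family F"
      unfolding disjoint_family_on_def
    proof (intro ballI impI)
      fix i j :: nat assume "i \<noteq> j"
      then show "F i \<inter> F j = {}"
        by (cases i j rule: linorder_cases) (auto simp: F_def)
    qed
    have sF: "(\<lambda>n. P.prob (F n)) sums P.prob (\<Union>n. F n)"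
      by (intro P.finite_measure_UNION disj) auto
    have sFE: "(\<lambda>n. P.prob (F n \<inter> E)) sums P.prob (\<Union>n. F n \<inter> E)"
      using disj by (intro P.finite_measure_UNION) (auto simp: disjoint_family_on_def)
    have "A \<inter> G \<subseteq> (\<Union>n. F n)"
    proof
      fix \<omega> assume w: "\<omega> \<in> A \<inter> G"
      then obtain n where "\<omega> \<in> Good (T + n)"
        unfolding G_def INFM_nat_le by (auto simp: le_iff_add) 
      then have ex: "\<exists>n. \<omega> \<in> Good (T + n)" ..
      have "\<omega> \<in> F (LEAST n. \<omega> \<in> Good (T + n))"
        using w LeastI_ex[OF ex] not_less_Least[of _ "\<lambda>n. \<omega> \<in> Good (T + n)"]
        by (auto simp: F_def G_def)
      then show "\<omega> \<in> (\<Union>n. F n)" by blast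
    qed
    then have "c * P.prob (A \<inter> G) \<le> c * P.prob (\<Union>n. F n)"
      using c(1) by (intro mult_left_mono P.finite_measure_mono) auto
    also have "\<dots> \<le> P.prob (\<Union>n. F n \<inter> E)"
      using one[OF det] by (intro sums_le[OF _ sums_mult[OF sF] sFE]) (auto simp: F_def)
    also have "\<dots> \<le> P.prob (A \<inter> E)"
      by (intro P.finite_measure_mono) (auto simp: F_def)
    finally show ?thesis .
  qed
  define B where "B = G - E"
  have [measurable]: "B \<in> sets S" by (simp add: B_def)
  have "c * P.prob B \<le> 0 + e" if "e > 0" for e
  proof -
    have "e / (c + 1) > 0" using that c(1) by simp
    from determined_approx[OF _ this, of B] obtain T A where
      A: "determined T A" "P.prob ((A - B) \<union> (B - A)) < e / (c + 1)" by auto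
    note [measurable] = determined_sets[OF A(1)]
    have "P.prob B \<le> P.prob ((A \<inter> G) \<union> ((A - B) \<union> (B - A)))"
      by (intro P.finite_measure_mono) (auto simp: B_def)
    also have "\<dots> \<le> P.prob (A \<inter> G) + P.prob ((A - B) \<union> (B - A))"
      by (intro measure_Un_le) auto
    finally have "c * P.prob B \<le> c * P.prob (A \<inter> G) + c * P.prob ((A - B) \<union> (B - A))"
      using c(1) by (simp add: distrib_left[symmetric])
    also have "c * P.prob (A \<inter> G) \<le> P.prob (A \<inter> E)" by (rule two[OF A(1)])
    also have "P.prob (A \<inter> E) \<le> P.prob ((A - B) \<union> (B - A))"
      by (intro P.finite_measure_mono) (auto simp: B_def)
    finally have "c * P.prob B \<le> (c + 1) * P.prob ((A - B) \<union> (B - A))"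
      by (simp add: algebra_simps)
    also have "\<dots> \<le> (c + 1) * (e / (c + 1))"
      using A(2) c(1) by (intro mult_left_mono) auto
    finally show ?thesis using c(1) by simp
  qed
  then have "c * P.prob B \<le> 0" by (rule field_le_epsilon)
  then have "P.prob B = 0"
    using c(1) by (simp add: mult_le_0_iff measure_le_0_iff)
  then have "AE \<omega> in S. \<omega> \<notin> B"
    by (subst AE_iff_measurable[OF _ refl]) (auto simp: P.emeasure_eq_measure Int_absorb1[OF sets.sets_into_space] Collect_conj_eq)
  with AE_space[of S] show ?thesis
  proof eventually_elim
    case (elim \<omega>)
    then show ?case unfolding B_def G_def by blast
  qed
qed

lemma indep_coordinates: "P.indep_vars (\<lambda>_. M) (\<lambda>i \<omega>. \<omega> i) UNIV"
proof -
  have "distr S (PiM UNIV (\<lambda>_. M)) (\<lambda>x. \<lambda>i\<in>UNIV. x i) = S"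
    by (simp add: restrict_UNIV distr_id2)
  moreover have "PiM UNIV (\<lambda>i. distr S M (\<lambda>x. x i)) = S"
    by (intro PiM_cong refl PiM_component) auto
  ultimately show ?thesis
    by (subst P.indep_vars_iff_distr_eq_PiM) auto
qed

text \<open>
The moment generating function of a centred summand bounded by 1 is at most \<open>exp (l\<^sup>2)\<close>.
\<close>

lemma chernoff:
  fixes l a :: real
  assumes g [measurable]: "g \<in> borel_measurable M" and bd: "\<And>x. x \<in> space M \<Longrightarrow> \<bar>g x\<bar> \<le> (1::real)"
    and mean: "(\<integral>x. g x \<partial>M) \<le> 0" and fin: "finite I" and l: "0 \<le> l" "l \<le> 1"
  shows "P.prob {\<omega> \<in> space S. a \<le> (\<Sum>i\<in>I. g (\<omega> i))} \<le> exp (l\<^sup>2 * card I - l * a)"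
proof -
  have int: "integrable M g"
    using bd by (intro M.integrable_const_bound[of _ 1]) auto
  have int2: "integrable M (\<lambda>x. exp (l * g x))"
  proof (intro M.integrable_const_bound[of _ "exp 1"])
    have "l * g x \<le> 1" if "x \<in> space M" for x
      using bd[OF that] l by (intro order_trans[OF mult_left_mono[of "g x" 1 l]]) auto
    then show "AE x in M. norm (exp (l * g x)) \<le> exp 1" by auto
  qed auto
  have "(\<integral>x. exp (l * g x) \<partial>M) \<le> (\<integral>x. 1 + l * g x + l\<^sup>2 \<partial>M)"
  proof (intro integral_mono int2)
    show "integrable M (\<lambda>x. 1 + l * g x + l\<^sup>2)" using int by auto
    fix x assume x: "x \<in> space M"
    have "\<bar>l * g x\<bar> \<le> l" using bd[OF x] l by (simp add: abs_mult mult_left_le)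
    then have "exp (l * g x) \<le> 1 + l * g x + (l * g x)\<^sup>2"
      using l by (intro exp_le_quadratic) auto
    moreover have "(l * g x)\<^sup>2 \<le> l\<^sup>2"
      using \<open>\<bar>l * g x\<bar> \<le> l\<close> l by (simp add: abs_le_square_iff[symmetric])
    ultimately show "exp (l * g x) \<le> 1 + l * g x + l\<^sup>2" by simp
  qed
  also have "\<dots> = 1 + l * (\<integral>x. g x \<partial>M) + l\<^sup>2"
    using int by (simp add: M.prob_space)
  also have "\<dots> \<le> 1 + l\<^sup>2" using mean l by (simp add: mult_nonneg_nonpos)
  also have "\<dots> \<le> exp (l\<^sup>2)" by (rule exp_ge_add_one_self)
  finally have mgf: "(\<integral>x. exp (l * g x) \<partial>M) \<le> exp (l\<^sup>2)" .
  have "(\<integral>\<^sup>+\<omega>. (\<Prod>i\<in>I. ennreal (exp (l * g (\<omega> i)))) \<partial>S) = (\<Prod>i\<in>I. \<integral>\<^sup>+\<omega>. ennreal (exp (l * g (\<omega> i))) \<partial>S)"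
  proof (rule P.indep_vars_nn_integral[OF fin])
    have "P.indep_vars (\<lambda>_. M) (\<lambda>i \<omega>. \<omega> i) I"
      using indep_coordinates by (rule P.indep_vars_subset) simp
    then show "P.indep_vars (\<lambda>_. borel) (\<lambda>i \<omega>. ennreal (exp (l * g (\<omega> i)))) I"
      by (rule P.indep_vars_compose2) auto
  qed simp
  also have "\<dots> \<le> (\<Prod>i\<in>I. ennreal (exp (l\<^sup>2)))"
  proof (intro prod_mono_ennreal)
    fix i assume "i \<in> I"
    have "(\<integral>\<^sup>+\<omega>. ennreal (exp (l * g (\<omega> i))) \<partial>S) = (\<integral>\<^sup>+x. ennreal (exp (l * g x)) \<partial>distr S M (\<lambda>\<omega>. \<omega> i))"
      by (intro nn_integral_distr[symmetric]) auto
    also have "distr S M (\<lambda>\<omega>. \<omega> i) = M" by (rule PiM_component) simp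
    also have "(\<integral>\<^sup>+x. ennreal (exp (l * g x)) \<partial>M) = ennreal (\<integral>x. exp (l * g x) \<partial>M)"
      by (intro nn_integral_eq_integral int2) auto
    also have "\<dots> \<le> ennreal (exp (l\<^sup>2))" using mgf by (rule ennreal_leI)
    finally show "(\<integral>\<^sup>+\<omega>. ennreal (exp (l * g (\<omega> i))) \<partial>S) \<le> ennreal (exp (l\<^sup>2))" .
  qed
  also have "\<dots> = ennreal (exp (l\<^sup>2 * card I))"
    by (simp add: ennreal_power exp_of_nat_mult[symmetric] mult.commute)
  finally have 1: "(\<integral>\<^sup>+\<omega>. (\<Prod>i\<in>I. ennreal (exp (l * g (\<omega> i)))) \<partial>S) \<le> ennreal (exp (l\<^sup>2 * card I))" .
  have "emeasure S {\<omega> \<in> space S. a \<le> (\<Sum>i\<in>I. g (\<omega> i))}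
      = (\<integral>\<^sup>+\<omega>. indicator {\<omega> \<in> space S. a \<le> (\<Sum>i\<in>I. g (\<omega> i))} \<omega> \<partial>S)"
    by (intro nn_integral_indicator[symmetric]) measurable
  also have "\<dots> \<le> (\<integral>\<^sup>+\<omega>. ennreal (exp (- l * a)) * (\<Prod>i\<in>I. ennreal (exp (l * g (\<omega> i)))) \<partial>S)"
  proof (intro nn_integral_mono)
    fix \<omega>
    have "(\<Prod>i\<in>I. ennreal (exp (l * g (\<omega> i)))) = ennreal (exp (l * (\<Sum>i\<in>I. g (\<omega> i))))"
      using fin by (simp add: prod_ennreal exp_sum sum_distrib_left)
    then have "ennreal (exp (- l * a)) * (\<Prod>i\<in>I. ennreal (exp (l * g (\<omega> i))))
       = ennreal (exp (l * ((\<Sum>i\<in>I. g (\<omega> i)) - a)))"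
      by (simp add: ennreal_mult[symmetric] exp_add[symmetric] algebra_simps)
    moreover have "1 \<le> exp (l * ((\<Sum>i\<in>I. g (\<omega> i)) - a))" if "a \<le> (\<Sum>i\<in>I. g (\<omega> i))"
      using that l by simp
    ultimately show "indicator {\<omega> \<in> space S. a \<le> (\<Sum>i\<in>I. g (\<omega> i))} \<omega> \<le>
        ennreal (exp (- l * a)) * (\<Prod>i\<in>I. ennreal (exp (l * g (\<omega> i))))"
      by (auto simp: indicator_def)
  qed
  also have "\<dots> = ennreal (exp (- l * a)) * (\<integral>\<^sup>+\<omega>. (\<Prod>i\<in>I. ennreal (exp (l * g (\<omega> i)))) \<partial>S)"
    by (intro nn_integral_cmult) measurable
  also have "\<dots> \<le> ennreal (exp (- l * a)) * ennreal (exp (l\<^sup>2 * card I))"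
    using 1 by (rule mult_left_mono) simp
  also have "\<dots> = ennreal (exp (l\<^sup>2 * card I - l * a))"
    by (simp add: ennreal_mult[symmetric] exp_add[symmetric])
  finally show ?thesis
    by (simp add: P.emeasure_eq_measure)
qed

text \<open>
The strong law of large numbers for indicators. The Chernoff bound makes the probabilities of
deviations by \<open>e\<close> summable, so the Borel--Cantelli lemma applies.
\<close>

lemma frequency_tendsto:
  assumes A [measurable]: "A \<in> sets M"
  shows "AE \<omega> in S. (\<lambda>t. (\<Sum>i<t. indicator A (\<omega> i)) / real t) \<longlonglongrightarrow> measure M A"
proof -
  define p where "p = measure M A"
  have p: "0 \<le> p" "p \<le> 1" by (simp_all add: p_def)
  let ?N = "\<lambda>t \<omega>. \<Sum>i<t. indicator A (\<omega> i) :: real"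
  have key: "AE \<omega> in S. \<forall>\<^sub>F t in sequentially. \<bar>?N t \<omega> / real t - p\<bar> < e" if e: "0 < e" "e \<le> 1" for e
  proof -
    define B where "B t = {\<omega> \<in> space S. e * t \<le> (\<Sum>i<t. indicator A (\<omega> i) - p)} \<union>
      {\<omega> \<in> space S. e * t \<le> (\<Sum>i<t. p - indicator A (\<omega> i))}" for t :: nat
    have [measurable]: "B t \<in> sets S" for t unfolding B_def by measurable
    have int: "(\<integral>x. indicator A x - p \<partial>M) = 0" "(\<integral>x. p - indicator A x \<partial>M) = 0"
      by (simp_all add: p_def M.prob_space M.emeasure_eq_measure integrable_real_indicator)
    have ex: "(e / 2)\<^sup>2 * real t - e / 2 * (e * real t) = real t * (- (e\<^sup>2 / 4))" for t
      by (simp add: power2_eq_square field_simps)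
    have bnd: "P.prob (B t) \<le> 2 * exp (- (e\<^sup>2 / 4)) ^ t" for t
    proof -
      have "P.prob (B t) \<le> P.prob {\<omega> \<in> space S. e * t \<le> (\<Sum>i<t. indicator A (\<omega> i) - p)} +
        P.prob {\<omega> \<in> space S. e * t \<le> (\<Sum>i<t. p - indicator A (\<omega> i))}"
        unfolding B_def by (intro measure_Un_le) measurable
      also have "\<dots> \<le> exp ((e/2)\<^sup>2 * card {..<t} - e/2 * (e * t)) + exp ((e/2)\<^sup>2 * card {..<t} - e/2 * (e * t))"
        using e p int by (intro add_mono chernoff) (auto simp: indicator_def)
      also have "\<dots> = 2 * exp (- (e\<^sup>2 / 4)) ^ t"
        unfolding card_lessThan ex exp_of_nat_mult by simp
      finally show ?thesis .
    qed
    have "summable (\<lambda>t. 2 * exp (- (e\<^sup>2 / 4)) ^ t)"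
      using e by (intro summable_mult summable_geometric) simp
    then have "summable (\<lambda>t. P.prob (B t))"
      by (rule summable_comparison_test'[where N = 0]) (simp only: real_norm_def abs_of_nonneg measure_nonneg bnd)
    then have "AE \<omega> in S. \<forall>\<^sub>F t in sequentially. \<omega> \<in> space S - B t"
      by (intro borel_cantelli_AE1) (auto simp: P.emeasure_eq_measure)
    then show ?thesis
    proof eventually_elim
      case (elim \<omega>)
      from elim eventually_gt_at_top[of 0] show ?case
      proof eventually_elim
        case (elim t)
        then have "\<bar>?N t \<omega> - t * p\<bar> < e * t"
          by (auto simp: B_def sum_subtractf)
        moreover have "?N t \<omega> / real t - p = (?N t \<omega> - t * p) / t"
          using elim by (simp add: field_simps)
        ultimately show ?case
          using elim by (simp add: abs_divide pos_divide_less_eq)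
      qed
    qed
  qed
  have "AE \<omega> in S. \<forall>k::nat. \<forall>\<^sub>F t in sequentially. \<bar>?N t \<omega> / real t - p\<bar> < 1 / real (Suc k)"
    by (intro AE_all_countable[THEN iffD2] allI key) auto
  then show ?thesis
  proof eventually_elim
    case (elim \<omega>)
    show ?case unfolding p_def[symmetric]
    proof (rule tendstoI)
      fix e :: real assume "e > 0"
      then obtain k where "1 / real (Suc k) < e" using nat_approx_posE by blast
      with elim[rule_format, of k] show "\<forall>\<^sub>F t in sequentially. dist (?N t \<omega> / real t) p < e"
        by (auto simp: dist_real_def elim!: eventually_mono)
    qed
  qed
qed

end

section \<open>The law of a single draw\<close>

lemma measurable_low [measurable]: "low \<in> borel_measurable (borel \<Otimes>\<^sub>M borel)"
  unfolding low_def by measurable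

lemma measurable_mid [measurable]: "mid \<in> borel_measurable (borel \<Otimes>\<^sub>M borel)"
  unfolding mid_def by measurable

locale opinions =
  fixes r :: real and \<mu> :: "real measure"
  assumes r: "0 < r" "r < 1" and mu: "real_distribution \<mu>"
begin

sublocale D: real_distribution \<mu> by (rule mu)
sublocale Z: pair_prob_space \<mu> \<mu> ..
sublocale SP: sequence_space "\<mu> \<Otimes>\<^sub>M \<mu>" ..

abbreviation "Z \<equiv> \<mu> \<Otimes>\<^sub>M \<mu>"
abbreviation "\<S> \<equiv> SP.S"
abbreviation "prb \<equiv> measure \<S>"

text \<open>
\<open>tail m\<close> is the probability that a candidate exceeds \<open>m\<close>, and \<open>mid_ge m\<close> the probability that the midpoint of a
pair is at least \<open>m\<close>, so that \<open>rho r \<mu> m\<close> is \<open>(tail m)\<^sup>2 / mid_ge m - (1 - r)\<close>.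
\<close>

definition tail where "tail m = measure \<mu> {m<..}"
definition mid_ge where "mid_ge m = measure Z {z. m \<le> mid z}"

lemma sets_Z [measurable_cong]: "sets Z = sets (borel \<Otimes>\<^sub>M borel)"
  by (intro sets_pair_measure_cong D.events_eq_borel)

lemma space_Z [simp]: "space Z = UNIV"
  by (simp add: space_pair_measure)

lemma space_S [simp]: "space \<S> = UNIV"
  by (simp add: space_PiM)

lemma measure_low: "measure Z {z. m < low z} = (tail m)\<^sup>2"
proof -
  have "{z. m < low z} = {m<..} \<times> {m<..}"
    by (auto simp: low_def)
  then show ?thesis
    by (simp add: tail_def measure_def D.emeasure_pair_measure_Times enn2real_mult power2_eq_square)
qed

lemma rho_eq: "rho r \<mu> m = (tail m)\<^sup>2 / mid_ge m - (1 - r)"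
proof -
  have "measure (\<mu> \<star> \<mu>) {2 * m..} = mid_ge m"
    unfolding convolution_def mid_ge_def
    by (subst measure_distr) (auto simp: mid_def field_simps intro!: arg_cong[where f = "measure _"])
  then show ?thesis by (simp add: rho_def tail_def)
qed

lemma measurable_draw:
  assumes "w \<in> N \<rightarrow>\<^sub>M \<S>"
  shows "(\<lambda>x. w x t) \<in> N \<rightarrow>\<^sub>M borel \<Otimes>\<^sub>M borel"
proof -
  have "(\<lambda>x. w x t) \<in> N \<rightarrow>\<^sub>M Z"
    by (rule measurable_compose[OF assms measurable_component_singleton]) simp
  then show ?thesis using measurable_cong_sets[OF refl sets_Z] by blast
qed

text \<open>
The level may depend on the sample. This generality is needed because a pair of candidates is
compared with the club at the level of its own midpoint.
\<close>

lemma measurable_above: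
  assumes [measurable]: "g \<in> borel_measurable N"
  shows "(\<lambda>x. above (g x) C) \<in> borel_measurable N"
proof (induction C)
  case (add s C)
  note [measurable] = add
  show ?case unfolding above_add by measurable
qed simp

lemma measurable_admits [measurable]: "Measurable.pred Z (\<lambda>z. admits r C z)"
  unfolding admits_def excess_def using measurable_above[of mid Z C] by measurable

lemma measurable_run:
  assumes [measurable]: "w \<in> N \<rightarrow>\<^sub>M \<S>"
  shows "(\<lambda>x. real (size (run r C (w x) t))) \<in> borel_measurable N"
    and "\<And>g. g \<in> borel_measurable N \<Longrightarrow> (\<lambda>x. above (g x) (run r C (w x) t)) \<in> borel_measurable N"
proof (induction t)
  case 0
  case 1 show ?case by simp
  case 2 then show ?case by (simp add: measurable_above)
next
  case (Suc t)
  note IH = Suc.IH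
  note [measurable] = measurable_draw[OF assms]
  have [measurable]: "(\<lambda>x. real (size (run r C (w x) t))) \<in> borel_measurable N" by (rule IH)
  have [measurable]: "(\<lambda>x. above (mid (w x t)) (run r C (w x) t)) \<in> borel_measurable N"
    by (rule IH) measurable
  have [measurable]: "Measurable.pred N (\<lambda>x. admits r (run r C (w x) t) (w x t))"
    unfolding admits_def excess_def by measurable
  { case 1
  show ?case
    by (simp add: step_def if_distrib[of size] if_distrib[of real] cong: if_cong) }
  case 2
  note [measurable] = 2 IH(2)[OF 2]
  show ?case
    by (simp add: step_def if_distrib[of "above _"] above_add cong: if_cong)
qed

lemma measurable_excess [measurable (raw)]:
  assumes "w \<in> N \<rightarrow>\<^sub>M \<S>" "g \<in> borel_measurable N"
  shows "(\<lambda>x. excess r (g x) (run r C (w x) t)) \<in> borel_measurable N"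
  unfolding excess_def using measurable_run[OF assms(1)] assms(2) by measurable

lemma measurable_quantile [measurable (raw)]:
  assumes [measurable]: "w \<in> N \<rightarrow>\<^sub>M \<S>"
  shows "(\<lambda>x. quantile r (run r C (w x) t)) \<in> borel_measurable N"
proof (cases "t = 0")
  case False
  show ?thesis
  proof (rule borel_measurableI_le)
    fix a
    have "{x \<in> space N. quantile r (run r C (w x) t) \<le> a} = {x \<in> space N. excess r a (run r C (w x) t) \<le> 0}"
      using False r by (simp add: quantile_le_iff run_nonempty)
    also have "\<dots> \<in> sets N" by measurable
    finally show "{x \<in> space N. quantile r (run r C (w x) t) \<le> a} \<in> sets N" .
  qed
qed simp

section \<open>Hitting probabilities\<close>

text \<open>
A function \<open>f\<close> of the state that does not increase on average outside of the bad and the winning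
states, and that is at least 1 on bad states, bounds the probability of reaching a bad state before a
winning one. The induction on the time horizon conditions on the first draw.
\<close>

lemma hitting_probability_le:
  fixes f :: "real multiset \<Rightarrow> ennreal"
  assumes [measurable]: "\<And>C j. Measurable.pred \<S> (\<lambda>\<omega>. bad (run r C \<omega> j))"
      "\<And>C j. Measurable.pred \<S> (\<lambda>\<omega>. win (run r C \<omega> j))"
    and bad: "\<And>C. bad C \<Longrightarrow> 1 \<le> f C"
    and super: "\<And>C. \<not> bad C \<Longrightarrow> \<not> win C \<Longrightarrow> (\<integral>\<^sup>+z. f (step r C z) \<partial>Z) \<le> f C"
  shows "emeasure \<S> {\<omega>. \<exists>j. bad (run r C \<omega> j) \<and> (\<forall>i<j. \<not> win (run r C \<omega> i))} \<le> f C"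
proof -
  define H where "H T C = {\<omega>. \<exists>j\<le>T. bad (run r C \<omega> j) \<and> (\<forall>i<j. \<not> win (run r C \<omega> i))}" for T C
  have [measurable]: "H T C \<in> sets \<S>" for T C
  proof -
    have "{\<omega> \<in> space \<S>. \<exists>j\<le>T. bad (run r C \<omega> j) \<and> (\<forall>i<j. \<not> win (run r C \<omega> i))} \<in> sets \<S>"
      by measurable
    then show ?thesis by (simp add: H_def)
  qed
  have "emeasure \<S> (H T C) \<le> f C" for T C
  proof (induction T arbitrary: C)
    case 0
    show ?case
    proof (cases "bad C")
      case True
      then show ?thesis
        using bad[OF True] SP.P.emeasure_le_1 order_trans by blast
    qed (simp add: H_def)
  next
    case (Suc T)
    show ?case
    proof (cases "bad C")
      case True
      then show ?thesis
        using bad[OF True] SP.P.emeasure_le_1 order_trans by blast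
    next
      case nb: False
      show ?thesis
      proof (cases "win C")
        case True
        have "H (Suc T) C = {}"
        proof -
          have False if "bad (run r C \<omega> j)" "\<forall>i<j. \<not> win (run r C \<omega> i)" for \<omega> j
            using that nb True by (cases j) auto
          then show ?thesis by (auto simp: H_def)
        qed
        then show ?thesis by simp
      next
        case nw: False
        have eq: "case_nat z \<omega> \<in> H (Suc T) C \<longleftrightarrow> \<omega> \<in> H T (step r C z)" for z \<omega>
        proof
          assume "case_nat z \<omega> \<in> H (Suc T) C"
          then obtain j where j: "j \<le> Suc T" "bad (run r C (case_nat z \<omega>) j)"
            "\<forall>i<j. \<not> win (run r C (case_nat z \<omega>) i)" by (auto simp: H_def)
          with nb obtain j' where j': "j = Suc j'" by (cases j) auto
          have "bad (run r (step r C z) \<omega> j')" "j' \<le> T"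
            using j unfolding j' run_case_nat by simp_all
          moreover have "\<not> win (run r (step r C z) \<omega> i)" if "i < j'" for i
            using j(3)[rule_format, of "Suc i"] that unfolding j' run_case_nat by simp
          ultimately show "\<omega> \<in> H T (step r C z)" by (auto simp: H_def)
        next
          assume "\<omega> \<in> H T (step r C z)"
          then obtain j where j: "j \<le> T" "bad (run r (step r C z) \<omega> j)"
            "\<forall>i<j. \<not> win (run r (step r C z) \<omega> i)" by (auto simp: H_def)
          have "\<not> win (run r C (case_nat z \<omega>) i)" if "i < Suc j" for i
          proof (cases i)
            case (Suc i')
            with that j(3) show ?thesis by (simp only: Suc run_case_nat) auto
          qed (use nw in simp)
          moreover have "bad (run r C (case_nat z \<omega>) (Suc j))" "Suc j \<le> Suc T"
            using j unfolding run_case_nat by simp_all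
          ultimately show "case_nat z \<omega> \<in> H (Suc T) C"
            unfolding H_def by blast
        qed
        have "emeasure \<S> (H (Suc T) C) = (\<integral>\<^sup>+z. emeasure \<S> {\<omega> \<in> space \<S>. case_nat z \<omega> \<in> H (Suc T) C} \<partial>Z)"
          by (rule SP.emeasure_case_nat) measurable
        also have "\<dots> = (\<integral>\<^sup>+z. emeasure \<S> (H T (step r C z)) \<partial>Z)"
          by (simp add: eq)
        also have "\<dots> \<le> (\<integral>\<^sup>+z. f (step r C z) \<partial>Z)"
          by (intro nn_integral_mono Suc.IH)
        also have "\<dots> \<le> f C" by (rule super[OF nb nw])
        finally show ?thesis .
      qed
    qed
  qed
  moreover have "(\<lambda>T. emeasure \<S> (H T C)) \<longlonglongrightarrow> emeasure \<S> (\<Union>T. H T C)"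
  proof (rule Lim_emeasure_incseq)
    show "incseq (\<lambda>T. H T C)"
      unfolding incseq_def H_def by (auto intro: order_trans)
  qed auto
  ultimately have "emeasure \<S> (\<Union>T. H T C) \<le> f C"
    by (intro LIMSEQ_le_const2) auto
  moreover have "(\<Union>T. H T C) = {\<omega>. \<exists>j. bad (run r C \<omega> j) \<and> (\<forall>i<j. \<not> win (run r C \<omega> i))}"
    by (auto simp: H_def)
  ultimately show ?thesis by simp
qed

text \<open>
The constant of \<open>drift_barrier\<close> for a drift \<open>e\<close>: with \<open>l = e / 2\<close> the exponential \<open>exp (- l * V)\<close>
shrinks on average at least by the factor \<open>1 - e\<^sup>2 / 4\<close> with each admission, and \<open>escape_gain e\<close> is
\<open>e\<^sup>2 / 4 * exp (- l)\<close>.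
\<close>

definition escape_gain :: "real \<Rightarrow> real" where
  "escape_gain e = e\<^sup>2 / 4 * exp (- e / 2)"

lemma escape_gain_pos: "e > 0 \<Longrightarrow> escape_gain e > 0"
  by (simp add: escape_gain_def)

text \<open>
The quantity \<open>V\<close> moves up by \<open>a\<close> or down by \<open>1 - a\<close> with each admission, and the drift
hypothesis says that its mean increment per admission is at least \<open>e\<close>. Hence \<open>exp (- l * V)\<close> is a
supermartingale, but at a start with \<open>V\<close> close to 0 this alone gives only the trivial bound 1. The
strict decrease of the exponential leaves room for an extra reward \<open>escape_gain e\<close> on bad states, and this
separates the value there, at least \<open>1 + escape_gain e\<close>, from the value at the start, at most 1.

Admissions may be rare, but only the conditional mean given an admission enters, so the bound is
uniform in the state.
\<close>

lemma drift_barrier: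
  fixes V :: "real multiset \<Rightarrow> real"
  assumes [measurable]: "\<And>C j. Measurable.pred \<S> (\<lambda>\<omega>. bad (run r C \<omega> j))"
      "\<And>C j. Measurable.pred \<S> (\<lambda>\<omega>. win (run r C \<omega> j))"
      "Measurable.pred Z U"
    and a: "0 < a" "a < 1" and e: "0 < e" "e \<le> 1"
    and V: "\<And>C z. V (step r C z) = V C + (if admits r C z then (if U z then a else a - 1) else 0)"
    and bad: "\<And>C. bad C \<Longrightarrow> V C \<le> 0" "\<And>C. \<not> bad C \<Longrightarrow> 0 \<le> V C" "\<And>C. 0 < V C \<Longrightarrow> \<not> bad C"
    and drift: "\<And>C. \<not> bad C \<Longrightarrow> \<not> win C \<Longrightarrow>
       (1 - a + e) * measure Z {z. admits r C z} \<le> measure Z {z. admits r C z \<and> U z}"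
    and C: "\<not> bad C"
  shows "prb {\<omega>. \<exists>j. bad (run r C \<omega> j) \<and> (\<forall>i<j. \<not> win (run r C \<omega> i))} \<le> 1 / (1 + escape_gain e)"
proof -
  \<comment> \<open>this value minimises the bound \<open>1 - l * e + l\<^sup>2\<close> for the exponential moment of one admission\<close>
  define l where "l = e / 2"
  define \<kappa> where "\<kappa> = escape_gain e"
  have \<kappa>: "\<kappa> > 0" using escape_gain_pos e by (simp add: \<kappa>_def)
  have \<kappa>l: "\<kappa> * exp l = e\<^sup>2 / 4"
    by (simp add: \<kappa>_def escape_gain_def l_def exp_minus)
  have l: "0 < l" "l \<le> 1" using e by (auto simp: l_def)
  define f where "f C = ennreal ((exp (- l * V C) + \<kappa> * of_bool (bad C)) / (1 + \<kappa>))" for C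
  have f1: "1 \<le> f C" if "bad C" for C
  proof -
    have "1 \<le> exp (- l * V C)" using bad(1)[OF that] l by (simp add: mult_nonneg_nonpos)
    then have "1 \<le> (exp (- l * V C) + \<kappa> * of_bool (bad C)) / (1 + \<kappa>)"
      using that \<kappa> by simp
    then show ?thesis unfolding f_def by (metis ennreal_1 ennreal_leI)
  qed
  have super: "(\<integral>\<^sup>+z. f (step r C z) \<partial>Z) \<le> f C" if nb: "\<not> bad C" and nw: "\<not> win C" for C
  proof -
    define v where "v = V C"
    define u where "u = exp (- l * v)"
    have v: "0 \<le> v" using bad(2)[OF nb] by (simp add: v_def)
    have u: "0 < u" by (simp add: u_def)
    define A where "A = measure Z {z. admits r C z}"
    define B where "B = measure Z {z. admits r C z \<and> U z}"
    define h where "h z = (u * (indicator {z. \<not> admits r C z} z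
        + exp (- l * a) * indicator {z. admits r C z \<and> U z} z
        + (exp (l * (1 - a)) + e\<^sup>2 / 4) * indicator {z. admits r C z \<and> \<not> U z} z)) / (1 + \<kappa>)" for z
    have hk: "h z * (1 + \<kappa>) = u * (indicator {z. \<not> admits r C z} z
        + exp (- l * a) * indicator {z. admits r C z \<and> U z} z
        + (exp (l * (1 - a)) + e\<^sup>2 / 4) * indicator {z. admits r C z \<and> \<not> U z} z)" for z
      using \<kappa> by (simp add: h_def)
    have [measurable]: "{z. \<not> admits r C z} \<in> sets Z" "{z. admits r C z \<and> U z} \<in> sets Z"
        "{z. admits r C z \<and> \<not> U z} \<in> sets Z" "{z. admits r C z} \<in> sets Z"
    proof -
      have "{z \<in> space Z. \<not> admits r C z} \<in> sets Z" "{z \<in> space Z. admits r C z \<and> U z} \<in> sets Z"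
        "{z \<in> space Z. admits r C z \<and> \<not> U z} \<in> sets Z" "{z \<in> space Z. admits r C z} \<in> sets Z"
        by measurable
      then show "{z. \<not> admits r C z} \<in> sets Z" "{z. admits r C z \<and> U z} \<in> sets Z"
        "{z. admits r C z \<and> \<not> U z} \<in> sets Z" "{z. admits r C z} \<in> sets Z"
        by simp_all
    qed
    have fh: "f (step r C z) \<le> ennreal (h z)" for z
    proof -
      have "exp (- l * V (step r C z)) + \<kappa> * of_bool (bad (step r C z)) \<le> h z * (1 + \<kappa>)"
      proof (cases "admits r C z")
        case False
        then have "step r C z = C" by (simp add: step_def)
        then show ?thesis unfolding hk using False nb by (simp add: u_def v_def)
      next
        case adm: True
        show ?thesis
        proof (cases "U z")
          case True
          then have "V (step r C z) = v + a" by (simp add: V adm v_def)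
          moreover from this have "\<not> bad (step r C z)" using bad(3) v a by simp
          ultimately show ?thesis
            unfolding hk using adm True by (simp add: u_def exp_add[symmetric] algebra_simps)
        next
          case False
          then have V': "V (step r C z) = v - (1 - a)" by (simp add: V adm v_def)
          have "\<kappa> * of_bool (bad (step r C z)) \<le> u * (e\<^sup>2 / 4)"
          proof (cases "bad (step r C z)")
            case True
            then have "v \<le> 1" using bad(1)[OF True] V' a by simp
            then have "1 \<le> exp (l * (1 - v))" using l by simp
            also have "\<dots> = u * exp l" by (simp add: u_def exp_add[symmetric] algebra_simps)
            finally have "\<kappa> * 1 \<le> \<kappa> * (u * exp l)" using \<kappa> by (intro mult_left_mono) auto
            also have "\<dots> = u * (\<kappa> * exp l)" by simp
            finally show ?thesis using True by (simp add: \<kappa>l)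
          qed (use u in simp)
          moreover have "exp (- l * V (step r C z)) = u * exp (l * (1 - a))"
            by (simp add: V' u_def exp_add[symmetric] algebra_simps)
          ultimately show ?thesis
            unfolding hk using adm False by (simp add: distrib_left)
        qed
      qed
      then show ?thesis
        unfolding f_def using \<kappa> by (intro ennreal_leI) (simp add: pos_divide_le_eq)
    qed
    have "B \<le> A" unfolding A_def B_def
    proof (rule Z.P.finite_measure_mono)
      show "{z. admits r C z} \<in> sets Z" by measurable
    qed auto
    then have AB: "(1 - a + e) * A \<le> B" "B \<le> A" "0 \<le> A"
      using drift[OF nb nw] by (auto simp: A_def B_def)
    have mA: "measure Z {z. \<not> admits r C z} = 1 - A"
    proof -
      have "{z. \<not> admits r C z} = space Z - {z. admits r C z}" by auto
      moreover have "measure Z (space Z - {z. admits r C z}) = 1 - A"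
        unfolding A_def by (rule Z.P.prob_compl) measurable
      ultimately show ?thesis by simp
    qed
    have mB: "measure Z {z. admits r C z \<and> \<not> U z} = A - B"
    proof -
      have "{z. admits r C z \<and> \<not> U z} = {z. admits r C z} - {z. admits r C z \<and> U z}" by auto
      moreover have "measure Z ({z. admits r C z} - {z. admits r C z \<and> U z}) = A - B"
        unfolding A_def B_def
      proof (rule Z.P.finite_measure_Diff)
        show "{z. admits r C z} \<in> sets Z" "{z. admits r C z \<and> U z} \<in> sets Z" by measurable
      qed auto
      ultimately show ?thesis by simp
    qed
    define E1 E2 E3 where "E1 = {z. \<not> admits r C z}" and "E2 = {z. admits r C z \<and> U z}"
      and "E3 = {z. admits r C z \<and> \<not> U z}"
    have "E1 \<in> sets Z" "E2 \<in> sets Z" "E3 \<in> sets Z"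
      unfolding E1_def E2_def E3_def by measurable
    then have I: "integrable Z (indicat_real E1)" "integrable Z (indicat_real E2)" "integrable Z (indicat_real E3)"
      by (auto intro!: integrable_real_indicator simp: Z.P.emeasure_eq_measure)
    have mE: "measure Z E1 = 1 - A" "measure Z E2 = B" "measure Z E3 = A - B"
      using mA mB by (simp_all add: E1_def E2_def E3_def B_def)
    have "(\<integral>\<^sup>+z. f (step r C z) \<partial>Z) \<le> (\<integral>\<^sup>+z. ennreal (h z) \<partial>Z)"
      by (intro nn_integral_mono fh)
    also have "\<dots> = ennreal (\<integral>z. h z \<partial>Z)"
      unfolding h_def E1_def[symmetric] E2_def[symmetric] E3_def[symmetric] using u \<kappa> I
      by (intro nn_integral_eq_integral) auto
    also have "(\<integral>z. h z \<partial>Z) = (u * ((1 - A) + exp (- l * a) * B + (exp (l * (1 - a)) + e\<^sup>2 / 4) * (A - B))) / (1 + \<kappa>)"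
    proof -
      show ?thesis
        unfolding h_def E1_def[symmetric] E2_def[symmetric] E3_def[symmetric]
        using I mE by simp
    qed
    also have "\<dots> \<le> (u * 1) / (1 + \<kappa>)"
    proof (intro divide_right_mono mult_left_mono)
      have "l * a \<le> l" "l * (1 - a) \<le> l" using l a by (simp_all add: mult_left_le)
      then have sq: "(l * a)\<^sup>2 \<le> l\<^sup>2" "(l * (1 - a))\<^sup>2 \<le> l\<^sup>2"
        using l a by (auto intro!: power_mono)
      have "exp (- l * a) \<le> 1 - l * a + (l * a)\<^sup>2"
        using exp_le_quadratic[of "- l * a"] l a \<open>l * a \<le> l\<close> by (simp add: abs_mult)
      also have "\<dots> \<le> 1 - l * a + l\<^sup>2" using sq(1) by linarith
      finally have "exp (- l * a) \<le> 1 - l * a + l\<^sup>2" .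
      then have 1: "exp (- l * a) * B \<le> (1 - l * a + l\<^sup>2) * B"
        by (intro mult_right_mono) (auto simp: B_def)
      have "exp (l * (1 - a)) \<le> 1 + l * (1 - a) + (l * (1 - a))\<^sup>2"
        using l a order_trans[OF \<open>l * (1 - a) \<le> l\<close> l(2)] by (intro exp_le_quadratic) (simp add: abs_mult)
      also have "\<dots> \<le> 1 + l * (1 - a) + l\<^sup>2" using sq(2) by linarith
      finally have "exp (l * (1 - a)) \<le> 1 + l * (1 - a) + l\<^sup>2" .
      then have 2: "(exp (l * (1 - a)) + e\<^sup>2 / 4) * (A - B) \<le> (1 + l * (1 - a) + l\<^sup>2 + e\<^sup>2 / 4) * (A - B)"
        using AB by (intro mult_right_mono) auto
      have "(1 - l * a + l\<^sup>2) * B + (1 + l * (1 - a) + l\<^sup>2 + e\<^sup>2 / 4) * (A - B)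
         = A + l\<^sup>2 * A + l * ((1 - a) * A - B) + e\<^sup>2 / 4 * (A - B)"
        by (simp add: algebra_simps)
      also have "\<dots> \<le> A + l\<^sup>2 * A + l * (- e * A) + e\<^sup>2 / 4 * A"
        using AB l by (intro add_mono mult_left_mono) (auto simp: algebra_simps B_def)
      also have "\<dots> = A"
        by (simp add: l_def power2_eq_square field_simps)
      finally show "(1 - A) + exp (- l * a) * B + (exp (l * (1 - a)) + e\<^sup>2 / 4) * (A - B) \<le> 1"
        using 1 2 by linarith
    qed (use u \<kappa> in auto)
    finally have "(\<integral>\<^sup>+z. f (step r C z) \<partial>Z) \<le> ennreal ((u * 1) / (1 + \<kappa>))"
      using ennreal_leI order_trans by blast
    also have "\<dots> = f C" using nb by (simp add: f_def u_def v_def)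
    finally show ?thesis .
  qed
  have "emeasure \<S> {\<omega>. \<exists>j. bad (run r C \<omega> j) \<and> (\<forall>i<j. \<not> win (run r C \<omega> i))} \<le> f C"
    by (rule hitting_probability_le[OF assms(1,2) f1 super])
  also have "f C \<le> ennreal (1 / (1 + \<kappa>))"
    unfolding f_def using C bad(2)[OF C] l \<kappa> by (intro ennreal_leI divide_right_mono) auto
  finally show ?thesis
    using \<kappa> by (simp add: SP.P.emeasure_eq_measure \<kappa>_def)
qed

end

section \<open>Levels crossed only finitely often\<close>

context opinions
begin

abbreviation "traj \<omega> t \<equiv> run r {#} \<omega> t"

lemma determined_traj:
  assumes [measurable]: "Measurable.pred \<S> (\<lambda>\<omega>. Q (traj \<omega> t))"
  shows "SP.determined t {\<omega>. Q (traj \<omega> t)}"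
proof -
  have "{\<omega> \<in> space \<S>. Q (traj \<omega> t)} \<in> sets \<S>" by measurable
  then show ?thesis by (simp add: SP.determined_def run_comb_seq_le)
qed

lemma eventually_comb_seq:
  assumes "\<And>j. Q (run r (traj \<omega> t) \<omega>' j)"
  shows "\<forall>\<^sub>F i in sequentially. Q (traj (comb_seq t \<omega> \<omega>') i)"
  unfolding eventually_sequentially
proof (intro exI[of _ t] allI impI)
  fix i assume "t \<le> i"
  then obtain j where "i = t + j" using le_Suc_ex by blast
  then show "Q (traj (comb_seq t \<omega> \<omega>') i)" using assms by (simp add: run_comb_seq)
qed

lemma admits_event: "{z. admits r C z} \<in> sets Z"
proof -
  have "{z \<in> space Z. admits r C z} \<in> sets Z" by measurable
  then show ?thesis by simp
qed

lemma comb_seq_event: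
  assumes "E \<in> sets \<S>"
  shows "{\<omega>' \<in> space \<S>. comb_seq t \<omega> \<omega>' \<in> E} \<in> sets \<S>"
proof -
  have "(\<lambda>\<omega>'. comb_seq t \<omega> \<omega>') \<in> \<S> \<rightarrow>\<^sub>M \<S>"
    by (rule measurable_comb_seq'[OF measurable_const measurable_ident_sets[OF refl]]) simp
  then have "(\<lambda>\<omega>'. comb_seq t \<omega> \<omega>') -` E \<inter> space \<S> \<in> sets \<S>"
    using assms by (rule measurable_sets)
  moreover have "(\<lambda>\<omega>'. comb_seq t \<omega> \<omega>') -` E \<inter> space \<S> = {\<omega>' \<in> space \<S>. comb_seq t \<omega> \<omega>' \<in> E}"
    by auto
  ultimately show ?thesis by (rule back_subst)
qed

text \<open>
Once the quantile is at most \<open>m\<close>, a pair with both candidates above \<open>m\<close> is admitted for certain.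
So the probability that a member above \<open>m\<close> joins does not depend on the state, while the probability
of an admission is smallest when the quantile equals \<open>m\<close>.
\<close>

lemma measure_admits_low_le:
  assumes "excess r m C \<le> 0"
  shows "measure Z {z. admits r C z \<and> \<not> m < low z} = measure Z {z. admits r C z} - (tail m)\<^sup>2"
    and "mid_ge m \<le> measure Z {z. admits r C z}"
proof -
  have mid: "admits r C z" if "m \<le> mid z" for z
    unfolding admits_def using excess_antimono[OF that, of r C] assms by linarith
  have eq: "{z. admits r C z \<and> \<not> m < low z} = {z. admits r C z} - {z. m < low z}" by auto
  have "measure Z ({z. admits r C z} - {z. m < low z}) = measure Z {z. admits r C z} - measure Z {z. m < low z}"
  proof (rule Z.P.finite_measure_Diff)
    show "{z. admits r C z} \<in> sets Z" by (rule admits_event)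
    have "{z \<in> space Z. m < low z} \<in> sets Z" by measurable
    then show "{z. m < low z} \<in> sets Z" by simp
    show "{z. m < low z} \<subseteq> {z. admits r C z}"
    proof safe
      fix z assume "m < low z"
      then have "m \<le> mid z" using low_le_mid[of z] by linarith
      then show "admits r C z" by (rule mid)
    qed
  qed
  then show "measure Z {z. admits r C z \<and> \<not> m < low z} = measure Z {z. admits r C z} - (tail m)\<^sup>2"
    unfolding eq measure_low .
  show "mid_ge m \<le> measure Z {z. admits r C z}"
    unfolding mid_ge_def
  proof (rule Z.P.finite_measure_mono)
    show "{z. admits r C z} \<in> sets Z" by (rule admits_event)
  qed (use mid in auto)
qed

lemma stay_below_probability:
  assumes T: "(tail m)\<^sup>2 \<le> (1 - r - e) * mid_ge m" and e: "0 < e" "e \<le> 1 - r"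
    and C: "excess r m C \<le> 0"
  shows "prb {\<omega>. \<exists>j. 0 < excess r m (run r C \<omega> j)} \<le> 1 / (1 + escape_gain e)"
proof -
  have "prb {\<omega>. \<exists>j. 0 < excess r m (run r C \<omega> j) \<and> (\<forall>i<j. \<not> False)} \<le> 1 / (1 + escape_gain e)"
  proof (rule drift_barrier[where V = "\<lambda>C. - excess r m C" and U = "\<lambda>z. \<not> m < low z" and a = "1 - r"
        and bad = "\<lambda>C. 0 < excess r m C" and win = "\<lambda>_. False"])
    fix C assume "\<not> 0 < excess r m C"
    then have C: "excess r m C \<le> 0" by simp
    note M = measure_admits_low_le[OF C]
    have "(tail m)\<^sup>2 \<le> (1 - r - e) * measure Z {z. admits r C z}"
      using T M(2) e by (intro order_trans[OF T] mult_left_mono) auto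
    then show "(1 - (1 - r) + e) * measure Z {z. admits r C z} \<le> measure Z {z. admits r C z \<and> \<not> m < low z}"
      unfolding M(1) by (simp add: algebra_simps)
  next
    show "Measurable.pred \<S> (\<lambda>\<omega>. 0 < excess r m (run r C \<omega> j))" for C j by measurable
    show "Measurable.pred \<S> (\<lambda>\<omega>. False)" by measurable
    show "Measurable.pred Z (\<lambda>z. \<not> m < low z)" by measurable
    show "- excess r m (step r C z) = - excess r m C +
        (if admits r C z then if \<not> m < low z then 1 - r else 1 - r - 1 else 0)" for C z
      by (simp add: excess_step)
    show "0 < e" "e \<le> 1" "0 < 1 - r" "1 - r < 1" "\<not> 0 < excess r m C"
      using r e C by simp_all
  qed simp_all
  then show ?thesis by simp
qed

lemma prob_stay:
  assumes Q: "\<And>j::nat. Measurable.pred \<S> (\<lambda>\<omega>. Q j \<omega>)"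
    and "prb {\<omega>. \<exists>j. Q j \<omega>} \<le> 1 / (1 + escape_gain e)" "e > 0"
  shows "escape_gain e / (1 + escape_gain e) \<le> prb {\<omega>. \<forall>j. \<not> Q j \<omega>}"
proof -
  have "{\<omega> \<in> space \<S>. \<exists>j. Q j \<omega>} \<in> sets \<S>"
    using Q unfolding pred_def by (rule sets.sets_Collect_countable_Ex)
  then have "prb (space \<S> - {\<omega>. \<exists>j. Q j \<omega>}) = 1 - prb {\<omega>. \<exists>j. Q j \<omega>}"
    by (intro SP.P.prob_compl) simp
  moreover have "space \<S> - {\<omega>. \<exists>j. Q j \<omega>} = {\<omega>. \<forall>j. \<not> Q j \<omega>}" by auto
  moreover have "1 - 1 / (1 + escape_gain e) = escape_gain e / (1 + escape_gain e)"
    using escape_gain_pos[OF assms(3)] by (simp add: field_simps)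
  ultimately show ?thesis using assms(2) by simp
qed

text \<open>
A whole sequence of barriers is available, with the same drift at each of them. A barrier that lies
above the current quantile stops it with a probability that does not depend on which one it is.
\<close>

lemma AE_stay_below_one_of:
  assumes T: "\<And>k. (tail (q k))\<^sup>2 \<le> (1 - r - e) * mid_ge (q k)" and e: "0 < e" "e \<le> 1 - r"
  shows "AE \<omega> in \<S>. (\<exists>\<^sub>\<infinity>t. \<exists>k. excess r (q k) (traj \<omega> t) \<le> 0) \<longrightarrow>
    (\<exists>k::nat. \<forall>\<^sub>F t in sequentially. excess r (q k) (traj \<omega> t) \<le> 0)"
proof -
  define E where "E = {\<omega>. \<exists>k. \<forall>\<^sub>F t in sequentially. excess r (q k) (traj \<omega> t) \<le> 0}"
  have "{\<omega> \<in> space \<S>. \<exists>k. \<forall>\<^sub>F t in sequentially. excess r (q k) (traj \<omega> t) \<le> 0} \<in> sets \<S>"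
    unfolding eventually_sequentially by measurable
  then have [measurable]: "E \<in> sets \<S>" by (simp add: E_def)
  have "AE \<omega> in \<S>. (\<exists>\<^sub>\<infinity>t. \<omega> \<in> {\<omega>. \<exists>k. excess r (q k) (traj \<omega> t) \<le> 0}) \<longrightarrow> \<omega> \<in> E"
  proof (rule SP.recurrence_zero_one)
    show "SP.determined t {\<omega>. \<exists>k. excess r (q k) (traj \<omega> t) \<le> 0}" for t
      by (rule determined_traj) measurable
    show "0 < escape_gain e / (1 + escape_gain e)" using escape_gain_pos[OF e(1)] by simp
    fix t \<omega> assume "\<omega> \<in> {\<omega>. \<exists>k. excess r (q k) (traj \<omega> t) \<le> 0}"
    then obtain k where w: "excess r (q k) (traj \<omega> t) \<le> 0" by auto
    have "escape_gain e / (1 + escape_gain e) \<le> prb {\<omega>'. \<forall>j. \<not> 0 < excess r (q k) (run r (traj \<omega> t) \<omega>' j)}"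
      using w by (intro prob_stay[where Q = "\<lambda>j \<omega>'. 0 < excess r (q k) (run r (traj \<omega> t) \<omega>' j)"]
          stay_below_probability[OF T e] e) auto
    also have "\<dots> \<le> prb {\<omega>' \<in> space \<S>. comb_seq t \<omega> \<omega>' \<in> E}"
    proof (rule SP.P.finite_measure_mono)
      show "{\<omega>' \<in> space \<S>. comb_seq t \<omega> \<omega>' \<in> E} \<in> sets \<S>" by (rule comb_seq_event) measurable
      show "{\<omega>'. \<forall>j. \<not> 0 < excess r (q k) (run r (traj \<omega> t) \<omega>' j)} \<subseteq> {\<omega>' \<in> space \<S>. comb_seq t \<omega> \<omega>' \<in> E}"
        using eventually_comb_seq[of "\<lambda>C. excess r (q k) C \<le> 0" \<omega> t] by (auto simp: E_def not_less)
    qed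
    finally show "escape_gain e / (1 + escape_gain e) \<le> prb {\<omega>' \<in> space \<S>. comb_seq t \<omega> \<omega>' \<in> E}" .
  qed simp
  then show ?thesis by (simp add: E_def)
qed

lemma AE_stay_below:
  assumes "(tail m)\<^sup>2 < (1 - r) * mid_ge m"
  shows "AE \<omega> in \<S>. (\<exists>\<^sub>\<infinity>t. excess r m (traj \<omega> t) \<le> 0) \<longrightarrow> (\<forall>\<^sub>F t in sequentially. excess r m (traj \<omega> t) \<le> 0)"
proof -
  have den: "0 < mid_ge m" using assms r by (smt (verit) mid_ge_def measure_nonneg mult_not_zero zero_le_power2)
  define e where "e = (1 - r) - (tail m)\<^sup>2 / mid_ge m"
  have e: "0 < e" "e \<le> 1 - r" using assms den by (auto simp: e_def field_simps)
  have "(tail m)\<^sup>2 \<le> (1 - r - e) * mid_ge m" using den by (simp add: e_def)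
  from AE_stay_below_one_of[OF this e] show ?thesis by simp
qed

text \<open>
The quantile may leave the set \<open>Q\<close> on which the drift is known, and only trajectories that remain in
\<open>Q\<close> from some time on are considered. For each time \<open>N\<close>, leaving \<open>Q\<close> after \<open>N\<close> therefore counts as success
in the zero-one law.
\<close>

lemma AE_stay_above:
  assumes Q [measurable]: "Q \<in> sets borel" and e: "0 < e" "e \<le> 1"
    and drift: "\<And>q. q \<in> Q \<Longrightarrow> m < q \<Longrightarrow> (1 - r + e) * mid_ge q \<le> measure Z {z. m < low z \<and> q \<le> mid z}"
  shows "AE \<omega> in \<S>. (\<forall>\<^sub>F t in sequentially. quantile r (traj \<omega> t) \<in> Q) \<longrightarrow>
     (\<exists>\<^sub>\<infinity>t. 0 < excess r m (traj \<omega> t)) \<longrightarrow> (\<forall>\<^sub>F t in sequentially. 0 < excess r m (traj \<omega> t))"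
proof -
  have main: "AE \<omega> in \<S>. (\<exists>\<^sub>\<infinity>t. t \<ge> N \<and> 0 < excess r m (traj \<omega> t)) \<longrightarrow>
     ((\<exists>t\<ge>N. quantile r (traj \<omega> t) \<notin> Q) \<or> (\<forall>\<^sub>F t in sequentially. 0 < excess r m (traj \<omega> t)))" for N
  proof -
    define E where "E = {\<omega>. (\<exists>t\<ge>N. quantile r (traj \<omega> t) \<notin> Q) \<or> (\<forall>\<^sub>F t in sequentially. 0 < excess r m (traj \<omega> t))}"
    have "{\<omega> \<in> space \<S>. (\<exists>t\<ge>N. quantile r (traj \<omega> t) \<notin> Q) \<or> (\<forall>\<^sub>F t in sequentially. 0 < excess r m (traj \<omega> t))} \<in> sets \<S>"
      unfolding eventually_sequentially by measurable
    then have [measurable]: "E \<in> sets \<S>" by (simp add: E_def)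
    have "AE \<omega> in \<S>. (\<exists>\<^sub>\<infinity>t. \<omega> \<in> {\<omega>. t \<ge> N \<and> 0 < excess r m (traj \<omega> t)}) \<longrightarrow> \<omega> \<in> E"
    proof (rule SP.recurrence_zero_one)
      show "SP.determined t {\<omega>. N \<le> t \<and> 0 < excess r m (traj \<omega> t)}" for t
        by (rule determined_traj) measurable
      show "0 < escape_gain e / (1 + escape_gain e)" using escape_gain_pos[OF e(1)] by simp
      fix t \<omega> assume w: "\<omega> \<in> {\<omega>. N \<le> t \<and> 0 < excess r m (traj \<omega> t)}"
      let ?bad = "\<lambda>C. excess r m C \<le> 0" and ?win = "\<lambda>C. quantile r C \<notin> Q"
      have "prb {\<omega>'. \<exists>j. ?bad (run r (traj \<omega> t) \<omega>' j) \<and> (\<forall>i<j. \<not> ?win (run r (traj \<omega> t) \<omega>' i))} \<le> 1 / (1 + escape_gain e)"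
      proof (rule drift_barrier[where V = "excess r m" and U = "\<lambda>z. m < low z" and a = r and bad = ?bad and win = ?win])
        fix C assume C: "\<not> excess r m C \<le> 0" "\<not> quantile r C \<notin> Q"
        then have "C \<noteq> {#}" by auto
        note q = quantile_le_iff[OF this r] and adm = admits_iff_quantile[OF this r]
        have "m < quantile r C" using C(1) q by (simp add: not_le[symmetric])
        with drift[of "quantile r C"] C(2)
        show "(1 - r + e) * measure Z {z. admits r C z} \<le> measure Z {z. admits r C z \<and> m < low z}"
          by (simp add: adm mid_ge_def conj_commute)
      next
        show "Measurable.pred \<S> (\<lambda>\<omega>. excess r m (run r C \<omega> j) \<le> 0)" for C j by measurable
        show "Measurable.pred \<S> (\<lambda>\<omega>. quantile r (run r C \<omega> j) \<notin> Q)" for C j by measurable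
        show "Measurable.pred Z (\<lambda>z. m < low z)" by measurable
        show "\<not> excess r m (traj \<omega> t) \<le> 0" using w by simp
      qed (use r e in \<open>simp_all add: excess_step\<close>)
      then have "escape_gain e / (1 + escape_gain e) \<le> prb {\<omega>'. \<forall>j. \<not> (?bad (run r (traj \<omega> t) \<omega>' j) \<and> (\<forall>i<j. \<not> ?win (run r (traj \<omega> t) \<omega>' i)))}"
        using e by (intro prob_stay[where Q = "\<lambda>j \<omega>'. ?bad (run r (traj \<omega> t) \<omega>' j) \<and> (\<forall>i<j. \<not> ?win (run r (traj \<omega> t) \<omega>' i))"]) measurable
      also have "\<dots> \<le> prb {\<omega>' \<in> space \<S>. comb_seq t \<omega> \<omega>' \<in> E}"
      proof (rule SP.P.finite_measure_mono)
        show "{\<omega>' \<in> space \<S>. comb_seq t \<omega> \<omega>' \<in> E} \<in> sets \<S>" by (rule comb_seq_event) measurable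
        show "{\<omega>'. \<forall>j. \<not> (?bad (run r (traj \<omega> t) \<omega>' j) \<and> (\<forall>i<j. \<not> ?win (run r (traj \<omega> t) \<omega>' i)))}
           \<subseteq> {\<omega>' \<in> space \<S>. comb_seq t \<omega> \<omega>' \<in> E}"
        proof (rule subsetI)
          fix \<omega>' assume *: "\<omega>' \<in> {\<omega>'. \<forall>j. \<not> (?bad (run r (traj \<omega> t) \<omega>' j) \<and> (\<forall>i<j. \<not> ?win (run r (traj \<omega> t) \<omega>' i)))}"
          have "comb_seq t \<omega> \<omega>' \<in> E"
          proof (cases "\<exists>i. ?win (run r (traj \<omega> t) \<omega>' i)")
            case True
            then obtain i where "?win (run r (traj \<omega> t) \<omega>' i)" ..
            then have "?win (traj (comb_seq t \<omega> \<omega>') (t + i))" by (simp add: run_comb_seq)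
            moreover have "t + i \<ge> N" using w by simp
            ultimately show ?thesis unfolding E_def by blast
          next
            case False
            with * have "0 < excess r m (run r (traj \<omega> t) \<omega>' j)" for j by (auto simp: not_le)
            from eventually_comb_seq[of "\<lambda>C. 0 < excess r m C", OF this]
            show ?thesis unfolding E_def by blast
          qed
          then show "\<omega>' \<in> {\<omega>' \<in> space \<S>. comb_seq t \<omega> \<omega>' \<in> E}" by simp
        qed
      qed
      finally show "escape_gain e / (1 + escape_gain e) \<le> prb {\<omega>' \<in> space \<S>. comb_seq t \<omega> \<omega>' \<in> E}" .
    qed simp
    then show ?thesis by (simp add: E_def)
  qed
  have "AE \<omega> in \<S>. \<forall>N. (\<exists>\<^sub>\<infinity>t. t \<ge> N \<and> 0 < excess r m (traj \<omega> t)) \<longrightarrow>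
     ((\<exists>t\<ge>N. quantile r (traj \<omega> t) \<notin> Q) \<or> (\<forall>\<^sub>F t in sequentially. 0 < excess r m (traj \<omega> t)))"
    using main by (simp add: AE_all_countable)
  then show ?thesis
  proof eventually_elim
    case (elim \<omega>)
    show ?case
    proof (intro impI)
      assume Q: "\<forall>\<^sub>F t in sequentially. quantile r (traj \<omega> t) \<in> Q" and inf: "\<exists>\<^sub>\<infinity>t. 0 < excess r m (traj \<omega> t)"
      obtain N where N: "\<And>t. t \<ge> N \<Longrightarrow> quantile r (traj \<omega> t) \<in> Q"
        using Q by (auto simp: eventually_sequentially)
      have "\<exists>\<^sub>\<infinity>t. t \<ge> N \<and> 0 < excess r m (traj \<omega> t)"
        using INFM_conjI[OF inf, of "\<lambda>t. t \<ge> N"]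
        by (auto simp: MOST_nat_le conj_commute)
      with elim N show "\<forall>\<^sub>F t in sequentially. 0 < excess r m (traj \<omega> t)" by blast
    qed
  qed
qed

lemma AE_stay_below_some:
  assumes T: "\<And>k. (tail (q k))\<^sup>2 \<le> (1 - r - e) * mid_ge (q k)" and e: "0 < e" "e \<le> 1 - r"
    and bd: "AE \<omega> in \<S>. \<forall>t. \<exists>k. quantile r (traj \<omega> (Suc t)) \<le> q k"
  shows "AE \<omega> in \<S>. \<exists>k::nat. \<forall>\<^sub>F t in sequentially. excess r (q k) (traj \<omega> t) \<le> 0"
  using bd AE_stay_below_one_of[where q = q, OF T e]
proof eventually_elim
  case (elim \<omega>)
  have "\<exists>k. excess r (q k) (traj \<omega> t) \<le> 0" if "t \<ge> 1" for t
    using elim(1)[rule_format, of "t - 1"] that r by (simp add: quantile_le_iff run_nonempty del: run.simps)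
  then have "\<exists>\<^sub>\<infinity>t. \<exists>k. excess r (q k) (traj \<omega> t) \<le> 0"
    unfolding INFM_nat_le by (metis le_add1 le_add2)
  with elim(2) show ?case by blast
qed

end

section \<open>Slowly rising levels\<close>

lemma exp_minus_le_inverse_cube:
  fixes x :: real
  assumes "x > 0"
  shows "exp (- x) \<le> 27 / x ^ 3"
proof -
  have "(x / 3) ^ 3 \<le> (1 + x / real 3) ^ 3" using assms by (intro power_mono) auto
  also have "\<dots> \<le> exp x" using assms by (intro exp_ge_one_plus_x_over_n_power_n) auto
  finally have "x ^ 3 / 27 \<le> exp x" by (simp add: power_divide)
  then show ?thesis using assms by (simp add: exp_minus field_simps)
qed

text \<open>
As long as the quantile is at most \<open>s\<close>, the excess is dominated by a sum of independent terms that do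
not refer to the club: every pair with both candidates above \<open>s\<close> is admitted, and so is every pair
with midpoint at least \<open>s\<close>. Pairs whose smaller candidate lies between \<open>s\<close> and \<open>s'\<close> are among them,
so they all contribute members between the two levels.
\<close>

lemma excess_run_le_walk:
  assumes C: "excess r s C \<le> - a" and r: "0 < r" "r < 1"
    and walk: "\<And>j. j \<le> l \<Longrightarrow> (\<Sum>i<j. of_bool (s < low (w i)) - (1 - r) * of_bool (s \<le> mid (w i))) \<le> a"
    and j: "j \<le> l" and ss: "s \<le> s'"
  shows "excess r s (run r C w j) \<le> excess r s C + (\<Sum>i<j. of_bool (s < low (w i)) - (1 - r) * of_bool (s \<le> mid (w i)))"
    and "excess r s (run r C w j) \<le> 0"
    and "(\<Sum>i<j. of_bool (s < low (w i) \<and> low (w i) \<le> s')) \<le> above s (run r C w j) - above s' (run r C w j)"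
proof -
  have "excess r s (run r C w j) \<le> excess r s C + (\<Sum>i<j. of_bool (s < low (w i)) - (1 - r) * of_bool (s \<le> mid (w i)))
    \<and> excess r s (run r C w j) \<le> 0 \<and>
      (\<Sum>i<j. of_bool (s < low (w i) \<and> low (w i) \<le> s')) \<le> above s (run r C w j) - above s' (run r C w j)"
    using j
  proof (induction j)
    case 0
    then show ?case using walk[of 0] C above_antimono[OF ss, of C] by simp
  next
    case (Suc j)
    let ?R = "run r C w j" and ?z = "w j"
    from Suc have IH: "excess r s ?R \<le> excess r s C + (\<Sum>i<j. of_bool (s < low (w i)) - (1 - r) * of_bool (s \<le> mid (w i)))"
      "excess r s ?R \<le> 0"
      "(\<Sum>i<j. of_bool (s < low (w i) \<and> low (w i) \<le> s')) \<le> above s ?R - above s' ?R" by auto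
    have adm: "admits r ?R ?z" if "s \<le> mid ?z"
      using excess_antimono[OF that, of r ?R] IH(2) by (simp add: admits_def)
    have 1: "excess r s (step r ?R ?z) \<le> excess r s ?R + (of_bool (s < low ?z) - (1 - r) * of_bool (s \<le> mid ?z))"
      using adm low_le_mid[of ?z] r by (auto simp: excess_step)
    have 3: "of_bool (s < low ?z \<and> low ?z \<le> s') + (above s ?R - above s' ?R) \<le> above s (step r ?R ?z) - above s' (step r ?R ?z)"
      using adm low_le_mid[of ?z] ss by (auto simp: step_def above_add)
    have 2: "excess r s (step r ?R ?z) \<le> 0"
      using 1 IH(1) walk[OF Suc.prems] C by simp
    show ?case using 1 2 3 IH(1,3) by auto
  qed
  then show "excess r s (run r C w j) \<le> excess r s C + (\<Sum>i<j. of_bool (s < low (w i)) - (1 - r) * of_bool (s \<le> mid (w i)))"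
    "excess r s (run r C w j) \<le> 0"
    "(\<Sum>i<j. of_bool (s < low (w i) \<and> low (w i) \<le> s')) \<le> above s (run r C w j) - above s' (run r C w j)"
    by auto
qed

context opinions
begin

lemma mid_low_events [measurable]:
  "{z. s < low z} \<in> sets Z" "{z. s \<le> mid z} \<in> sets Z" "{z. s < mid z} \<in> sets Z"
proof -
  have "{z \<in> space Z. s < low z} \<in> sets Z" "{z \<in> space Z. s \<le> mid z} \<in> sets Z" "{z \<in> space Z. s < mid z} \<in> sets Z"
    by measurable
  then show "{z. s < low z} \<in> sets Z" "{z. s \<le> mid z} \<in> sets Z" "{z. s < mid z} \<in> sets Z" by simp_all
qed

lemma tail_antimono: "m \<le> m' \<Longrightarrow> tail m' \<le> tail m"
  unfolding tail_def by (intro D.finite_measure_mono) auto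

lemma tail_nonneg: "0 \<le> tail m" by (simp add: tail_def)

lemma tail_le_1: "tail m \<le> 1" by (simp add: tail_def)

lemma tail_sq_le_mid_ge: "(tail m)\<^sup>2 \<le> mid_ge m"
  unfolding measure_low[symmetric] mid_ge_def
proof (rule Z.P.finite_measure_mono)
  show "{z. m < low z} \<subseteq> {z. m \<le> mid z}"
    using low_le_mid by (auto intro: less_imp_le less_le_trans)
qed (rule mid_low_events)

lemma measure_low_between:
  assumes "s \<le> s'"
  shows "measure Z ({z. s < low z} - {z. s' < low z}) = (tail s)\<^sup>2 - (tail s')\<^sup>2"
  unfolding measure_low[symmetric] using assms
  by (intro Z.P.finite_measure_Diff mid_low_events) auto

lemma draw_sum_event:
  fixes a :: real
  assumes [measurable]: "g \<in> borel_measurable Z"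
  shows "{\<omega>. a \<le> (\<Sum>i\<in>I. g (\<omega> i))} \<in> sets \<S>"
proof -
  have gm: "(\<lambda>\<omega>. g (\<omega> i)) \<in> borel_measurable \<S>" for i
    by (rule measurable_compose[OF measurable_component_singleton]; use assms in simp)
  have "(\<lambda>\<omega>. \<Sum>i\<in>I. g (\<omega> i)) \<in> borel_measurable \<S>"
    by (rule borel_measurable_sum) (rule gm)
  from borel_measurable_le[OF borel_measurable_const this] show ?thesis by simp
qed

text \<open>
One stage of the construction with a fixed level \<open>s\<close>. It succeeds if the walk that dominates the excess
never rises by more than \<open>a\<close> during \<open>l\<close> steps, and if at least half of the expected number
\<open>l * p\<close> of pairs falls between \<open>s\<close> and the next level \<open>s'\<close>.
\<close>

lemma stage_failure:
  fixes t l :: nat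
  assumes neg: "(tail s)\<^sup>2 \<le> (1 - r) * mid_ge s" and ss: "s \<le> s'"
    and p: "p = (tail s)\<^sup>2 - (tail s')\<^sup>2" and a: "0 \<le> a" "a \<le> 2 * real l" "0 < l"
  defines "ok \<equiv> \<lambda>\<omega>. (\<forall>j\<le>l. (\<Sum>i<j. of_bool (s < low (\<omega> (t + i))) - (1 - r) * of_bool (s \<le> mid (\<omega> (t + i)))) \<le> a) \<and>
      real l * p / 2 \<le> (\<Sum>i<l. of_bool (s < low (\<omega> (t + i)) \<and> low (\<omega> (t + i)) \<le> s'))"
  shows "{\<omega>. \<not> ok \<omega>} \<in> sets \<S>"
    and "prb {\<omega>. \<not> ok \<omega>} \<le> (real l + 1) * exp (- (a\<^sup>2 / (4 * real l))) + exp (- (real l * p\<^sup>2 / 16))"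
proof -
  define g where "g z = indicator {z. s < low z} z - (1 - r) * indicator {z. s \<le> mid z} z" for z
  define h where "h z = p - indicator ({z. s < low z} - {z. s' < low z}) z" for z
  have [measurable]: "g \<in> borel_measurable Z" unfolding g_def by measurable
  have [measurable]: "h \<in> borel_measurable Z" unfolding h_def by measurable
  have p01: "0 \<le> p" "p \<le> 1"
    unfolding p measure_low_between[OF ss, symmetric] by simp_all
  have g_bd: "\<bar>g z\<bar> \<le> 1" for z
    using r low_le_mid[of z] by (auto simp: g_def indicator_def)
  have h_bd: "\<bar>h z\<bar> \<le> 1" for z
    using p01 by (auto simp: h_def indicator_def)
  have ind: "integrable Z (indicat_real A)" if "A \<in> sets Z" for A
    using that by (intro integrable_real_indicator) (auto simp: Z.P.emeasure_eq_measure)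
  have g_mean: "(\<integral>z. g z \<partial>Z) \<le> 0"
  proof -
    have "(\<integral>z. g z \<partial>Z) = (tail s)\<^sup>2 - (1 - r) * mid_ge s"
      unfolding g_def using ind[OF mid_low_events(1)] ind[OF mid_low_events(2)]
      by (simp add: measure_low mid_ge_def)
    then show ?thesis using neg by simp
  qed
  have h_mean: "(\<integral>z. h z \<partial>Z) \<le> 0"
  proof -
    have "{z. s < low z} - {z. s' < low z} \<in> sets Z" by (intro sets.Diff mid_low_events)
    from ind[OF this] have "(\<integral>z. h z \<partial>Z) = p - measure Z ({z. s < low z} - {z. s' < low z})"
      unfolding h_def using Z.P.prob_space by simp
    then show ?thesis using measure_low_between[OF ss] p by simp
  qed
  have [measurable]: "(\<lambda>\<omega>. g (\<omega> i)) \<in> borel_measurable \<S>" "(\<lambda>\<omega>. h (\<omega> i)) \<in> borel_measurable \<S>" for i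
    by (rule measurable_compose[OF measurable_component_singleton]; simp)+
  define A where "A j = {\<omega>. a \<le> (\<Sum>i\<in>{t..<t+j}. g (\<omega> i))}" for j
  define B where "B = {\<omega>. real l * p / 2 \<le> (\<Sum>i\<in>{t..<t+l}. h (\<omega> i))}"
  have As: "A j \<in> sets \<S>" for j unfolding A_def by (rule draw_sum_event) measurable
  have Bs: "B \<in> sets \<S>" unfolding B_def by (rule draw_sum_event) measurable
  have sg: "(\<Sum>i<j. of_bool (s < low (\<omega> (t + i))) - (1 - r) * of_bool (s \<le> mid (\<omega> (t + i)))) = (\<Sum>i\<in>{t..<t+j}. g (\<omega> i))" for \<omega> j
    by (simp add: sum.atLeastLessThan_shift_0[of _ t] g_def indicator_def atLeast0LessThan)
  have sh: "(\<Sum>i<l. of_bool (s < low (\<omega> (t + i)) \<and> low (\<omega> (t + i)) \<le> s')) = real l * p - (\<Sum>i\<in>{t..<t+l}. h (\<omega> i))" for \<omega>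
    by (simp add: sum.atLeastLessThan_shift_0[of _ t] h_def indicator_def atLeast0LessThan sum_subtractf not_less)
  have "{\<omega>. \<not> ok \<omega>} = (\<Union>j\<le>l. {\<omega>. \<not> (\<Sum>i\<in>{t..<t+j}. g (\<omega> i)) \<le> a}) \<union> {\<omega>. \<not> real l * p / 2 \<le> real l * p - (\<Sum>i\<in>{t..<t+l}. h (\<omega> i))}"
    unfolding ok_def sg sh by auto
  also have "\<dots> \<in> sets \<S>"
  proof (intro sets.Un sets.finite_UN)
    have "{\<omega> \<in> space \<S>. \<not> (\<Sum>i\<in>{t..<t+j}. g (\<omega> i)) \<le> a} \<in> sets \<S>" for j by measurable
    then show "{\<omega>. \<not> (\<Sum>i\<in>{t..<t+j}. g (\<omega> i)) \<le> a} \<in> sets \<S>" for j by simp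
    have "{\<omega> \<in> space \<S>. \<not> real l * p / 2 \<le> real l * p - (\<Sum>i\<in>{t..<t+l}. h (\<omega> i))} \<in> sets \<S>" by measurable
    then show "{\<omega>. \<not> real l * p / 2 \<le> real l * p - (\<Sum>i\<in>{t..<t+l}. h (\<omega> i))} \<in> sets \<S>" by simp
  qed auto
  finally show "{\<omega>. \<not> ok \<omega>} \<in> sets \<S>" .
  have PA: "prb (A j) \<le> exp (- (a\<^sup>2 / (4 * real l)))" if "j \<le> l" for j
  proof -
    have "prb (A j) \<le> exp ((a / (2 * real l))\<^sup>2 * card {t..<t+j} - a / (2 * real l) * a)"
      using SP.chernoff[of g "{t..<t+j}" "a / (2 * real l)" a] g_bd g_mean a
      by (simp add: A_def divide_le_eq)
    also have "\<dots> \<le> exp ((a / (2 * real l))\<^sup>2 * real l - a / (2 * real l) * a)"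
      using that by (auto intro!: mult_left_mono)
    also have "(a / (2 * real l))\<^sup>2 * real l - a / (2 * real l) * a = - (a\<^sup>2 / (4 * real l))"
      using a(3) by (simp add: power2_eq_square field_simps)
    finally show ?thesis .
  qed
  have PB: "prb B \<le> exp (- (real l * p\<^sup>2 / 16))"
  proof -
    have "prb B \<le> exp ((p / 4)\<^sup>2 * card {t..<t+l} - p / 4 * (real l * p / 2))"
      using SP.chernoff[of h "{t..<t+l}" "p / 4" "real l * p / 2"] h_bd h_mean p01
      by (simp add: B_def)
    also have "(p / 4)\<^sup>2 * card {t..<t+l} - p / 4 * (real l * p / 2) = - (real l * p\<^sup>2 / 16)"
      by (simp add: power2_eq_square field_simps)
    finally show ?thesis .
  qed
  have "prb {\<omega>. \<not> ok \<omega>} \<le> prb ((\<Union>j\<in>{..l}. A j) \<union> B)"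
  proof (rule SP.P.finite_measure_mono)
    show "{\<omega>. \<not> ok \<omega>} \<subseteq> (\<Union>j\<in>{..l}. A j) \<union> B"
      unfolding ok_def sg sh A_def B_def by (auto simp: mult.commute not_le)
    show "(\<Union>j\<in>{..l}. A j) \<union> B \<in> sets \<S>" using As Bs by auto
  qed
  also have "\<dots> \<le> prb (\<Union>j\<in>{..l}. A j) + prb B"
    using As Bs by (intro measure_Un_le) auto
  also have "prb (\<Union>j\<in>{..l}. A j) \<le> (\<Sum>j\<in>{..l}. prb (A j))"
    using As by (intro SP.P.finite_measure_subadditive_finite) auto
  also have "\<dots> \<le> (\<Sum>j\<in>{..l}. exp (- (a\<^sup>2 / (4 * real l))))"
    by (intro sum_mono PA) auto
  finally show "prb {\<omega>. \<not> ok \<omega>} \<le> (real l + 1) * exp (- (a\<^sup>2 / (4 * real l))) + exp (- (real l * p\<^sup>2 / 16))"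
    using PB by (simp add: add.commute)
qed

text \<open>
Stage \<open>k\<close> lasts \<open>L * 16 ^ k\<close> steps, and the next level is chosen such that a pair falls between it and the
current one with probability \<open>d / 2 ^ Suc k\<close>. The expected number of such pairs is of the order
\<open>8 ^ k\<close>, which is large compared with the fluctuations of order \<open>4 ^ k\<close> of the walk. So the excess at
the next level starts stage \<open>k + 1\<close> at a negative value that the walk is unlikely to make up for, and
the failure probabilities are summable. The constant in the hypothesis on \<open>L\<close> makes their sum at
most \<open>1 / 3\<close>.
\<close>

lemma rising_levels_probability:
  assumes lev: "\<And>k. s k < s (Suc k)" "\<And>k. s k \<le> m'"
    and neg: "\<And>k. (tail (s k))\<^sup>2 \<le> (1 - r) * mid_ge (s k)"
    and p: "\<And>k. (tail (s k))\<^sup>2 - (tail (s (Suc k)))\<^sup>2 = d / 2 ^ Suc k"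
    and d: "0 < d" "d \<le> 1" and L: "1 \<le> L" "4 * 81 * 4096 ^ 3 / d ^ 6 \<le> real L"
    and C: "excess r (s 0) C \<le> - (real L * d / 32)"
  shows "1 / 2 \<le> prb {\<omega>. \<forall>n. excess r m' (run r C \<omega> n) \<le> 0}"
proof -
  define l where "l k = L * 16 ^ k" for k :: nat
  define a where "a k = real L * d * 8 ^ k / 32" for k :: nat
  define t where "t k = (\<Sum>i<k. l i)" for k
  define x where "x k = real L * d\<^sup>2 * 4 ^ k / 4096" for k :: nat
  have lpos: "0 < l k" for k using L by (simp add: l_def)
  have xpos: "0 < x k" for k using L d by (simp add: x_def)
  have apos: "0 \<le> a k" for k using d by (simp add: a_def)
  have a_Suc: "a (Suc k) = real (l k) * (d / 2 ^ Suc k) / 2" for k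
  proof -
    have "(16::real) ^ k = 8 ^ k * 2 ^ k" by (simp add: power_mult_distrib[symmetric])
    then show ?thesis by (simp add: a_def l_def)
  qed
  define ok where "ok k \<omega> \<longleftrightarrow>
      (\<forall>j\<le>l k. (\<Sum>i<j. of_bool (s k < low (\<omega> (t k + i))) - (1 - r) * of_bool (s k \<le> mid (\<omega> (t k + i)))) \<le> a k) \<and>
      real (l k) * (d / 2 ^ Suc k) / 2 \<le> (\<Sum>i<l k. of_bool (s k < low (\<omega> (t k + i)) \<and> low (\<omega> (t k + i)) \<le> s (Suc k)))" for k \<omega>
  have a_le: "a k \<le> 2 * real (l k)" for k
  proof -
    have "a k \<le> real L * 1 * 16 ^ k / 32"
      unfolding a_def using d by (intro divide_right_mono mult_mono power_mono) auto
    also have "\<dots> \<le> 2 * real (l k)" using L by (simp add: l_def)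
    finally show ?thesis .
  qed
  have fail: "{\<omega>. \<not> ok k \<omega>} \<in> sets \<S>"
    "prb {\<omega>. \<not> ok k \<omega>} \<le> (real (l k) + 1) * exp (- ((a k)\<^sup>2 / (4 * real (l k)))) + exp (- (real (l k) * (d / 2 ^ Suc k)\<^sup>2 / 16))" for k
    using stage_failure[OF neg[of k] less_imp_le[OF lev(1)[of k]] p[of k, symmetric] apos[of k] a_le[of k] lpos[of k], where t = "t k"]
    unfolding ok_def by blast+
  have bound: "prb {\<omega>. \<not> ok k \<omega>} \<le> 1 / 4 * (1 / 4) ^ k" for k
  proof -
    have e1: "(a k)\<^sup>2 / (4 * real (l k)) = x k"
    proof -
      have "(64::real) ^ k = 16 ^ k * 4 ^ k" by (simp add: power_mult_distrib[symmetric])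
      moreover have "((8::real) ^ k)\<^sup>2 = 64 ^ k" by (simp add: power_mult_distrib[symmetric] power2_eq_square)
      ultimately show ?thesis
        using L by (simp add: a_def l_def x_def power_mult_distrib power_divide power2_eq_square[of "real L"] field_simps)
    qed
    have e2: "x k \<le> real (l k) * (d / 2 ^ Suc k)\<^sup>2 / 16"
    proof -
      have "(16::real) ^ k = 4 ^ k * 4 ^ k" by (simp add: power_mult_distrib[symmetric])
      moreover have "((2::real) ^ k)\<^sup>2 = 4 ^ k" by (simp add: power_mult_distrib[symmetric] power2_eq_square)
      ultimately have eq: "real (l k) * (d / 2 ^ Suc k)\<^sup>2 / 16 = real L * d\<^sup>2 * 4 ^ k / 64"
        by (simp add: l_def power_divide power_mult_distrib)
      show ?thesis unfolding eq x_def using d by (intro divide_left_mono) simp_all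
    qed
    have "prb {\<omega>. \<not> ok k \<omega>} \<le> (real (l k) + 1) * exp (- x k) + exp (- x k)"
      using fail(2)[of k] e2 unfolding e1 by (smt (verit) exp_le_cancel_iff)
    also have "\<dots> = (real (l k) + 2) * exp (- x k)" by (simp add: algebra_simps)
    also have "\<dots> \<le> (3 * real (l k)) * (27 / x k ^ 3)"
      using lpos[of k] by (intro mult_mono exp_minus_le_inverse_cube xpos) auto
    also have "\<dots> = (81 * 4096 ^ 3 / d ^ 6) / (real L)\<^sup>2 * (1 / 4) ^ k"
    proof -
      have "((4::real) ^ k) ^ 3 = 16 ^ k * 4 ^ k"
        by (simp add: power_mult_distrib[symmetric] power3_eq_cube)
      then show ?thesis
        using L d by (simp add: l_def x_def power_mult_distrib power_divide field_simps power2_eq_square power3_eq_cube eval_nat_numeral)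
    qed
    also have "\<dots> \<le> 1 / 4 * (1 / 4) ^ k"
    proof (rule mult_right_mono)
      have "81 * 4096 ^ 3 / d ^ 6 \<le> 1 / 4 * real L" using L(2) by simp
      also have "\<dots> \<le> 1 / 4 * (real L)\<^sup>2" using L(1) by (simp add: power2_eq_square)
      finally have const_le: "81 * 4096 ^ 3 / d ^ 6 \<le> 1 / 4 * (real L)\<^sup>2" .
      have "0 < (real L)\<^sup>2" using L(1) by simp
      then show "(81 * 4096 ^ 3 / d ^ 6) / (real L)\<^sup>2 \<le> 1 / 4"
        by (subst pos_divide_le_eq) (rule \<open>0 < (real L)\<^sup>2\<close>, rule const_le)
    qed simp
    finally show ?thesis .
  qed
  have sm: "summable (\<lambda>k. 1 / 4 * (1 / 4 :: real) ^ k)"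
    by (intro summable_mult summable_geometric) simp
  have sm': "summable (\<lambda>k. prb {\<omega>. \<not> ok k \<omega>})"
    by (rule summable_comparison_test'[OF sm, of 0]) (use bound in simp)
  have "prb (\<Union>k. {\<omega>. \<not> ok k \<omega>}) \<le> (\<Sum>k. prb {\<omega>. \<not> ok k \<omega>})"
    using fail(1) by (intro SP.P.finite_measure_subadditive_countably sm') auto
  also have "\<dots> \<le> (\<Sum>k. 1 / 4 * (1 / 4) ^ k)"
    by (intro suminf_le bound sm sm')
  also have "\<dots> = 1 / 3"
    by (subst suminf_mult) (simp_all add: suminf_geometric summable_geometric)
  finally have P: "prb (\<Union>k. {\<omega>. \<not> ok k \<omega>}) \<le> 1 / 2" by simp
  have U: "(\<Union>k. {\<omega>. \<not> ok k \<omega>}) \<in> sets \<S>" using fail(1) by auto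
  have "1 / 2 \<le> prb (space \<S> - (\<Union>k. {\<omega>. \<not> ok k \<omega>}))"
    using P SP.P.prob_compl[OF U] by simp
  also have "\<dots> \<le> prb {\<omega>. \<forall>n. excess r m' (run r C \<omega> n) \<le> 0}"
  proof (rule SP.P.finite_measure_mono)
    have "{\<omega> \<in> space \<S>. \<forall>n. excess r m' (run r C \<omega> n) \<le> 0} \<in> sets \<S>" by measurable
    then show "{\<omega>. \<forall>n. excess r m' (run r C \<omega> n) \<le> 0} \<in> sets \<S>" by simp
    show "space \<S> - (\<Union>k. {\<omega>. \<not> ok k \<omega>}) \<subseteq> {\<omega>. \<forall>n. excess r m' (run r C \<omega> n) \<le> 0}"
    proof (rule subsetI)
      fix \<omega> assume "\<omega> \<in> space \<S> - (\<Union>k. {\<omega>. \<not> ok k \<omega>})"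
      then have ok: "ok k \<omega>" for k by auto
      have stage: "excess r (s k) (run r C \<omega> (t k)) \<le> - a k" for k
      proof (induction k)
        case 0
        then show ?case using C by (simp add: t_def a_def)
      next
        case (Suc k)
        note W = excess_run_le_walk[OF Suc r, of "l k" "\<lambda>i. \<omega> (t k + i)" "l k" "s (Suc k)"]
        have "t (Suc k) = t k + l k" by (simp add: t_def)
        then have R: "run r C \<omega> (t (Suc k)) = run r (run r C \<omega> (t k)) (\<lambda>i. \<omega> (t k + i)) (l k)"
          by (simp add: run_add)
        have "a (Suc k) \<le> above (s k) (run r C \<omega> (t (Suc k))) - above (s (Suc k)) (run r C \<omega> (t (Suc k)))"
          and "excess r (s k) (run r C \<omega> (t (Suc k))) \<le> 0"
          using W(2,3) ok[of k] less_imp_le[OF lev(1)[of k]] unfolding R a_Suc ok_def by (auto intro: order_trans)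
        then show ?case by (simp add: excess_def)
      qed
      have "excess r m' (run r C \<omega> n) \<le> 0" for n
      proof -
        have "\<exists>k. t k \<le> n \<and> n < t (Suc k)"
        proof -
          have "k \<le> t k" for k
          proof (induction k)
            case (Suc k)
            then show ?case using lpos[of k] by (simp add: t_def)
          qed simp
          then have "n < t (Suc n)" by (meson Suc_le_lessD)
          then have ex: "\<exists>k. n < t (Suc k)" ..
          define k where "k = (LEAST k. n < t (Suc k))"
          have "n < t (Suc k)" unfolding k_def using ex by (rule LeastI_ex)
          moreover have "t k \<le> n"
          proof (cases k)
            case (Suc k')
            then have "\<not> n < t (Suc k')" using not_less_Least[of k' "\<lambda>k. n < t (Suc k)"] by (simp add: k_def)
            then show ?thesis using Suc by simp
          qed (simp add: t_def)
          ultimately show ?thesis by blast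
        qed
        then obtain k where k: "t k \<le> n" "n < t (Suc k)" by blast
        then obtain j where j: "n = t k + j" using le_Suc_ex by blast
        then have jl: "j \<le> l k" using k(2) by (simp add: t_def)
        have "excess r (s k) (run r (run r C \<omega> (t k)) (\<lambda>i. \<omega> (t k + i)) j) \<le> 0"
          using excess_run_le_walk(2)[OF stage r _ jl less_imp_le[OF lev(1)[of k]], of "\<lambda>i. \<omega> (t k + i)"] ok[of k]
          unfolding ok_def by auto
        then show ?thesis
          using excess_antimono[OF lev(2)[of k], of r "run r C \<omega> n"] by (simp add: j run_add)
      qed
      then show "\<omega> \<in> {\<omega>. \<forall>n. excess r m' (run r C \<omega> n) \<le> 0}" by simp
    qed
  qed
  finally show ?thesis .
qed

lemma isCont_tail: "measure \<mu> {x} = 0 \<Longrightarrow> isCont tail x"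
proof -
  assume "measure \<mu> {x} = 0"
  then have "isCont (cdf \<mu>) x" by (simp add: D.isCont_cdf)
  moreover have "tail = (\<lambda>x. 1 - cdf \<mu> x)"
  proof
    fix x
    have "space \<mu> - {..x} = {x<..}" by auto
    then show "tail x = 1 - cdf \<mu> x"
      using D.prob_compl[of "{..x}"] by (simp add: tail_def cdf_def)
  qed
  ultimately show ?thesis by simp
qed

text \<open>
To start the moving levels, the excess at the first level \<open>s 0\<close> must be negative enough. From any state with
quantile at most \<open>m\<close> this is reached with positive probability, namely if for a fixed number of rounds every pair has
its midpoint at or above \<open>s 0\<close> and its smaller candidate at or below \<open>s 0\<close>. So a quantile that is at most \<open>m\<close> infinitely often
reaches such a starting position again and again, and from there it never gets above \<open>m'\<close> with
probability at least \<open>1 / 2\<close>.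
\<close>

lemma AE_cross_below:
  assumes mm: "m < m'" and atomless: "\<And>s. m \<le> s \<Longrightarrow> s \<le> m' \<Longrightarrow> measure \<mu> {s} = 0"
    and charged: "tail m' < tail m"
    and neg: "\<And>s. m < s \<Longrightarrow> s \<le> m' \<Longrightarrow> (tail s)\<^sup>2 \<le> (1 - r) * mid_ge s"
  shows "AE \<omega> in \<S>. (\<exists>\<^sub>\<infinity>t. excess r m (traj \<omega> t) \<le> 0) \<longrightarrow> (\<forall>\<^sub>F t in sequentially. excess r m' (traj \<omega> t) \<le> 0)"
proof -
  \<comment> \<open>half of the available mass, so that the limit of the values \<open>v k\<close> is attained at \<open>m'\<close> and \<open>v 0\<close> lies strictly below the value at \<open>m\<close>\<close>
  define d where "d = ((tail m)\<^sup>2 - (tail m')\<^sup>2) / 2"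
  have sq: "(tail m')\<^sup>2 < (tail m)\<^sup>2"
    using charged tail_nonneg[of m'] by (intro power_strict_mono) auto
  have "(tail m)\<^sup>2 \<le> 1" using tail_nonneg tail_le_1 by (simp add: power_le_one)
  then have "(tail m)\<^sup>2 - (tail m')\<^sup>2 \<le> 2" using zero_le_power2[of "tail m'"] by linarith
  then have d: "0 < d" "d \<le> 1" using sq by (simp_all add: d_def)
  define v where "v k = (tail m')\<^sup>2 + d / 2 ^ k" for k :: nat
  have "\<exists>s. m \<le> s \<and> s \<le> m' \<and> (tail s)\<^sup>2 = v k" for k
  proof (rule IVT2)
    have "d / 2 ^ k \<le> d" using d divide_left_mono[of 1 "2 ^ k" d] by (simp add: one_le_power)
    moreover have "(tail m')\<^sup>2 + d \<le> (tail m)\<^sup>2" using sq by (simp add: d_def field_simps)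
    ultimately show "v k \<le> (tail m)\<^sup>2" unfolding v_def by linarith
    show "(tail m')\<^sup>2 \<le> v k" using d by (simp add: v_def)
    show "\<forall>x. m \<le> x \<and> x \<le> m' \<longrightarrow> isCont (\<lambda>s. (tail s)\<^sup>2) x"
      using isCont_tail atomless by (auto intro!: continuous_intros)
  qed (use mm in simp)
  then obtain s where s: "\<And>k. m \<le> s k" "\<And>k. s k \<le> m'" "\<And>k. (tail (s k))\<^sup>2 = v k" by metis
  have v_Suc: "v k - v (Suc k) = d / 2 ^ Suc k" for k by (simp add: v_def field_simps)
  have s_Suc: "s k < s (Suc k)" for k
  proof (rule ccontr)
    assume "\<not> s k < s (Suc k)"
    then have "tail (s k) \<le> tail (s (Suc k))" by (intro tail_antimono) simp
    then have "v k \<le> v (Suc k)" unfolding s(3)[symmetric] by (intro power_mono tail_nonneg)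
    moreover have "0 < d / 2 ^ Suc k" using d by simp
    ultimately show False using v_Suc[of k] by linarith
  qed
  have s0: "m < s 0"
  proof (rule ccontr)
    assume "\<not> m < s 0"
    then have "v 0 = (tail m)\<^sup>2" using s(1)[of 0] s(3)[of 0] by simp
    then have "(tail m')\<^sup>2 + ((tail m)\<^sup>2 - (tail m')\<^sup>2) / 2 = (tail m)\<^sup>2" by (simp add: v_def d_def)
    then show False using sq by (simp add: field_simps)
  qed
  have neg': "(tail (s k))\<^sup>2 \<le> (1 - r) * mid_ge (s k)" for k
  proof (rule neg)
    have "s 0 \<le> s k" by (rule lift_Suc_mono_le[of s]) (use s_Suc less_imp_le in auto)
    with s0 show "m < s k" by simp
  qed (rule s)
  obtain L :: nat where "max 1 (4 * 81 * 4096 ^ 3 / d ^ 6) \<le> real L" using real_arch_simple by blast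
  then have L: "1 \<le> L" "4 * 81 * 4096 ^ 3 / d ^ 6 \<le> real L" by auto
  define a where "a = real L * d / 32"
  obtain t0 :: nat where "a / (1 - r) \<le> real t0" using real_arch_simple by blast
  then have t0: "a \<le> (1 - r) * real t0" using r by (simp add: pos_divide_le_eq mult.commute)
  define B where "B = {z. s 0 \<le> mid z} - {z. s 0 < low z}"
  have Bs: "B \<in> sets Z" unfolding B_def by (intro sets.Diff mid_low_events)
  have "0 < v 0" using d by (simp add: v_def add_nonneg_pos)
  then have "0 < mid_ge (s 0)" using tail_sq_le_mid_ge[of "s 0"] s(3)[of 0] by simp
  then have adr: "(1 - r) * mid_ge (s 0) < mid_ge (s 0)" using r by simp
  have "measure Z B = mid_ge (s 0) - (tail (s 0))\<^sup>2"
    unfolding B_def mid_ge_def measure_low[symmetric]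
  proof (rule Z.P.finite_measure_Diff)
    show "{z. s 0 < low z} \<subseteq> {z. s 0 \<le> mid z}"
      using low_le_mid by (auto intro: less_imp_le less_le_trans)
  qed (rule mid_low_events)+
  then have B: "0 < measure Z B" using neg'[of 0] adr by simp
  have pull: "AE \<omega> in \<S>. (\<exists>\<^sub>\<infinity>t. N \<le> t \<and> excess r m (traj \<omega> t) \<le> 0) \<longrightarrow> (\<exists>t\<ge>N. excess r (s 0) (traj \<omega> t) \<le> - a)" for N
  proof -
    define E where "E = {\<omega>. \<exists>t\<ge>N. excess r (s 0) (traj \<omega> t) \<le> - a}"
    have "{\<omega> \<in> space \<S>. \<exists>t\<ge>N. excess r (s 0) (traj \<omega> t) \<le> - a} \<in> sets \<S>" by measurable
    then have Es: "E \<in> sets \<S>" by (simp add: E_def)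
    have "AE \<omega> in \<S>. (\<exists>\<^sub>\<infinity>t. \<omega> \<in> {\<omega>. N \<le> t \<and> excess r m (traj \<omega> t) \<le> 0}) \<longrightarrow> \<omega> \<in> E"
    proof (rule SP.recurrence_zero_one[OF Es])
      show "SP.determined t {\<omega>. N \<le> t \<and> excess r m (traj \<omega> t) \<le> 0}" for t
        by (rule determined_traj) measurable
      show "0 < measure Z B ^ t0" using B by simp
      fix t \<omega> assume w: "\<omega> \<in> {\<omega>. N \<le> t \<and> excess r m (traj \<omega> t) \<le> 0}"
      have "emeasure \<S> {\<omega>' \<in> space \<S>. \<forall>i\<in>{..<t0}. \<omega>' i \<in> B} = (\<Prod>i\<in>{..<t0}. emeasure Z B)"
        using Bs by (intro SP.emeasure_PiM_Collect) auto
      then have "measure Z B ^ t0 = prb {\<omega>'. \<forall>i<t0. \<omega>' i \<in> B}"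
        by (simp add: lessThan_def Ball_def Z.P.emeasure_eq_measure SP.P.emeasure_eq_measure ennreal_power)
      also have "prb {\<omega>'. \<forall>i<t0. \<omega>' i \<in> B} \<le> prb {\<omega>' \<in> space \<S>. comb_seq t \<omega> \<omega>' \<in> E}"
      proof (rule SP.P.finite_measure_mono[OF _ comb_seq_event[OF Es]])
        show "{\<omega>'. \<forall>i<t0. \<omega>' i \<in> B} \<subseteq> {\<omega>' \<in> space \<S>. comb_seq t \<omega> \<omega>' \<in> E}"
        proof safe
          fix \<omega>' assume h: "\<forall>i<t0. \<omega>' i \<in> B"
          have "excess r (s 0) (run r (traj \<omega> t) \<omega>' j) \<le> - ((1 - r) * real j)" if "j \<le> t0" for j
            using that
          proof (induction j)
            case 0
            then show ?case using w excess_antimono[OF less_imp_le[OF s0], of r "traj \<omega> t"] by simp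
          next
            case (Suc j)
            let ?R = "run r (traj \<omega> t) \<omega>' j"
            have z: "s 0 \<le> mid (\<omega>' j)" "\<not> s 0 < low (\<omega>' j)" using h Suc.prems by (auto simp: B_def)
            have IH: "excess r (s 0) ?R \<le> - ((1 - r) * real j)" using Suc by simp
            then have "excess r (s 0) ?R \<le> 0" using r by (smt (verit) mult_nonneg_nonneg of_nat_0_le_iff)
            then have "admits r ?R (\<omega>' j)"
              unfolding admits_def using excess_antimono[OF z(1), of r ?R] by linarith
            then show ?case using z(2) IH by (simp add: excess_step algebra_simps)
          qed
          from this[of t0] t0 have "excess r (s 0) (traj (comb_seq t \<omega> \<omega>') (t + t0)) \<le> - a"
            by (simp add: run_comb_seq)
          moreover have "N \<le> t + t0" using w by simp
          ultimately show "comb_seq t \<omega> \<omega>' \<in> E" unfolding E_def by blast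
        qed simp
      qed
      finally show "measure Z B ^ t0 \<le> prb {\<omega>' \<in> space \<S>. comb_seq t \<omega> \<omega>' \<in> E}" .
    qed
    then show ?thesis by (simp add: E_def)
  qed
  have keep: "AE \<omega> in \<S>. (\<exists>\<^sub>\<infinity>t. excess r (s 0) (traj \<omega> t) \<le> - a) \<longrightarrow> (\<forall>\<^sub>F t in sequentially. excess r m' (traj \<omega> t) \<le> 0)"
  proof -
    define E where "E = {\<omega>. \<forall>\<^sub>F t in sequentially. excess r m' (traj \<omega> t) \<le> 0}"
    have "{\<omega> \<in> space \<S>. \<forall>\<^sub>F t in sequentially. excess r m' (traj \<omega> t) \<le> 0} \<in> sets \<S>"
      unfolding eventually_sequentially by measurable
    then have Es: "E \<in> sets \<S>" by (simp add: E_def)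
    have "AE \<omega> in \<S>. (\<exists>\<^sub>\<infinity>t. \<omega> \<in> {\<omega>. excess r (s 0) (traj \<omega> t) \<le> - a}) \<longrightarrow> \<omega> \<in> E"
    proof (rule SP.recurrence_zero_one[OF Es, of _ "1 / 2"])
      show "SP.determined t {\<omega>. excess r (s 0) (traj \<omega> t) \<le> - a}" for t
        by (rule determined_traj) measurable
      fix t \<omega> assume w: "\<omega> \<in> {\<omega>. excess r (s 0) (traj \<omega> t) \<le> - a}"
      have "1 / 2 \<le> prb {\<omega>'. \<forall>n. excess r m' (run r (traj \<omega> t) \<omega>' n) \<le> 0}"
        by (rule rising_levels_probability[where s = s and d = d and L = L])
           (use s_Suc s neg' v_Suc d L w in \<open>simp_all add: a_def\<close>)
      also have "\<dots> \<le> prb {\<omega>' \<in> space \<S>. comb_seq t \<omega> \<omega>' \<in> E}"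
        using eventually_comb_seq[of "\<lambda>C. excess r m' C \<le> 0" \<omega> t]
        by (intro SP.P.finite_measure_mono[OF _ comb_seq_event[OF Es]]) (auto simp: E_def)
      finally show "1 / 2 \<le> prb {\<omega>' \<in> space \<S>. comb_seq t \<omega> \<omega>' \<in> E}" .
    qed simp
    then show ?thesis by (simp add: E_def)
  qed
  have "AE \<omega> in \<S>. \<forall>N. (\<exists>\<^sub>\<infinity>t. N \<le> t \<and> excess r m (traj \<omega> t) \<le> 0) \<longrightarrow> (\<exists>t\<ge>N. excess r (s 0) (traj \<omega> t) \<le> - a)"
    using pull by (simp add: AE_all_countable)
  with keep show ?thesis
  proof eventually_elim
    case (elim \<omega>)
    show ?case
    proof
      assume inf: "\<exists>\<^sub>\<infinity>t. excess r m (traj \<omega> t) \<le> 0"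
      have "\<exists>\<^sub>\<infinity>t. N \<le> t \<and> excess r m (traj \<omega> t) \<le> 0" for N
        using INFM_conjI[OF inf, of "\<lambda>t. N \<le> t"] by (auto simp: MOST_nat_le conj_commute)
      then have "\<exists>\<^sub>\<infinity>t. excess r (s 0) (traj \<omega> t) \<le> - a"
        using elim(2) unfolding INFM_nat_le by blast
      with elim(1) show "\<forall>\<^sub>F t in sequentially. excess r m' (traj \<omega> t) \<le> 0" by blast
    qed
  qed
qed

end

section \<open>Tails and support of the opinion law\<close>

context finite_measure
begin

lemma tail_at_left:
  fixes f :: "'a \<Rightarrow> real"
  assumes f [measurable]: "f \<in> borel_measurable M" and A [measurable]: "A \<in> sets M"
  shows "((\<lambda>q. measure M {z \<in> A. q \<le> f z}) \<longlongrightarrow> measure M {z \<in> A. x \<le> f z}) (at_left x)"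
    and "((\<lambda>q. measure M {z \<in> A. q < f z}) \<longlongrightarrow> measure M {z \<in> A. x \<le> f z}) (at_left x)"
proof -
  have AM: "A \<subseteq> space M" by (rule sets.sets_into_space[OF A])
  have ev: "{z \<in> A. q \<le> f z} \<in> sets M" "{z \<in> A. q < f z} \<in> sets M" for q
  proof -
    have "{z \<in> space M. z \<in> A \<and> q \<le> f z} \<in> sets M" "{z \<in> space M. z \<in> A \<and> q < f z} \<in> sets M" by measurable
    moreover have "{z \<in> space M. z \<in> A \<and> q \<le> f z} = {z \<in> A. q \<le> f z}" "{z \<in> space M. z \<in> A \<and> q < f z} = {z \<in> A. q < f z}"
      using AM by auto
    ultimately show "{z \<in> A. q \<le> f z} \<in> sets M" "{z \<in> A. q < f z} \<in> sets M" by simp_all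
  qed
  have lim: "x \<le> f z" if "\<And>n. S n \<le> f z" "S \<longlonglongrightarrow> x" for S z
    using that(2) by (rule LIMSEQ_le_const2) (use that(1) in auto)
  show "((\<lambda>q. measure M {z \<in> A. q \<le> f z}) \<longlongrightarrow> measure M {z \<in> A. x \<le> f z}) (at_left x)"
  proof (rule tendsto_at_left_sequentially[of "x - 1"])
    fix S assume S: "\<And>n. S n < x" "incseq S" "S \<longlonglongrightarrow> x"
    have "(\<lambda>n. measure M {z \<in> A. S n \<le> f z}) \<longlonglongrightarrow> measure M (\<Inter>n. {z \<in> A. S n \<le> f z})"
      by (rule finite_Lim_measure_decseq) (use ev S(2) in \<open>auto simp: decseq_def incseq_def intro: order_trans\<close>)
    moreover have "(\<Inter>n. {z \<in> A. S n \<le> f z}) = {z \<in> A. x \<le> f z}"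
      using lim[OF _ S(3)] S(1) by (auto intro: less_imp_le[OF less_le_trans])
    ultimately show "(\<lambda>n. measure M {z \<in> A. S n \<le> f z}) \<longlonglongrightarrow> measure M {z \<in> A. x \<le> f z}" by simp
  qed simp
  show "((\<lambda>q. measure M {z \<in> A. q < f z}) \<longlongrightarrow> measure M {z \<in> A. x \<le> f z}) (at_left x)"
  proof (rule tendsto_at_left_sequentially[of "x - 1"])
    fix S assume S: "\<And>n. S n < x" "incseq S" "S \<longlonglongrightarrow> x"
    have "(\<lambda>n. measure M {z \<in> A. S n < f z}) \<longlonglongrightarrow> measure M (\<Inter>n. {z \<in> A. S n < f z})"
      by (rule finite_Lim_measure_decseq) (use ev S(2) in \<open>auto simp: decseq_def incseq_def intro: le_less_trans\<close>)
    moreover have "(\<Inter>n. {z \<in> A. S n < f z}) = {z \<in> A. x \<le> f z}"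
      using lim[OF less_imp_le S(3)] S(1) by (auto intro: less_le_trans)
    ultimately show "(\<lambda>n. measure M {z \<in> A. S n < f z}) \<longlonglongrightarrow> measure M {z \<in> A. x \<le> f z}" by simp
  qed simp
qed

lemma tail_at_right:
  fixes f :: "'a \<Rightarrow> real"
  assumes f [measurable]: "f \<in> borel_measurable M" and A [measurable]: "A \<in> sets M"
  shows "((\<lambda>q. measure M {z \<in> A. q \<le> f z}) \<longlongrightarrow> measure M {z \<in> A. x < f z}) (at_right x)"
    and "((\<lambda>q. measure M {z \<in> A. q < f z}) \<longlongrightarrow> measure M {z \<in> A. x < f z}) (at_right x)"
proof -
  have AM: "A \<subseteq> space M" by (rule sets.sets_into_space[OF A])
  have ev: "{z \<in> A. q \<le> f z} \<in> sets M" "{z \<in> A. q < f z} \<in> sets M" for q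
  proof -
    have "{z \<in> space M. z \<in> A \<and> q \<le> f z} \<in> sets M" "{z \<in> space M. z \<in> A \<and> q < f z} \<in> sets M" by measurable
    moreover have "{z \<in> space M. z \<in> A \<and> q \<le> f z} = {z \<in> A. q \<le> f z}" "{z \<in> space M. z \<in> A \<and> q < f z} = {z \<in> A. q < f z}"
      using AM by auto
    ultimately show "{z \<in> A. q \<le> f z} \<in> sets M" "{z \<in> A. q < f z} \<in> sets M" by simp_all
  qed
  have lim: "\<exists>n. S n < f z" if "x < f z" "S \<longlonglongrightarrow> x" for S z
    using order_tendstoD(2)[OF that(2,1)] by (auto simp: eventually_sequentially)
  show "((\<lambda>q. measure M {z \<in> A. q \<le> f z}) \<longlongrightarrow> measure M {z \<in> A. x < f z}) (at_right x)"
  proof (rule tendsto_at_right_sequentially[of _ "x + 1"])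
    fix S assume S: "\<And>n. x < S n" "decseq S" "S \<longlonglongrightarrow> x"
    have "(\<lambda>n. measure M {z \<in> A. S n \<le> f z}) \<longlonglongrightarrow> measure M (\<Union>n. {z \<in> A. S n \<le> f z})"
      by (rule finite_Lim_measure_incseq) (use ev S(2) in \<open>auto simp: decseq_def incseq_def intro: order_trans\<close>)
    moreover have "(\<Union>n. {z \<in> A. S n \<le> f z}) = {z \<in> A. x < f z}"
    proof safe
      fix z n assume "S n \<le> f z"
      then show "x < f z" using S(1)[of n] by simp
    next
      fix z assume "z \<in> A" "x < f z"
      moreover from lim[OF this(2) S(3)] obtain n where "S n < f z" ..
      ultimately show "z \<in> (\<Union>n. {z \<in> A. S n \<le> f z})" by (auto intro: less_imp_le)
    qed
    ultimately show "(\<lambda>n. measure M {z \<in> A. S n \<le> f z}) \<longlonglongrightarrow> measure M {z \<in> A. x < f z}" by simp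
  qed simp
  show "((\<lambda>q. measure M {z \<in> A. q < f z}) \<longlongrightarrow> measure M {z \<in> A. x < f z}) (at_right x)"
  proof (rule tendsto_at_right_sequentially[of _ "x + 1"])
    fix S assume S: "\<And>n. x < S n" "decseq S" "S \<longlonglongrightarrow> x"
    have "(\<lambda>n. measure M {z \<in> A. S n < f z}) \<longlonglongrightarrow> measure M (\<Union>n. {z \<in> A. S n < f z})"
      by (rule finite_Lim_measure_incseq) (use ev S(2) in \<open>auto simp: decseq_def incseq_def intro: le_less_trans\<close>)
    moreover have "(\<Union>n. {z \<in> A. S n < f z}) = {z \<in> A. x < f z}"
      using lim[OF _ S(3)] S(1) by (auto intro: less_trans)
    ultimately show "(\<lambda>n. measure M {z \<in> A. S n < f z}) \<longlonglongrightarrow> measure M {z \<in> A. x < f z}" by simp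
  qed simp
qed

end

locale nonneg_opinions = opinions +
  assumes nonneg: "measure \<mu> {0..} = 1"
begin

abbreviation "supp \<equiv> measure_support \<mu>"

text \<open>
The one-sided limits of the tails differ by the atoms: \<open>tail_ge\<close> is the limit of \<open>tail\<close> from the left, and
\<open>mid_gt\<close> and \<open>joint_gt\<close> are the limits of \<open>mid_ge\<close> and \<open>joint_ge\<close> from the right. If the quantile is \<open>q\<close>, a round
adds a member above \<open>m\<close> with probability \<open>joint_ge m q\<close>.
\<close>

definition tail_ge where "tail_ge m = measure \<mu> {m..}"
definition mid_gt where "mid_gt m = measure Z {z. m < mid z}"
definition joint_ge where "joint_ge m q = measure Z {z. m < low z \<and> q \<le> mid z}"
definition joint_gt where "joint_gt m q = measure Z {z. m < low z \<and> q < mid z}"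

lemmas [simp] = mid_low_events[unfolded sets_Z] admits_event[unfolded sets_Z]

lemma mid_Z: "mid \<in> borel_measurable Z" by measurable

lemma tail_at_right: "(tail \<longlongrightarrow> tail x) (at_right x)"
  using D.tail_at_right(2)[of "\<lambda>x. x" UNIV x] by (simp add: tail_def[abs_def] greaterThan_def)

lemma tail_at_left: "(tail \<longlongrightarrow> tail_ge x) (at_left x)"
  using D.tail_at_left(2)[of "\<lambda>x. x" UNIV x] by (simp add: tail_def[abs_def] tail_ge_def greaterThan_def atLeast_def)

lemma mid_ge_at_left: "(mid_ge \<longlongrightarrow> mid_ge x) (at_left x)"
  using Z.P.tail_at_left(1)[OF mid_Z sets.top, of x] by (simp add: mid_ge_def[abs_def])

lemma mid_ge_at_right: "(mid_ge \<longlongrightarrow> mid_gt x) (at_right x)"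
  using Z.P.tail_at_right(1)[OF mid_Z sets.top, of x] by (simp add: mid_ge_def[abs_def] mid_gt_def)

lemma joint_ge_at_left: "(joint_ge m \<longlongrightarrow> joint_ge m x) (at_left x)"
  using Z.P.tail_at_left(1)[OF mid_Z mid_low_events(1)[of m], of x] by (simp add: joint_ge_def[abs_def])

lemma joint_ge_at_right: "(joint_ge m \<longlongrightarrow> joint_gt m x) (at_right x)"
  using Z.P.tail_at_right(1)[OF mid_Z mid_low_events(1)[of m], of x] by (simp add: joint_ge_def[abs_def] joint_gt_def)

lemma joint_ge_events: "{z. m < low z \<and> q \<le> mid z} \<in> sets Z" "{z. m < low z \<and> q < mid z} \<in> sets Z"
proof -
  have "{z \<in> space Z. m < low z \<and> q \<le> mid z} \<in> sets Z" "{z \<in> space Z. m < low z \<and> q < mid z} \<in> sets Z"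
    by measurable
  then show "{z. m < low z \<and> q \<le> mid z} \<in> sets Z" "{z. m < low z \<and> q < mid z} \<in> sets Z" by simp_all
qed

lemmas [simp] = joint_ge_events[unfolded sets_Z]

lemma mid_ge_antimono: "m \<le> m' \<Longrightarrow> mid_ge m' \<le> mid_ge m"
  unfolding mid_ge_def by (rule Z.P.finite_measure_mono) (auto intro: mid_low_events)

lemma mid_gt_le_mid_ge: "mid_gt m \<le> mid_ge m"
  unfolding mid_ge_def mid_gt_def by (rule Z.P.finite_measure_mono) (auto intro: mid_low_events)

lemma measure_rect:
  assumes "A \<in> sets borel" "B \<in> sets borel"
  shows "measure Z (A \<times> B) = measure \<mu> A * measure \<mu> B"
  using assms by (simp add: measure_def D.emeasure_pair_measure_Times enn2real_mult)

lemma rect_event: "A \<in> sets borel \<Longrightarrow> B \<in> sets borel \<Longrightarrow> A \<times> B \<in> sets Z"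
  by (intro pair_measureI) simp_all

lemma supp_interval_pos: "x \<in> supp \<Longrightarrow> a < x \<Longrightarrow> x < c \<Longrightarrow> 0 < measure \<mu> {a<..<c}"
  unfolding measure_support_def
  by (auto simp: D.emeasure_eq_measure dest!: spec[of _ "{a<..<c}"])

lemma closed_supp: "closed supp"
proof -
  have "open (- supp)"
    unfolding open_contains_ball
  proof
    fix x assume "x \<in> - supp"
    then obtain U where U: "open U" "x \<in> U" "\<not> 0 < emeasure \<mu> U" by (auto simp: measure_support_def)
    then obtain e where "e > 0" "ball x e \<subseteq> U" by (meson open_contains_ball)
    moreover have "U \<subseteq> - supp" using U by (auto simp: measure_support_def)
    ultimately show "\<exists>e>0. ball x e \<subseteq> - supp" by blast
  qed
  then show ?thesis by (simp add: closed_def)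
qed

lemma AE_supp: "AE x in \<mu>. x \<in> supp"
proof -
  obtain B :: "real set set" where B: "countable B" "topological_basis B"
    using ex_countable_basis by blast
  let ?B = "{b \<in> B. emeasure \<mu> b = 0}"
  have o: "open b" if "b \<in> B" for b using B(2) that by (rule topological_basis_open)
  have "(\<Union>b\<in>?B. b) \<in> null_sets \<mu>"
    using B(1) o by (intro null_sets_UN') (auto intro: countable_subset[of _ B])
  moreover have "{x \<in> space \<mu>. x \<notin> supp} \<subseteq> (\<Union>b\<in>?B. b)"
  proof safe
    fix x assume "x \<notin> supp"
    then obtain U where U: "open U" "x \<in> U" "emeasure \<mu> U = 0" by (auto simp: measure_support_def)
    obtain b where b: "b \<in> B" "x \<in> b" "b \<subseteq> U"
      using topological_basisE[OF B(2) U(1,2)] by blast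
    have "emeasure \<mu> b \<le> emeasure \<mu> U" using b U(1) by (intro emeasure_mono) auto
    then show "x \<in> (\<Union>b\<in>?B. b)" using b U(3) by auto
  qed
  ultimately show ?thesis by (rule AE_I')
qed

lemma tail_pos_iff: "0 < tail m \<longleftrightarrow> (\<exists>x\<in>supp. m < x)"
proof
  assume pos: "0 < tail m"
  show "\<exists>x\<in>supp. m < x"
  proof (rule ccontr)
    assume "\<not> (\<exists>x\<in>supp. m < x)"
    then have "AE x in \<mu>. x \<notin> {m<..}" using AE_supp by (auto elim: eventually_mono)
    then have "tail m = 0" unfolding tail_def by (subst D.prob_eq_0) auto
    with pos show False by simp
  qed
next
  assume "\<exists>x\<in>supp. m < x"
  then obtain x where "x \<in> supp" "m < x" ..
  then have "0 < measure \<mu> {m<..<x + 1}" by (intro supp_interval_pos) auto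
  also have "\<dots> \<le> tail m" unfolding tail_def by (intro D.finite_measure_mono) auto
  finally show "0 < tail m" .
qed

lemma tail_pos_iff_mu_max: "0 < tail m \<longleftrightarrow> ereal m < mu_max \<mu>"
  unfolding tail_pos_iff mu_max_def less_SUP_iff by simp

lemma mid_ge_pos: "0 < tail m \<Longrightarrow> 0 < mid_ge m"
  using tail_sq_le_mid_ge[of m] by (smt (verit) zero_less_power)

lemma mid_gt_pos: "0 < tail m \<Longrightarrow> 0 < mid_gt m"
proof -
  assume "0 < tail m"
  then have "0 < (tail m)\<^sup>2" by simp
  also have "\<dots> \<le> mid_gt m"
    unfolding measure_low[symmetric] mid_gt_def
    by (rule Z.P.finite_measure_mono) (auto intro: mid_low_events less_le_trans[OF _ low_le_mid])
  finally show ?thesis .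
qed

text \<open>
If one candidate lands near \<open>\<alpha>\<close> and the other near \<open>\<beta>\<close>, the midpoint lands near \<open>(\<alpha> + \<beta>) / 2\<close>;
so the law of the midpoint charges every neighbourhood of such a point, although its own support may be hard to
describe.
\<close>

lemma mid_ge_strict:
  assumes "\<alpha> \<in> supp" "\<beta> \<in> supp" "s < (\<alpha> + \<beta>) / 2" "(\<alpha> + \<beta>) / 2 < s'"
  shows "mid_ge s' < mid_ge s"
proof -
  define c where "c = (\<alpha> + \<beta>) / 2"
  define \<eta> where "\<eta> = min (c - s) (s' - c) / 2"
  have \<eta>: "\<eta> > 0" "\<eta> < c - s" "\<eta> < s' - c"
    using assms by (auto simp: \<eta>_def c_def[symmetric])
  let ?I = "{\<alpha> - \<eta><..<\<alpha> + \<eta>}" and ?J = "{\<beta> - \<eta><..<\<beta> + \<eta>}"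
  have "0 < measure Z (?I \<times> ?J)"
    using \<eta>(1) assms by (simp add: measure_rect supp_interval_pos)
  also have "\<dots> \<le> measure Z ({z. s \<le> mid z} - {z. s' \<le> mid z})"
  proof (rule Z.P.finite_measure_mono)
    show "?I \<times> ?J \<subseteq> {z. s \<le> mid z} - {z. s' \<le> mid z}"
    proof (rule subsetI)
      fix z assume "z \<in> ?I \<times> ?J"
      moreover have "\<alpha> + \<beta> = 2 * c" by (simp add: c_def)
      ultimately have "2 * c - 2 * \<eta> < fst z + snd z" "fst z + snd z < 2 * c + 2 * \<eta>" by auto
      then show "z \<in> {z. s \<le> mid z} - {z. s' \<le> mid z}"
        using \<eta> by (simp add: mid_def)
    qed
  qed (intro sets.Diff mid_low_events)
  also have "\<dots> = mid_ge s - mid_ge s'"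
    unfolding mid_ge_def using assms by (intro Z.P.finite_measure_Diff mid_low_events) auto
  finally show ?thesis by simp
qed

lemma tail_diff: "a \<le> c \<Longrightarrow> tail a - tail c = measure \<mu> {a<..c}"
proof -
  assume "a \<le> c"
  then have "{a<..} - {c<..} = {a<..c}" by auto
  then show ?thesis
    unfolding tail_def using \<open>a \<le> c\<close> by (subst D.finite_measure_Diff[symmetric]) auto
qed

lemma tail_ge_eq: "a < c \<Longrightarrow> measure \<mu> {a<..<c} = 0 \<Longrightarrow> tail a = tail_ge c"
proof -
  assume a: "a < c" "measure \<mu> {a<..<c} = 0"
  then have eq: "{a<..} = {a<..<c} \<union> {c..}" by auto
  have "tail a = measure \<mu> {a<..<c} + tail_ge c"
    unfolding tail_def tail_ge_def eq by (rule D.finite_measure_Union) auto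
  then show ?thesis using a by simp
qed

lemma measure_low_ge: "measure Z {z. x \<le> low z} = (tail_ge x)\<^sup>2"
proof -
  have "{z. x \<le> low z} = {x..} \<times> {x..}" by (auto simp: low_def)
  then show ?thesis by (simp add: measure_rect tail_ge_def power2_eq_square)
qed

text \<open>
If there is no mass immediately to the left of a point \<open>x\<close> of the support, then \<open>x\<close> ends a gap of the
support. Across the gap \<open>tail\<close> is constant, but \<open>mid_ge\<close> strictly decreases at its middle,
because one candidate may lie at each end. So the inequality at a level \<open>s\<close> in the left half of the
gap is strict at \<open>x\<close>. If the gap reaches down to \<open>m\<close>, strictness comes from the hypothesis on
\<open>m\<close> instead.
\<close>

lemma charged_left_of_gap:
  assumes x: "x \<in> supp" "m < x" and ratio: "\<And>s. s \<in> \<rat> \<Longrightarrow> m < s \<Longrightarrow> s < x \<Longrightarrow> (1 - r) * mid_ge s \<le> (tail s)\<^sup>2"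
    and strict: "(1 - r) * mid_ge m < (tail m)\<^sup>2" and gap: "m \<le> y" "y < x" "measure \<mu> {y<..<x} = 0"
  shows "\<exists>s. m \<le> s \<and> s < x \<and> measure \<mu> {s<..<x} = 0 \<and> (1 - r) * mid_ge x < (tail s)\<^sup>2"
proof -
  define Y where "Y = {y. m \<le> y \<and> y < x \<and> measure \<mu> {y<..<x} = 0}"
  define \<alpha> where "\<alpha> = Inf Y"
  have Y: "y \<in> Y" "bdd_below Y" using gap by (auto simp: Y_def)
  have \<alpha>: "m \<le> \<alpha>" "\<alpha> < x"
    using Y gap(2) cInf_lower[OF Y] unfolding \<alpha>_def by (auto intro!: cInf_greatest simp: Y_def)
  have gap_above: "measure \<mu> {s<..<x} = 0" if "\<alpha> < s" "s < x" for s
  proof -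
    obtain y' where "y' \<in> Y" "y' < s"
      using \<open>\<alpha> < s\<close> Y cInf_less_iff[of Y s] unfolding \<alpha>_def by blast
    then have "measure \<mu> {s<..<x} \<le> measure \<mu> {y'<..<x}"
      by (intro D.finite_measure_mono) auto
    then show ?thesis using \<open>y' \<in> Y\<close> by (simp add: Y_def measure_le_0_iff)
  qed
  have gap\<alpha>: "measure \<mu> {\<alpha><..<x} = 0"
  proof -
    have "(\<lambda>n. measure \<mu> {\<alpha> + (x - \<alpha>) / real (n + 2)<..<x}) \<longlonglongrightarrow> measure \<mu> (\<Union>n. {\<alpha> + (x - \<alpha>) / real (n + 2)<..<x})"
      using \<alpha>(2) by (intro D.finite_Lim_measure_incseq)
        (auto simp: incseq_def intro!: add_left_mono divide_left_mono elim!: le_less_trans[rotated])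
    moreover have "measure \<mu> {\<alpha> + (x - \<alpha>) / real (n + 2)<..<x} = 0" for n
    proof (rule gap_above)
      show "\<alpha> < \<alpha> + (x - \<alpha>) / real (n + 2)" using \<alpha>(2) by simp
      have "(x - \<alpha>) / real (n + 2) < (x - \<alpha>) / 1"
        using \<alpha>(2) by (intro divide_strict_left_mono) auto
      then show "\<alpha> + (x - \<alpha>) / real (n + 2) < x" by simp
    qed
    moreover have "(\<Union>n. {\<alpha> + (x - \<alpha>) / real (n + 2)<..<x}) = {\<alpha><..<x}"
    proof safe
      fix v n assume "v \<in> {\<alpha> + (x - \<alpha>) / real (n + 2)<..<x}"
      then show "v \<in> {\<alpha><..<x}" using \<alpha>(2) by (auto intro: less_trans[rotated])
    next
      fix v assume v: "v \<in> {\<alpha><..<x}"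
      have "(\<lambda>n. \<alpha> + (x - \<alpha>) / real (n + 2)) \<longlonglongrightarrow> \<alpha> + 0"
        by (intro tendsto_add tendsto_const LIMSEQ_ignore_initial_segment[OF lim_const_over_n, of _ 2])
      then have "\<forall>\<^sub>F n in sequentially. \<alpha> + (x - \<alpha>) / real (n + 2) < v"
        using v by (intro order_tendstoD) auto
      then obtain n where "\<alpha> + (x - \<alpha>) / real (n + 2) < v" by (auto simp: eventually_sequentially)
      then show "v \<in> (\<Union>n. {\<alpha> + (x - \<alpha>) / real (n + 2)<..<x})" using v by auto
    qed
    ultimately show ?thesis by (simp add: LIMSEQ_const_iff)
  qed
  show ?thesis
  proof (cases "\<alpha> = m")
    case True
    have "(1 - r) * mid_ge x \<le> (1 - r) * mid_ge m"
      using x(2) r mid_ge_antimono[of m x] by (intro mult_left_mono) auto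
    then show ?thesis using True gap\<alpha> strict x(2) by (intro exI[of _ m]) auto
  next
    case False
    then have ma: "m < \<alpha>" using \<alpha> by simp
    have "\<alpha> \<in> supp"
      unfolding measure_support_def mem_Collect_eq
    proof (intro allI impI)
      fix U assume U: "open U \<and> \<alpha> \<in> U"
      then obtain e where e: "e > 0" "ball \<alpha> e \<subseteq> U" by (meson open_contains_ball)
      define c where "c = max m (\<alpha> - e / 2)"
      have c: "m \<le> c" "c < \<alpha>" "\<alpha> - e < c" using ma e(1) by (auto simp: c_def)
      have "c \<notin> Y" using cInf_lower[OF _ Y(2), of c] c by (auto simp: \<alpha>_def)
      then have "0 < measure \<mu> {c<..<x}"
        using c \<alpha>(2) by (auto simp: Y_def zero_less_measure_iff)
      also have "measure \<mu> {c<..<x} \<le> measure \<mu> ({c<..\<alpha>} \<union> {\<alpha><..<x})"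
        by (intro D.finite_measure_mono) auto
      also have "\<dots> \<le> measure \<mu> {c<..\<alpha>} + measure \<mu> {\<alpha><..<x}"
        by (intro measure_Un_le) auto
      also have "\<dots> = measure \<mu> {c<..\<alpha>}" using gap\<alpha> by simp
      also have "\<dots> \<le> measure \<mu> U"
        using U e c by (intro D.finite_measure_mono) (auto simp: dist_real_def subset_iff)
      finally show "0 < emeasure \<mu> U" by (simp add: D.emeasure_eq_measure)
    qed
    obtain s where s: "s \<in> \<rat>" "\<alpha> < s" "s < (\<alpha> + x) / 2"
      using Rats_dense_in_real[of \<alpha> "(\<alpha> + x) / 2"] \<alpha>(2) by auto
    have "mid_ge x < mid_ge s" using \<open>\<alpha> \<in> supp\<close> x(1) s(3) \<alpha>(2) by (intro mid_ge_strict[of \<alpha> x]) auto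
    then have "(1 - r) * mid_ge x < (1 - r) * mid_ge s" using r by simp
    also have "\<dots> \<le> (tail s)\<^sup>2" using s \<alpha> ma by (intro ratio) auto
    finally show ?thesis using s \<alpha> gap_above by (intro exI[of _ s]) auto
  qed
qed

lemma rect_right_pos:
  assumes "0 < tail x"
  shows "\<exists>\<eta>>0. 0 < tail (x + \<eta>)"
proof -
  obtain x' where "x' \<in> supp" "x < x'" using assms tail_pos_iff by auto
  then show ?thesis by (intro exI[of _ "(x' - x) / 2"]) (auto simp: tail_pos_iff field_simps intro!: bexI[of _ x'])
qed

text \<open>
The pairs with both candidates at or above \<open>x\<close> already balance the threshold. If there is mass immediately
to the left of \<open>x\<close>, then pairs with the smaller candidate slightly below \<open>x\<close> and the larger one well
above \<open>x\<close> give a strict surplus. Otherwise \<open>x\<close> ends a gap.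
\<close>

lemma upward_drift_left:
  assumes x: "x \<in> supp" "m < x" "0 < tail x" and ratio: "\<And>s. s \<in> \<rat> \<Longrightarrow> m < s \<Longrightarrow> s < x \<Longrightarrow> (1 - r) * mid_ge s \<le> (tail s)\<^sup>2"
    and strict: "(1 - r) * mid_ge m < (tail m)\<^sup>2" and lim: "(1 - r) * mid_ge x \<le> (tail_ge x)\<^sup>2"
  shows "(1 - r) * mid_ge x < joint_ge m x"
proof (cases "\<exists>y. m \<le> y \<and> y < x \<and> measure \<mu> {y<..<x} = 0")
  case True
  then obtain s where s: "m \<le> s" "s < x" "measure \<mu> {s<..<x} = 0" "(1 - r) * mid_ge x < (tail s)\<^sup>2"
    using charged_left_of_gap[OF x(1,2) ratio strict] by blast
  have "(tail s)\<^sup>2 = measure Z {z. x \<le> low z}" using tail_ge_eq[OF s(2,3)] by (simp add: measure_low_ge)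
  also have "\<dots> \<le> joint_ge m x" unfolding joint_ge_def
    using x(2) by (intro Z.P.finite_measure_mono joint_ge_events) (auto intro: order_trans[OF _ low_le_mid])
  finally show ?thesis using s(4) by simp
next
  case False
  obtain \<eta> where \<eta>: "\<eta> > 0" "0 < tail (x + \<eta>)" using rect_right_pos[OF x(3)] by blast
  define y where "y = max m (x - \<eta>)"
  have y: "m \<le> y" "y < x" "x - \<eta> \<le> y" using x(2) \<eta>(1) by (auto simp: y_def)
  have pos: "0 < measure \<mu> {y<..<x}" using False y by (auto simp: zero_less_measure_iff)
  let ?R = "{y<..<x} \<times> {x + \<eta><..}"
  have low_ev: "{z. x \<le> low z} \<in> sets Z"
  proof -
    have "{z. x \<le> low z} = {x..} \<times> {x..}" by (auto simp: low_def)
    then show ?thesis by (simp only: rect_event borel_closed closed_atLeast)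
  qed
  have "(1 - r) * mid_ge x < (tail_ge x)\<^sup>2 + measure \<mu> {y<..<x} * tail (x + \<eta>)"
    using lim mult_pos_pos[OF pos \<eta>(2)] by linarith
  also have "\<dots> = measure Z {z. x \<le> low z} + measure Z ?R"
    by (simp add: measure_low_ge measure_rect tail_def)
  also have "\<dots> = measure Z ({z. x \<le> low z} \<union> ?R)"
    by (intro Z.P.finite_measure_Union[symmetric] low_ev rect_event) (auto simp: low_def)
  also have "\<dots> \<le> joint_ge m x" unfolding joint_ge_def
  proof (intro Z.P.finite_measure_mono joint_ge_events)
    show "{z. x \<le> low z} \<union> ?R \<subseteq> {z. m < low z \<and> x \<le> mid z}"
      using x(2) y \<eta>(1) by (auto simp: low_def mid_def)
  qed
  finally show ?thesis .
qed

text \<open>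
The counterpart of \<open>upward_drift_left\<close> for quantiles slightly above \<open>x\<close>. An atom at \<open>x\<close> now counts
as mass to the left.
\<close>

lemma upward_drift_right:
  assumes x: "x \<in> supp" "m < x" "0 < tail x" and ratio: "\<And>s. s \<in> \<rat> \<Longrightarrow> m < s \<Longrightarrow> s < x \<Longrightarrow> (1 - r) * mid_ge s \<le> (tail s)\<^sup>2"
    and strict: "(1 - r) * mid_ge m < (tail m)\<^sup>2" and lim: "(1 - r) * mid_gt x \<le> (tail x)\<^sup>2"
  shows "(1 - r) * mid_gt x < joint_gt m x"
proof (cases "\<exists>y. m \<le> y \<and> y < x \<and> measure \<mu> {y<..x} = 0")
  case True
  then obtain y where y: "m \<le> y" "y < x" "measure \<mu> {y<..x} = 0" by blast
  have "measure \<mu> {y<..<x} \<le> measure \<mu> {y<..x}" by (intro D.finite_measure_mono) auto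
  then have "measure \<mu> {y<..<x} = 0" using y(3) by (simp add: measure_le_0_iff)
  then obtain s where s: "m \<le> s" "s < x" "measure \<mu> {s<..<x} = 0" "(1 - r) * mid_ge x < (tail s)\<^sup>2"
    using charged_left_of_gap[OF x(1,2) ratio strict y(1,2)] by blast
  have "tail s = tail_ge x" by (rule tail_ge_eq[OF s(2,3)])
  also have "\<dots> = tail y" by (rule tail_ge_eq[symmetric, OF y(2)]) fact
  also have "\<dots> = tail x" using tail_diff[of y x] y by simp
  finally have "(1 - r) * mid_ge x < (tail x)\<^sup>2" using s(4) by simp
  moreover have "(1 - r) * mid_gt x \<le> (1 - r) * mid_ge x" using mid_gt_le_mid_ge r by (intro mult_left_mono) auto
  moreover have "(tail x)\<^sup>2 \<le> joint_gt m x" unfolding joint_gt_def measure_low[symmetric]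
    using x(2) by (intro Z.P.finite_measure_mono joint_ge_events) (auto intro: less_le_trans[OF _ low_le_mid])
  ultimately show ?thesis by simp
next
  case False
  obtain \<eta> where \<eta>: "\<eta> > 0" "0 < tail (x + \<eta>)" using rect_right_pos[OF x(3)] by blast
  define y where "y = max m (x - \<eta>)"
  have y: "m \<le> y" "y < x" "x - \<eta> \<le> y" using x(2) \<eta>(1) by (auto simp: y_def)
  have pos: "0 < measure \<mu> {y<..x}" using False y by (auto simp: zero_less_measure_iff)
  let ?R = "{y<..x} \<times> {x + \<eta><..}"
  have "(1 - r) * mid_gt x < (tail x)\<^sup>2 + measure \<mu> {y<..x} * tail (x + \<eta>)"
    using lim mult_pos_pos[OF pos \<eta>(2)] by linarith
  also have "\<dots> = measure Z {z. x < low z} + measure Z ?R"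
    by (simp add: measure_low measure_rect tail_def)
  also have "\<dots> = measure Z ({z. x < low z} \<union> ?R)"
    by (intro Z.P.finite_measure_Union[symmetric] mid_low_events rect_event) (auto simp: low_def)
  also have "\<dots> \<le> joint_gt m x" unfolding joint_gt_def
  proof (intro Z.P.finite_measure_mono joint_ge_events)
    show "{z. x < low z} \<union> ?R \<subseteq> {z. m < low z \<and> x < mid z}"
      using x(2) y \<eta>(1) by (auto simp: low_def mid_def)
  qed
  finally show ?thesis .
qed

lemma drift_near:
  assumes F: "eventually (\<lambda>q. (1 - r) * mid_ge q + e \<le> joint_ge m q) F" and e: "0 < e"
  shows "eventually (\<lambda>q. (1 - r + e) * mid_ge q \<le> joint_ge m q) F"
  using F
proof eventually_elim
  case (elim q)
  have "e * mid_ge q \<le> e * 1" using e by (intro mult_left_mono) (auto simp: mid_ge_def)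
  then show ?case using elim by (simp add: algebra_simps)
qed

lemma drift_at:
  assumes "((\<lambda>q. joint_ge m q) \<longlongrightarrow> k) F" "(mid_ge \<longlongrightarrow> a) F" "(1 - r) * a < k"
  shows "\<exists>e>0. eventually (\<lambda>q. (1 - r + e) * mid_ge q \<le> joint_ge m q) F"
proof -
  define e where "e = (k - (1 - r) * a) / 2"
  have "((\<lambda>q. joint_ge m q - (1 - r) * mid_ge q) \<longlongrightarrow> k - (1 - r) * a) F"
    by (intro tendsto_intros assms)
  moreover have "e < k - (1 - r) * a" using assms(3) by (simp add: e_def mult.commute)
  ultimately have "eventually (\<lambda>q. e < joint_ge m q - (1 - r) * mid_ge q) F" by (rule order_tendstoD)
  then have "eventually (\<lambda>q. (1 - r) * mid_ge q + e \<le> joint_ge m q) F" by eventually_elim simp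
  moreover have "0 < e" using assms(3) by (simp add: e_def)
  ultimately show ?thesis using drift_near by blast
qed

lemma drift_weaken:
  assumes "(1 - r + e) * mid_ge q \<le> joint_ge m q" "e' \<le> e"
  shows "(1 - r + e') * mid_ge q \<le> joint_ge m q"
proof -
  have "(1 - r + e') * mid_ge q \<le> (1 - r + e) * mid_ge q"
    using assms(2) by (intro mult_right_mono) (auto simp: mid_ge_def)
  then show ?thesis using assms(1) by simp
qed

lemma AE_Z_supp: "AE z in Z. fst z \<in> supp \<and> snd z \<in> supp"
proof -
  have sb: "supp \<in> sets borel" using closed_supp by simp
  have "measure \<mu> (- supp) = 0"
    using AE_supp sb by (subst D.prob_eq_0) (auto simp: Compl_eq_Diff_UNIV)
  then have n: "measure Z ((- supp) \<times> UNIV) = 0" "measure Z (UNIV \<times> (- supp)) = 0"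
    using sb by (simp_all add: measure_rect Compl_eq_Diff_UNIV)
  have ev: "(- supp) \<times> UNIV \<in> sets Z" "UNIV \<times> (- supp) \<in> sets Z"
    using sb by (auto intro!: rect_event simp: Compl_eq_Diff_UNIV)
  have "AE z in Z. z \<notin> (- supp) \<times> UNIV" "AE z in Z. z \<notin> UNIV \<times> (- supp)"
    using n ev by (auto simp: Z.P.prob_eq_0[symmetric])
  then show ?thesis
    by eventually_elim (auto simp: mem_Times_iff)
qed

lemma joint_ge_eq_mid_ge:
  assumes "\<forall>x\<in>supp. x \<le> u" "(m + u) / 2 < q"
  shows "joint_ge m q = mid_ge q"
  unfolding joint_ge_def mid_ge_def
proof (rule Z.P.finite_measure_eq_AE)
  show "AE z in Z. z \<in> {z. m < low z \<and> q \<le> mid z} \<longleftrightarrow> z \<in> {z. q \<le> mid z}"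
    using AE_Z_supp
  proof eventually_elim
    case (elim z)
    then have "fst z \<le> u" "snd z \<le> u" using assms(1) by auto
    then show ?case using assms(2) by (auto simp: low_def mid_def)
  qed
qed (auto intro: joint_ge_events mid_low_events)

lemma rat_limit_left:
  fixes f g :: "real \<Rightarrow> real"
  assumes "(f \<longlongrightarrow> F) (at_left x)" "(g \<longlongrightarrow> G) (at_left x)" "m < x"
    and le: "\<And>s. s \<in> \<rat> \<Longrightarrow> m < s \<Longrightarrow> s < x \<Longrightarrow> f s \<le> g s"
  shows "F \<le> G"
proof (rule ccontr)
  assume "\<not> F \<le> G"
  then have "\<forall>\<^sub>F s in at_left x. 0 < f s - g s"
    by (intro order_tendstoD(1)[OF tendsto_diff[OF assms(1,2)]]) simp
  then obtain b where b: "b < x" "\<And>y. b < y \<Longrightarrow> y < x \<Longrightarrow> 0 < f y - g y"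
    unfolding eventually_at_left_field by auto
  obtain s where "s \<in> \<rat>" "max b m < s" "s < x"
    using Rats_dense_in_real[of "max b m" x] b(1) assms(3) by auto
  then show False using b(2)[of s] le[of s] by simp
qed

lemma rat_limit_right:
  fixes f g :: "real \<Rightarrow> real"
  assumes "(f \<longlongrightarrow> F) (at_right x)" "(g \<longlongrightarrow> G) (at_right x)" "x < u"
    and le: "\<And>s. s \<in> \<rat> \<Longrightarrow> x < s \<Longrightarrow> s < u \<Longrightarrow> f s \<le> g s"
  shows "F \<le> G"
proof (rule ccontr)
  assume "\<not> F \<le> G"
  then have "\<forall>\<^sub>F s in at_right x. 0 < f s - g s"
    by (intro order_tendstoD(1)[OF tendsto_diff[OF assms(1,2)]]) simp
  then obtain b where b: "x < b" "\<And>y. x < y \<Longrightarrow> y < b \<Longrightarrow> 0 < f y - g y"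
    unfolding eventually_at_right_field by auto
  obtain s where "s \<in> \<rat>" "x < s" "s < min b u"
    using Rats_dense_in_real[of x "min b u"] b(1) assms(3) by auto
  then show False using b(2)[of s] le[of s] by simp
qed

text \<open>
A drift that is positive at each point of the support between \<open>m\<close> and \<open>u\<close>, and also in the limit from the right,
is bounded below on the whole range. The bound is taken relative to \<open>mid_ge\<close>, since close to the top of
the support admissions become rare; there every admitted pair exceeds \<open>m\<close> with both candidates
(\<open>joint_ge_eq_mid_ge\<close>).
\<close>

lemma uniform_drift:
  assumes mu: "m < u" "u \<in> supp"
    and ratio: "\<And>s. s \<in> \<rat> \<Longrightarrow> m < s \<Longrightarrow> s < u \<Longrightarrow> (1 - r) * mid_ge s \<le> (tail s)\<^sup>2"
    and strict: "(1 - r) * mid_ge m < (tail m)\<^sup>2"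
  shows "\<exists>e>0. \<forall>q\<in>supp. m < q \<and> q \<le> u \<longrightarrow> (1 - r + e) * mid_ge q \<le> joint_ge m q"
    and "0 < tail u \<Longrightarrow> (1 - r) * mid_ge u < joint_ge m u"
proof -
  define good where "good e q \<longleftrightarrow> (q \<in> supp \<longrightarrow> m < q \<longrightarrow> q \<le> u \<longrightarrow> (1 - r + e) * mid_ge q \<le> joint_ge m q)" for e q
  have good_weaken: "good e q \<Longrightarrow> e' \<le> e \<Longrightarrow> good e' q" for e e' q
    unfolding good_def using drift_weaken by blast
  have left_strict: "(1 - r) * mid_ge x < joint_ge m x" if x: "x \<in> supp" "m < x" "x \<le> u" "0 < tail x" for x
  proof (rule upward_drift_left[OF x(1,2,4) ratio strict])
    show "(1 - r) * mid_ge x \<le> (tail_ge x)\<^sup>2"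
      by (rule rat_limit_left[OF tendsto_mult[OF tendsto_const mid_ge_at_left] tendsto_power[OF tail_at_left] x(2)])
         (use ratio x(3) in auto)
  qed (use x in auto)
  show "0 < tail u \<Longrightarrow> (1 - r) * mid_ge u < joint_ge m u" using left_strict mu by simp
  have left: "\<exists>e>0. \<exists>\<delta>>0. \<forall>q. x - \<delta> < q \<longrightarrow> q \<le> x \<longrightarrow> good e q" if x: "x \<le> u" for x
  proof -
    consider "x \<le> m" | "x \<notin> supp" | "m < x" "x \<in> supp" "0 < tail x" | "m < x" "x \<in> supp" "\<not> 0 < tail x" by fastforce
    then show ?thesis
    proof cases
      case 1
      then show ?thesis by (intro exI[of _ 1] conjI) (auto simp: good_def)
    next
      case 2
      then obtain \<delta> where "\<delta> > 0" "ball x \<delta> \<subseteq> - supp"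
        using closed_supp by (metis ComplI open_Compl open_contains_ball)
      then show ?thesis by (intro exI[of _ 1] conjI exI[of _ \<delta>]) (auto simp: good_def dist_real_def subset_iff)
    next
      case 3
      have s: "(1 - r) * mid_ge x < joint_ge m x" by (rule left_strict[OF 3(2,1) x 3(3)])
      obtain e where e: "e > 0" "\<forall>\<^sub>F q in at_left x. (1 - r + e) * mid_ge q \<le> joint_ge m q"
        using drift_at[OF joint_ge_at_left mid_ge_at_left s] by blast
      then obtain b where b: "b < x" "\<And>q. b < q \<Longrightarrow> q < x \<Longrightarrow> (1 - r + e) * mid_ge q \<le> joint_ge m q"
        unfolding eventually_at_left_field by auto
      define e' where "e' = min e (joint_ge m x - (1 - r) * mid_ge x)"
      have e': "0 < e'" "e' \<le> e" using e s by (auto simp: e'_def)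
      have "e' * mid_ge x \<le> e' * 1" using e' by (intro mult_left_mono) (auto simp: mid_ge_def)
      then have "(1 - r + e') * mid_ge x \<le> joint_ge m x" by (simp add: e'_def algebra_simps)
      then have "good e' q" if "b < q" "q \<le> x" for q
        using that b(2)[of q] drift_weaken[OF _ e'(2)] unfolding good_def by (cases "q = x") auto
      then show ?thesis using e' b(1) by (intro exI[of _ e'] conjI exI[of _ "x - b"]) auto
    next
      case 4
      then have "\<forall>y\<in>supp. y \<le> x" by (auto simp: tail_pos_iff not_less)
      then have "good r q" if "(m + x) / 2 < q" for q
        using joint_ge_eq_mid_ge[OF _ that] by (simp add: good_def)
      then show ?thesis using r 4(1) by (intro exI[of _ r] conjI exI[of _ "(x - m) / 2"]) (auto simp: field_simps)
    qed
  qed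
  have right: "\<exists>e>0. \<exists>\<delta>>0. \<forall>q. x < q \<longrightarrow> q < x + \<delta> \<longrightarrow> good e q" if x: "m \<le> x" for x
  proof -
    consider "u \<le> x" | "x \<noteq> m" "x \<notin> supp" | "x < u" "x = m" | "x < u" "m < x" "x \<in> supp"
      using x by fastforce
    then show ?thesis
    proof cases
      case 1
      then show ?thesis by (intro exI[of _ 1] conjI) (auto simp: good_def)
    next
      case 2
      then obtain \<delta> where "\<delta> > 0" "ball x \<delta> \<subseteq> - supp"
        using closed_supp by (metis ComplI open_Compl open_contains_ball)
      then show ?thesis by (intro exI[of _ 1] conjI exI[of _ \<delta>]) (auto simp: good_def dist_real_def subset_iff)
    next
      case 3
      have "joint_gt m m = (tail m)\<^sup>2"
        unfolding joint_gt_def measure_low[symmetric]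
        by (intro arg_cong[where f = "measure Z"]) (auto intro: less_le_trans[OF _ low_le_mid])
      moreover have "(1 - r) * mid_gt m \<le> (1 - r) * mid_ge m" using mid_gt_le_mid_ge r by (intro mult_left_mono) auto
      ultimately have "(1 - r) * mid_gt x < joint_gt m x" using strict 3 by simp
      from drift_at[OF joint_ge_at_right mid_ge_at_right this] obtain e where
        e: "e > 0" "\<forall>\<^sub>F q in at_right x. (1 - r + e) * mid_ge q \<le> joint_ge m q" by blast
      then obtain b where b: "x < b" "\<And>q. x < q \<Longrightarrow> q < b \<Longrightarrow> (1 - r + e) * mid_ge q \<le> joint_ge m q"
        unfolding eventually_at_right_field by auto
      then show ?thesis using e by (intro exI[of _ e] conjI exI[of _ "b - x"]) (auto simp: good_def)
    next
      case 4
      have "(1 - r) * mid_gt x \<le> (tail x)\<^sup>2"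
        by (rule rat_limit_right[OF tendsto_mult[OF tendsto_const mid_ge_at_right] tendsto_power[OF tail_at_right] 4(1)])
           (use ratio 4 in auto)
      moreover have "0 < tail x" using 4 mu tail_pos_iff by auto
      ultimately have "(1 - r) * mid_gt x < joint_gt m x"
        using 4 ratio strict by (intro upward_drift_right) auto
      from drift_at[OF joint_ge_at_right mid_ge_at_right this] obtain e where
        e: "e > 0" "\<forall>\<^sub>F q in at_right x. (1 - r + e) * mid_ge q \<le> joint_ge m q" by blast
      then obtain b where b: "x < b" "\<And>q. x < q \<Longrightarrow> q < b \<Longrightarrow> (1 - r + e) * mid_ge q \<le> joint_ge m q"
        unfolding eventually_at_right_field by auto
      then show ?thesis using e by (intro exI[of _ e] conjI exI[of _ "b - x"]) (auto simp: good_def)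
    qed
  qed
  define P where "P a c \<longleftrightarrow> (\<exists>e>0. \<forall>q. a \<le> q \<longrightarrow> q \<le> c \<longrightarrow> good e q)" for a c
  have "P m u"
  proof (rule Bolzano)
    show "m \<le> u" using mu by simp
    fix a b c assume "P a b" "P b c" "a \<le> b" "b \<le> c"
    then obtain e1 e2 where e: "e1 > 0" "e2 > 0" "\<And>q. a \<le> q \<Longrightarrow> q \<le> b \<Longrightarrow> good e1 q" "\<And>q. b \<le> q \<Longrightarrow> q \<le> c \<Longrightarrow> good e2 q"
      unfolding P_def by blast
    have "good (min e1 e2) q" if "a \<le> q" "q \<le> c" for q
      using e(3,4)[of q] that good_weaken by (cases "q \<le> b") auto
    then show "P a c" unfolding P_def using e(1,2) by (intro exI[of _ "min e1 e2"]) auto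
  next
    fix x assume x: "m \<le> x" "x \<le> u"
    obtain e1 d1 where 1: "e1 > 0" "d1 > 0" "\<And>q. x - d1 < q \<Longrightarrow> q \<le> x \<Longrightarrow> good e1 q" using left[OF x(2)] by blast
    obtain e2 d2 where 2: "e2 > 0" "d2 > 0" "\<And>q. x < q \<Longrightarrow> q < x + d2 \<Longrightarrow> good e2 q" using right[OF x(1)] by blast
    have "P a b" if "a \<le> x" "x \<le> b" "b - a < min d1 d2" for a b
    proof -
      have "good (min e1 e2) q" if q: "a \<le> q" "q \<le> b" for q
      proof (cases "q \<le> x")
        case True
        then have "good e1 q" using q \<open>x \<le> b\<close> \<open>b - a < min d1 d2\<close> by (intro 1(3)) auto
        then show ?thesis by (rule good_weaken) simp
      next
        case False
        then have "good e2 q" using q \<open>a \<le> x\<close> \<open>b - a < min d1 d2\<close> by (intro 2(3)) auto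
        then show ?thesis by (rule good_weaken) simp
      qed
      then show ?thesis unfolding P_def using 1(1) 2(1) by (intro exI[of _ "min e1 e2"]) auto
    qed
    then show "\<exists>d>0. \<forall>a b. a \<le> x \<and> x \<le> b \<and> b - a < d \<longrightarrow> P a b"
      using 1(2) 2(2) by (intro exI[of _ "min d1 d2"]) auto
  qed
  then obtain e where "e > 0" "\<And>q. m \<le> q \<Longrightarrow> q \<le> u \<Longrightarrow> good e q" unfolding P_def by blast
  then show "\<exists>e>0. \<forall>q\<in>supp. m < q \<and> q \<le> u \<longrightarrow> (1 - r + e) * mid_ge q \<le> joint_ge m q"
    unfolding good_def by (intro exI[of _ e]) auto
qed

text \<open>
The quantile may approach its upper limit \<open>u\<close> from above, so the drift is also needed a little beyond
\<open>u\<close>. If midpoints equal to \<open>u\<close> have positive probability, the drift may differ on the two sides of \<open>u\<close>. It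
is then positive on the right if \<open>rho\<close> is nonnegative at \<open>u\<close>.
\<close>

lemma uniform_drift_beyond:
  assumes mu: "m < u" "u \<in> supp" "0 < tail u"
    and ratio: "\<And>s. s \<in> \<rat> \<Longrightarrow> m < s \<Longrightarrow> s < u \<Longrightarrow> (1 - r) * mid_ge s \<le> (tail s)\<^sup>2"
    and strict: "(1 - r) * mid_ge m < (tail m)\<^sup>2"
    and u: "measure Z {z. mid z = u} = 0 \<or> (1 - r) * mid_ge u \<le> (tail u)\<^sup>2"
  shows "\<exists>e>0. \<exists>w>u. w \<in> \<rat> \<and> (\<forall>q\<in>supp. m < q \<and> q \<le> w \<longrightarrow> (1 - r + e) * mid_ge q \<le> joint_ge m q)"
proof -
  note ud = uniform_drift[OF mu(1,2) ratio strict]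
  obtain e1 where e1: "e1 > 0" "\<forall>q\<in>supp. m < q \<and> q \<le> u \<longrightarrow> (1 - r + e1) * mid_ge q \<le> joint_ge m q"
    using ud(1) by blast
  have "(1 - r) * mid_gt u < joint_gt m u"
    using u
  proof
    assume 0: "measure Z {z. mid z = u} = 0"
    have ev: "{z. mid z = u} \<in> sets Z"
    proof -
      have "{z \<in> space Z. mid z = u} \<in> sets Z" by measurable
      then show ?thesis by simp
    qed
    have "AE z in Z. mid z \<noteq> u"
      using 0 ev by (simp add: Z.P.prob_eq_0)
    then have "joint_ge m u = joint_gt m u" unfolding joint_ge_def joint_gt_def
      by (intro Z.P.finite_measure_eq_AE joint_ge_events) (auto elim!: eventually_mono)
    moreover have "(1 - r) * mid_gt u \<le> (1 - r) * mid_ge u" using mid_gt_le_mid_ge r by (intro mult_left_mono) auto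
    ultimately show ?thesis using ud(2)[OF _ _ _ mu(3)] by simp
  next
    assume "(1 - r) * mid_ge u \<le> (tail u)\<^sup>2"
    moreover have "(1 - r) * mid_gt u \<le> (1 - r) * mid_ge u" using mid_gt_le_mid_ge r by (intro mult_left_mono) auto
    ultimately show ?thesis using mu ratio strict by (intro upward_drift_right) auto
  qed
  from drift_at[OF joint_ge_at_right mid_ge_at_right this] obtain e2 where
    e2: "e2 > 0" "\<forall>\<^sub>F q in at_right u. (1 - r + e2) * mid_ge q \<le> joint_ge m q" by blast
  then obtain b where b: "u < b" "\<And>q. u < q \<Longrightarrow> q < b \<Longrightarrow> (1 - r + e2) * mid_ge q \<le> joint_ge m q"
    unfolding eventually_at_right_field by auto
  obtain w where w: "w \<in> \<rat>" "u < w" "w < b" using Rats_dense_in_real[OF b(1)] by blast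
  have "(1 - r + min e1 e2) * mid_ge q \<le> joint_ge m q" if q: "q \<in> supp" "m < q" "q \<le> w" for q
  proof (cases "q \<le> u")
    case True
    then show ?thesis using e1(2) q by (intro drift_weaken[where e = e1 and e' = "min e1 e2"]) auto
  next
    case False
    then show ?thesis using b(2) q w by (intro drift_weaken[where e = e2 and e' = "min e1 e2"]) auto
  qed
  then show ?thesis using e1(1) e2(1) w by (intro exI[of _ "min e1 e2"] conjI exI[of _ w]) auto
qed

end

section \<open>Unbounded opinions\<close>

context nonneg_opinions
begin

text \<open>
The tail is at most \<open>(1 / 2) ^ n\<close> at this point, and its limit from the left is at least \<open>(1 / 2) ^ n\<close>.
Both bounds also hold in the presence of atoms and gaps.
\<close>

definition halving_point :: "nat \<Rightarrow> real" where
  "halving_point n = Inf {m. 0 \<le> m \<and> tail m \<le> (1 / 2) ^ n}"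

lemma tail_tendsto_0: "(\<lambda>n. tail (real n)) \<longlonglongrightarrow> 0"
proof -
  have "(\<lambda>n. measure \<mu> {real n<..}) \<longlonglongrightarrow> measure \<mu> (\<Inter>n. {real n<..})"
    by (intro D.finite_Lim_measure_decseq) (auto simp: decseq_def)
  moreover have "(\<Inter>n. {real n<..}) = {}"
  proof (rule equals0I)
    fix x assume x: "x \<in> (\<Inter>n. {real n<..})"
    obtain n where "x \<le> real n" using real_arch_simple by blast
    moreover have "real n < x" using x by blast
    ultimately show False by simp
  qed
  ultimately show ?thesis by (simp add: tail_def)
qed

lemma halving_point_props:
  shows halving_point_nonneg: "0 \<le> halving_point n"
    and halving_point_upper: "tail (halving_point n) \<le> (1 / 2) ^ n"
    and halving_point_lower: "(1 / 2) ^ n \<le> measure \<mu> {halving_point n..}"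
    and halving_point_mono: "n \<le> n' \<Longrightarrow> halving_point n \<le> halving_point n'"
    and halving_point_ge: "(1 / 2) ^ n < tail m \<Longrightarrow> m \<le> halving_point n"
proof -
  define A where "A n = {m. 0 \<le> m \<and> tail m \<le> (1 / 2) ^ n}" for n
  have lev: "halving_point n = Inf (A n)" for n by (simp add: halving_point_def A_def)
  have ne: "A n \<noteq> {}" for n
  proof -
    have "\<forall>\<^sub>F k in sequentially. tail (real k) < (1 / 2) ^ n"
      by (intro order_tendstoD(2)[OF tail_tendsto_0]) simp
    then obtain k where "tail (real k) < (1 / 2) ^ n" by (auto simp: eventually_sequentially)
    then have "real k \<in> A n" by (simp add: A_def)
    then show ?thesis by blast
  qed
  have bdd: "bdd_below (A n)" for n by (auto simp: A_def)
  show nn: "0 \<le> halving_point n" unfolding lev using ne by (intro cInf_greatest) (auto simp: A_def)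
  have above: "tail m \<le> (1 / 2) ^ n" if "halving_point n < m" for m
  proof -
    have "\<exists>a\<in>A n. a < m" using that cInf_less_iff[OF ne bdd, of n m] by (simp add: lev)
    then obtain a where "a \<in> A n" "a < m" ..
    then show ?thesis using tail_antimono[of a m] by (simp add: A_def)
  qed
  have below: "(1 / 2) ^ n < tail m" if "0 \<le> m" "m < halving_point n" for m
  proof (rule ccontr)
    assume "\<not> ?thesis"
    then have "m \<in> A n" using that by (simp add: A_def)
    then show False using cInf_lower[OF _ bdd, of m n] that unfolding lev by simp
  qed
  show "tail (halving_point n) \<le> (1 / 2) ^ n"
    by (rule rat_limit_right[OF tail_at_right tendsto_const, of "halving_point n" "halving_point n + 1"]) (use above in auto)
  show "(1 / 2) ^ n \<le> measure \<mu> {halving_point n..}"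
  proof (cases "halving_point n = 0")
    case True
    then show ?thesis using nonneg by (simp add: power_le_one)
  next
    case False
    then have "0 < halving_point n" using nn by simp
    then show ?thesis
      unfolding tail_ge_def[symmetric]
      by (intro rat_limit_left[OF tendsto_const tail_at_left, of 0]) (use below in \<open>auto intro: less_imp_le\<close>)
  qed
  show "halving_point n \<le> halving_point n'" if "n \<le> n'"
  proof -
    have pd: "(1 / 2 :: real) ^ n' \<le> (1 / 2) ^ n" using that by (intro power_decreasing) auto
    have "A n' \<subseteq> A n" by (rule subsetI) (simp add: A_def order_trans[OF _ pd])
    then show ?thesis unfolding lev by (intro cInf_superset_mono ne bdd)
  qed
  show "m \<le> halving_point n" if "(1 / 2) ^ n < tail m"
    using above[of m] that by linarith
qed

text \<open>
For \<open>l = 1 / N\<^sup>2\<close> the function \<open>- exp (- l * n)\<close> is concave in \<open>n\<close>, but up to distance \<open>N\<close> its second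
differences are smaller in absolute value than twice its increase over one step.
\<close>

lemma concave_weights:
  assumes "N \<ge> 1" "j \<le> N" and l: "l = 1 / (real N)\<^sup>2"
  shows "exp (- (l * real j)) + exp (l * real j) \<le> 2 * exp l"
proof -
  have l0: "0 < l" "l \<le> 1" using assms by (auto simp: divide_le_eq one_le_power)
  have "l * real j \<le> l * real N" using assms l0 by (intro mult_left_mono) auto
  also have lN: "l * real N = 1 / real N" using assms by (simp add: power2_eq_square)
  also have "\<dots> \<le> 1" using assms by simp
  finally have x: "\<bar>l * real j\<bar> \<le> 1" using l0 by simp
  have "(l * real j)\<^sup>2 \<le> (l * real N)\<^sup>2" using assms l0 by (intro power_mono mult_left_mono) auto
  also have "\<dots> = (1 / real N)\<^sup>2" by (simp only: lN)
  also have "\<dots> = l" by (simp add: l power_divide)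
  finally have sq: "(l * real j)\<^sup>2 \<le> l" .
  have "exp (- (l * real j)) + exp (l * real j) \<le> (1 + - (l * real j) + (- (l * real j))\<^sup>2) + (1 + l * real j + (l * real j)\<^sup>2)"
    using x by (intro add_mono exp_le_quadratic) auto
  also have "\<dots> = 2 + 2 * (l * real j)\<^sup>2" by simp
  also have "\<dots> \<le> 2 * (1 + l)" using sq by simp
  also have "\<dots> \<le> 2 * exp l" by (intro mult_left_mono exp_ge_add_one_self) simp
  finally show ?thesis .
qed

text \<open>
An unbounded sequence cannot be strictly concave on the scale \<open>N\<close> forever. Touch it from below with a
bounded concave function: for large \<open>a\<close> the minimum of \<open>halving_point n + a * exp (- l * n)\<close> is attained far out,
and near a minimum the sequence is at least as convex as \<open>- a * exp (- l * n)\<close>.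
\<close>

lemma nearly_midpoint_convex_halving_points:
  assumes unb: "\<And>m. 0 < tail m" and N: "1 \<le> N"
  shows "\<exists>s>N. M \<le> halving_point (s - 1) \<and> (\<forall>j\<le>N. 2 * halving_point (s - 1) \<le> halving_point (s + j) + halving_point (s - j))"
proof -
  have unbounded: "\<exists>n. B \<le> halving_point n" for B
  proof -
    have "(\<lambda>n. (1 / 2 :: real) ^ n) \<longlonglongrightarrow> 0" by (intro LIMSEQ_power_zero) simp
    then have "\<forall>\<^sub>F n in sequentially. (1 / 2) ^ n < tail B"
      using unb by (intro order_tendstoD(2)) auto
    then show ?thesis using halving_point_ge by (auto simp: eventually_sequentially)
  qed
  define l where "l = 1 / (real N)\<^sup>2"
  have l: "0 < l" using N by (simp add: l_def)
  obtain n1 where n1: "M \<le> halving_point n1" using unbounded by blast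
  define n0 where "n0 = max n1 (Suc N)"
  have n0: "M \<le> halving_point n0" "N < n0" using n1 halving_point_mono[of n1 n0] by (auto simp: n0_def)
  \<comment> \<open>the weight \<open>a\<close> is chosen so large that the minimum of \<open>\<Psi>\<close> lies beyond \<open>n0\<close>\<close>
  define \<delta> where "\<delta> = exp (- l * real n0) - exp (- l * real (Suc n0))"
  have \<delta>: "0 < \<delta>" using l by (simp add: \<delta>_def)
  define a where "a = (halving_point (Suc n0) + 1) / \<delta>"
  have a: "0 < a" "halving_point (Suc n0) < a * \<delta>"
    using \<delta> halving_point_nonneg[of "Suc n0"] by (auto simp: a_def)
  define \<Psi> where "\<Psi> n = halving_point n + a * exp (- l * real n)" for n
  obtain n2 where n2: "\<Psi> 0 \<le> halving_point n2" using unbounded by blast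
  obtain n where n: "\<And>k. k \<le> n2 \<Longrightarrow> \<Psi> n \<le> \<Psi> k" "n \<le> n2"
    using ex_min_if_finite[of "\<Psi> ` {..n2}"] by (auto simp: not_less image_iff Bex_def)
  have min: "\<Psi> n \<le> \<Psi> k" for k
  proof (cases "k \<le> n2")
    case False
    have "\<Psi> n \<le> \<Psi> 0" by (rule n) simp
    also have "\<dots> \<le> halving_point k" using n2 halving_point_mono[of n2 k] False by simp
    also have "\<dots> \<le> \<Psi> k" using a by (simp add: \<Psi>_def)
    finally show ?thesis .
  qed (rule n)
  have "n0 < n"
  proof (rule ccontr)
    assume "\<not> n0 < n"
    then have "exp (- l * real n0) \<le> exp (- l * real n)" using l by simp
    then have "a * exp (- l * real n0) \<le> \<Psi> n" using a halving_point_nonneg[of n] by (simp add: \<Psi>_def add_increasing)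
    also have "\<dots> \<le> \<Psi> (Suc n0)" by (rule min)
    finally show False using a(2) by (simp add: \<Psi>_def \<delta>_def right_diff_distrib)
  qed
  show ?thesis
  proof (intro exI[of _ "Suc n"] conjI allI impI)
    show "N < Suc n" using n0 \<open>n0 < n\<close> by simp
    show "M \<le> halving_point (Suc n - 1)" using n0(1) halving_point_mono[of n0 n] \<open>n0 < n\<close> by simp
    fix j assume j: "j \<le> N"
    have r: "real (Suc n - j) = real n + 1 - real j" using j n0 \<open>n0 < n\<close> by simp
    have "2 * \<Psi> n \<le> \<Psi> (Suc n + j) + \<Psi> (Suc n - j)" using min[of "Suc n + j"] min[of "Suc n - j"] by simp
    also have "\<dots> = halving_point (Suc n + j) + halving_point (Suc n - j) + a * exp (- l * (real n + 1)) * (exp (- (l * real j)) + exp (l * real j))"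
      unfolding \<Psi>_def r by (simp add: algebra_simps exp_add[symmetric])
    also have "\<dots> \<le> halving_point (Suc n + j) + halving_point (Suc n - j) + a * exp (- l * (real n + 1)) * (2 * exp l)"
      using a concave_weights[OF N j l_def] by (intro add_left_mono mult_left_mono) auto
    also have "a * exp (- l * (real n + 1)) * (2 * exp l) = 2 * (a * exp (- l * real n))"
      by (simp add: algebra_simps exp_add[symmetric])
    finally show "2 * halving_point (Suc n - 1) \<le> halving_point (Suc n + j) + halving_point (Suc n - j)"
      by (simp add: \<Psi>_def)
  qed
qed

text \<open>
The rectangles with corners \<open>(H j, H' j)\<close> form a staircase inside the half-plane of pairs with midpoint at least
\<open>m\<close>. Each of its \<open>N + 1\<close> steps adds mass of order \<open>c\<^sup>2\<close>. Only lower bounds for the tails are known, so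
the sum over the disjoint pieces is estimated by summation by parts.
\<close>

lemma staircase_measure:
  assumes mono: "\<And>j. H j \<le> H (Suc j)" and mid: "\<And>j. j \<le> N \<Longrightarrow> 2 * m \<le> H j + H' j"
    and lower: "\<And>j. j \<le> N \<Longrightarrow> c / 2 ^ j \<le> measure \<mu> {H j..}" "\<And>j. j \<le> N \<Longrightarrow> c * 2 ^ j \<le> measure \<mu> {H' j..}"
    and c: "0 \<le> c"
  shows "c\<^sup>2 * (1 + real N / 2) \<le> mid_ge m"
proof -
  define E where "E j = (if j < N then {H j..<H (Suc j)} else {H N..}) \<times> {H' j..}" for j
  have mono': "i \<le> j \<Longrightarrow> H i \<le> H j" for i j by (rule lift_Suc_mono_le[of H]) (rule mono)
  have Es: "E j \<in> sets Z" for j unfolding E_def by (rule rect_event) auto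
  have disj: "disjoint_family_on E {..N}"
    unfolding disjoint_family_on_def
  proof (intro ballI impI)
    have "E i \<inter> E j = {}" if "i < j" "j \<le> N" for i j
    proof -
      have "H (Suc i) \<le> H j" using that by (intro mono') simp
      then show ?thesis using that mono'[of j N] unfolding E_def by auto
    qed
    then show "E i \<inter> E j = {}" if "i \<in> {..N}" "j \<in> {..N}" "i \<noteq> j" for i j
      using that by (metis atMost_iff inf_commute linorder_neqE_nat)
  qed
  define x where "x j = measure \<mu> {H j..}" for j
  define y where "y j = measure \<mu> {H' j..}" for j
  have x: "measure \<mu> {H j..<H (Suc j)} = x j - x (Suc j)" "x (Suc j) \<le> x j" for j
  proof -
    have "{H j..<H (Suc j)} = {H j..} - {H (Suc j)..}" by auto
    then show "measure \<mu> {H j..<H (Suc j)} = x j - x (Suc j)"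
      unfolding x_def using mono[of j] by (simp add: D.finite_measure_Diff)
    show "x (Suc j) \<le> x j" unfolding x_def using mono[of j] by (intro D.finite_measure_mono) auto
  qed
  have main: "c\<^sup>2 * (1 + real k / 2) \<le> (\<Sum>j<k. (x j - x (Suc j)) * y j) + x k * (c * 2 ^ k)" if "k \<le> N" for k
    using that
  proof (induction k)
    case 0
    have "c * c \<le> x 0 * c" using lower(1)[of 0] c by (intro mult_right_mono) (auto simp: x_def)
    then show ?case by (simp add: power2_eq_square)
  next
    case (Suc k)
    have 1: "(x k - x (Suc k)) * (c * 2 ^ k) \<le> (x k - x (Suc k)) * y k"
      using lower(2)[of k] Suc.prems x(2)[of k] by (intro mult_left_mono) (auto simp: y_def)
    have "c / 2 ^ Suc k * (c * 2 ^ k) \<le> x (Suc k) * (c * 2 ^ k)"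
      using lower(1)[of "Suc k"] Suc.prems c by (intro mult_right_mono) (auto simp: x_def)
    then have 2: "c\<^sup>2 / 2 \<le> x (Suc k) * (c * 2 ^ k)" by (simp add: power2_eq_square)
    define A P Q where "A = (\<Sum>j<k. (x j - x (Suc j)) * y j)" and "P = x k * (c * 2 ^ k)" and "Q = x (Suc k) * (c * 2 ^ k)"
    have "c\<^sup>2 * (1 + real k / 2) \<le> A + P" using Suc by (simp add: A_def P_def)
    moreover have "(x k - x (Suc k)) * (c * 2 ^ k) = P - Q" by (simp add: P_def Q_def algebra_simps)
    ultimately have "c\<^sup>2 * (1 + real k / 2) + c\<^sup>2 / 2 \<le> A + (x k - x (Suc k)) * y k + 2 * Q"
      using 1 2 unfolding Q_def[symmetric] by linarith
    moreover have "c\<^sup>2 * (1 + real (Suc k) / 2) = c\<^sup>2 * (1 + real k / 2) + c\<^sup>2 / 2"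
      by (simp add: algebra_simps add_divide_distrib)
    moreover have "x (Suc k) * (c * 2 ^ Suc k) = 2 * Q" by (simp add: Q_def)
    ultimately show ?case by (simp add: A_def)
  qed
  have "x N * (c * 2 ^ N) \<le> x N * y N"
    using lower(2)[of N] by (intro mult_left_mono) (auto simp: x_def y_def)
  with main[of N] have "c\<^sup>2 * (1 + real N / 2) \<le> (\<Sum>j<N. (x j - x (Suc j)) * y j) + x N * y N" by simp
  also have "\<dots> = (\<Sum>j<N. measure Z (E j)) + measure Z (E N)"
    by (simp add: E_def measure_rect x x_def[symmetric] y_def[symmetric])
  also have "\<dots> = (\<Sum>j\<in>{..N}. measure Z (E j))"
    by (simp add: lessThan_Suc_atMost[symmetric])
  also have "\<dots> = measure Z (\<Union>j\<in>{..N}. E j)"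
    using Es disj by (intro Z.P.finite_measure_finite_Union[symmetric]) auto
  also have "\<dots> \<le> mid_ge m" unfolding mid_ge_def
  proof (intro Z.P.finite_measure_mono mid_low_events subsetI)
    fix z assume "z \<in> (\<Union>j\<in>{..N}. E j)"
    then obtain j where j: "j \<le> N" "z \<in> E j" by auto
    have "H j \<le> fst z" "H' j \<le> snd z" using j by (auto simp: E_def split: if_splits)
    then show "z \<in> {z. m \<le> mid z}" using mid[OF j(1)] by (simp add: mid_def)
  qed
  finally show ?thesis .
qed

text \<open>
Both candidates exceeding \<open>m\<close> is only one of about \<open>N\<close> comparably likely ways to have a midpoint of at
least \<open>m\<close>: one candidate may be higher by \<open>j\<close> halvings of the tail if the other one is lower by
\<open>j\<close> halvings.
\<close>

lemma ratio_small_at_infinity: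
  assumes unb: "\<And>m. 0 < tail m" and e: "0 < e"
  shows "\<exists>m\<ge>M. (tail m)\<^sup>2 \<le> e * mid_ge m"
proof -
  obtain N :: nat where "8 / e + 1 \<le> real N" using real_arch_simple by blast
  moreover have "0 < 8 / e" using e by simp
  ultimately have "8 / e \<le> real N" "1 \<le> real N" by linarith+
  then have N: "8 / e \<le> real N" "1 \<le> N" by simp_all
  obtain s where s: "s > N" "M \<le> halving_point (s - 1)" "\<And>j. j \<le> N \<Longrightarrow> 2 * halving_point (s - 1) \<le> halving_point (s + j) + halving_point (s - j)"
    using nearly_midpoint_convex_halving_points[OF unb N(2)] by blast
  define c where "c = (1 / 2 :: real) ^ s"
  have c: "0 < c" by (simp add: c_def)
  have "c\<^sup>2 * (1 + real N / 2) \<le> mid_ge (halving_point (s - 1))"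
  proof (rule staircase_measure[where H = "\<lambda>j. halving_point (s + j)" and H' = "\<lambda>j. halving_point (s - j)"])
    show "c / 2 ^ j \<le> measure \<mu> {halving_point (s + j)..}" for j
      using halving_point_lower[of "s + j"] by (simp add: c_def power_add power_divide)
    show "c * 2 ^ j \<le> measure \<mu> {halving_point (s - j)..}" if "j \<le> N" for j
    proof -
      have "c * 2 ^ j = (1 / 2) ^ (s - j)"
        using that s(1) by (simp add: c_def power_diff power_divide)
      then show ?thesis using halving_point_lower[of "s - j"] by simp
    qed
  qed (use s halving_point_mono c in auto)
  moreover have "(tail (halving_point (s - 1)))\<^sup>2 \<le> 4 * c\<^sup>2"
  proof -
    have "(1 / 2 :: real) ^ (s - 1) = 2 * c" using s(1) by (cases s) (simp_all add: c_def)
    then have "tail (halving_point (s - 1)) \<le> 2 * c" using halving_point_upper[of "s - 1"] by simp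
    then have "(tail (halving_point (s - 1)))\<^sup>2 \<le> (2 * c)\<^sup>2" by (intro power_mono tail_nonneg)
    then show ?thesis by (simp add: power_mult_distrib)
  qed
  moreover have "4 * c\<^sup>2 \<le> e * (c\<^sup>2 * (1 + real N / 2))"
  proof -
    have "8 \<le> e * real N" using N(1) e by (simp add: field_simps)
    then have "4 \<le> e * (1 + real N / 2)" using e by (simp add: algebra_simps)
    then have "c\<^sup>2 * 4 \<le> c\<^sup>2 * (e * (1 + real N / 2))" by (intro mult_left_mono) auto
    then show ?thesis by (simp add: algebra_simps)
  qed
  ultimately have "(tail (halving_point (s - 1)))\<^sup>2 \<le> e * mid_ge (halving_point (s - 1))"
    using mult_left_mono[of "c\<^sup>2 * (1 + real N / 2)" "mid_ge (halving_point (s - 1))" e] e by linarith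
  then show ?thesis using s(2) by blast
qed

end

section \<open>Convergence of the quantile\<close>

context nonneg_opinions
begin

text \<open>
Almost sure statements can be used simultaneously only for countably many levels. Rational levels suffice
except where \<open>rho\<close> jumps, which requires an atom of the law of the midpoint.
\<close>

definition "levels = \<rat> \<union> {s. measure Z {z. mid z = s} \<noteq> 0}"

lemma mid_eq_event: "{z. mid z = s} \<in> sets Z"
proof -
  have "{z \<in> space Z. mid z = s} \<in> sets Z" by measurable
  then show ?thesis by simp
qed

lemma countable_levels: "countable levels"
proof -
  interpret M: prob_space "distr Z borel mid" by (rule Z.P.prob_space_distr) (rule mid_Z)
  have "measure (distr Z borel mid) {s} = measure Z {z. mid z = s}" for s
    by (subst measure_distr[OF mid_Z]) (auto intro!: arg_cong[where f = "measure Z"])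
  then have "countable {s. measure Z {z. mid z = s} \<noteq> 0}"
    using M.countable_support by simp
  then show ?thesis by (auto simp: levels_def countable_rat)
qed

lemma mid_ge_minus_mid_gt: "mid_ge s - mid_gt s = measure Z {z. mid z = s}"
proof -
  have eq: "{z. mid z = s} = {z. s \<le> mid z} - {z. s < mid z}" by auto
  show ?thesis
    unfolding mid_ge_def mid_gt_def eq
    by (rule Z.P.finite_measure_Diff[symmetric]) (auto intro: mid_low_events)
qed

lemma atom_in_levels: "measure \<mu> {s} \<noteq> 0 \<Longrightarrow> measure Z {z. mid z = s} \<noteq> 0"
proof -
  assume "measure \<mu> {s} \<noteq> 0"
  then have "0 < measure \<mu> {s} * measure \<mu> {s}" by (simp add: zero_less_measure_iff)
  also have "\<dots> = measure Z ({s} \<times> {s})" by (rule measure_rect[symmetric]) auto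
  also have "\<dots> \<le> measure Z {z. mid z = s}"
    by (intro Z.P.finite_measure_mono mid_eq_event) (auto simp: mid_def)
  finally show ?thesis by simp
qed

lemma supp_nonneg: "supp \<subseteq> {0..}"
proof
  fix x assume x: "x \<in> supp"
  show "x \<in> {0..}"
  proof (rule ccontr)
    assume "x \<notin> {0..}"
    then have "0 < measure \<mu> {x - 1<..<0}" using x by (intro supp_interval_pos) auto
    also have "\<dots> \<le> measure \<mu> (space \<mu> - {0..})" by (intro D.finite_measure_mono) auto
    also have "\<dots> = 0" using nonneg D.prob_compl[of "{0..}"] by simp
    finally show False by simp
  qed
qed

lemma measure_off_supp: "A \<inter> supp = {} \<Longrightarrow> A \<in> sets borel \<Longrightarrow> measure \<mu> A = 0"
  using AE_supp by (subst D.prob_eq_0) (auto elim!: eventually_mono)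

text \<open>
The three properties of the quantile sequence that hold almost surely and from which its convergence
follows deterministically. They concern levels with \<open>rho < 0\<close>, levels from which there is an upward drift up
to \<open>w\<close>, and intervals on which \<open>rho \<le> 0\<close>.
\<close>

definition "respects_sinks x \<longleftrightarrow> (\<forall>m\<in>levels. (tail m)\<^sup>2 < (1 - r) * mid_ge m \<longrightarrow>
    (\<exists>\<^sub>F t in sequentially. x t \<le> m) \<longrightarrow> (\<forall>\<^sub>F t in sequentially. x t \<le> m))"

definition "respects_sources x \<longleftrightarrow> (\<forall>m\<in>levels. \<forall>w\<in>levels. \<forall>n::nat.
    (\<forall>y\<in>supp. m < y \<and> y \<le> w \<longrightarrow> (1 - r + 1 / real (Suc n)) * mid_ge y \<le> joint_ge m y) \<longrightarrow>
    (\<forall>\<^sub>F t in sequentially. x t \<in> supp \<inter> {..w}) \<longrightarrow> (\<exists>\<^sub>F t in sequentially. m < x t) \<longrightarrow>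
    (\<forall>\<^sub>F t in sequentially. m < x t))"

definition "neutral m m' \<longleftrightarrow> m < m' \<and> (\<forall>s. m \<le> s \<and> s \<le> m' \<longrightarrow> measure \<mu> {s} = 0) \<and>
    tail m' < tail m \<and> (\<forall>s. m < s \<and> s \<le> m' \<longrightarrow> (tail s)\<^sup>2 \<le> (1 - r) * mid_ge s)"

definition "respects_neutral x \<longleftrightarrow> (\<forall>m\<in>\<rat>. \<forall>m'\<in>\<rat>. neutral m m' \<longrightarrow>
    (\<exists>\<^sub>F t in sequentially. x t \<le> m) \<longrightarrow> (\<forall>\<^sub>F t in sequentially. x t \<le> m'))"

lemma respects_sourcesD:
  assumes "respects_sources x" "m \<in> levels" "w \<in> levels" "0 < e"
    "\<forall>y\<in>supp. m < y \<and> y \<le> w \<longrightarrow> (1 - r + e) * mid_ge y \<le> joint_ge m y"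
    "\<forall>\<^sub>F t in sequentially. x t \<in> supp \<inter> {..w}" "\<exists>\<^sub>F t in sequentially. m < x t"
  shows "\<forall>\<^sub>F t in sequentially. m < x t"
proof -
  obtain n where "1 / real (Suc n) < e" using assms(4) nat_approx_posE by blast
  then have "\<forall>y\<in>supp. m < y \<and> y \<le> w \<longrightarrow> (1 - r + 1 / real (Suc n)) * mid_ge y \<le> joint_ge m y"
    using assms(5) by (auto intro: drift_weaken[where e = e])
  with assms show ?thesis unfolding respects_sources_def by blast
qed

text \<open>
If \<open>rho\<close> vanishes at the \<open>levels\<close> between the lower limit \<open>l\<close> and the upper limit \<open>u\<close>, it is
nonpositive everywhere between them, and there is no atom there, since at an atom \<open>rho\<close> would be
smaller than its limit from the right. The support must have a point between \<open>l\<close> and \<open>u\<close>, because across a gap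
\<open>mid_ge\<close> would decrease while \<open>tail\<close> does not.
\<close>

lemma quantile_convergent:
  fixes q :: "nat \<Rightarrow> real"
  assumes qs: "\<And>t. 1 \<le> t \<Longrightarrow> q t \<in> supp" and bdd: "\<forall>\<^sub>F t in sequentially. q t \<le> B"
    and sinks: "respects_sinks q" and sources: "respects_sources q" and neutral: "respects_neutral q"
  shows "convergent q"
proof -
  have below: "\<forall>\<^sub>F t in sequentially. q t \<le> m"
    if "m \<in> levels" "(tail m)\<^sup>2 < (1 - r) * mid_ge m" "\<exists>\<^sub>F t in sequentially. q t \<le> m" for m
    using sinks that unfolding respects_sinks_def by blast
  have evs: "\<forall>\<^sub>F t in sequentially. q t \<in> supp"
    using eventually_ge_at_top[of 1] by eventually_elim (rule qs)
  have ev0: "\<forall>\<^sub>F t in sequentially. 0 \<le> q t"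
    using evs by eventually_elim (use supp_nonneg in auto)
  define U where "U = {x. \<forall>\<^sub>F t in sequentially. q t \<le> x}"
  define L where "L = {x. \<forall>\<^sub>F t in sequentially. x \<le> q t}"
  define u where "u = Inf U"
  define l where "l = Sup L"
  have LU: "x \<le> y" if "x \<in> L" "y \<in> U" for x y
  proof -
    have "\<forall>\<^sub>F t in sequentially. x \<le> q t \<and> q t \<le> y" using that by (auto simp: L_def U_def eventually_conj_iff)
    then have "\<forall>\<^sub>F t in sequentially. x \<le> y" by eventually_elim auto
    then show ?thesis by simp
  qed
  have "B \<in> U" "0 \<in> L" using bdd ev0 by (simp_all add: U_def L_def)
  then have U: "B \<in> U" "bdd_below U" and L: "0 \<in> L" "bdd_above L"
    using LU bdd_belowI[of U 0] bdd_aboveI[of L B] by auto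
  have u1: "\<forall>\<^sub>F t in sequentially. q t < x" if x: "u < x" for x
  proof -
    have "\<exists>y\<in>U. y < x" using x cInf_less_iff[of U x] U by (auto simp: u_def)
    then obtain y where y: "y \<in> U" "y < x" ..
    then have "\<forall>\<^sub>F t in sequentially. q t \<le> y" by (simp add: U_def)
    then show ?thesis by eventually_elim (use y in simp)
  qed
  have u2: "\<exists>\<^sub>F t in sequentially. x < q t" if x: "x < u" for x
  proof -
    have "x \<notin> U" using cInf_lower[OF _ U(2), of x] x by (auto simp: u_def)
    then show ?thesis by (simp add: U_def not_eventually not_le)
  qed
  have l1: "\<forall>\<^sub>F t in sequentially. x < q t" if x: "x < l" for x
  proof -
    have "\<exists>y\<in>L. x < y" using x less_cSup_iff[of L x] L by (auto simp: l_def)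
    then obtain y where y: "y \<in> L" "x < y" ..
    then have "\<forall>\<^sub>F t in sequentially. y \<le> q t" by (simp add: L_def)
    then show ?thesis by eventually_elim (use y in simp)
  qed
  have l2: "\<exists>\<^sub>F t in sequentially. q t < x" if x: "l < x" for x
  proof -
    have "x \<notin> L" using cSup_upper[OF _ L(2), of x] x by (auto simp: l_def)
    then show ?thesis by (simp add: L_def not_eventually not_le)
  qed
  have l2': "\<exists>\<^sub>F t in sequentially. q t \<le> x" if "l < x" for x
    using l2[OF that] by (rule frequently_elim1) simp
  show ?thesis
  proof (cases "l < u")
    case False
    have "q \<longlonglongrightarrow> u"
    proof (rule order_tendstoI)
      show "\<forall>\<^sub>F t in sequentially. a < q t" if "a < u" for a using False that by (intro l1) simp
    qed (rule u1)
    then show ?thesis by (rule convergentI)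
  next
    case lu: True
    have in_supp: "x \<in> supp" if "\<And>e. e > 0 \<Longrightarrow> \<exists>\<^sub>F t in sequentially. \<bar>q t - x\<bar> < e" for x
    proof (rule ccontr)
      assume "x \<notin> supp"
      then obtain d where d: "d > 0" "ball x d \<subseteq> - supp"
        using closed_supp by (metis ComplI open_Compl open_contains_ball)
      have "\<exists>\<^sub>F t in sequentially. \<bar>q t - x\<bar> < d \<and> q t \<in> supp"
        by (rule frequently_eventually_frequently[OF that[OF d(1)] evs])
      then obtain t where "\<bar>q t - x\<bar> < d" "q t \<in> supp" by (auto dest: frequently_ex)
      then show False using d by (auto simp: dist_real_def subset_iff abs_minus_commute)
    qed
    have us: "u \<in> supp"
    proof (rule in_supp)
      fix e :: real assume "e > 0"
      have "\<exists>\<^sub>F t in sequentially. u - e < q t \<and> q t < u + e"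
        using frequently_eventually_frequently[OF u2[of "u - e"] u1[of "u + e"]] \<open>e > 0\<close> by simp
      then show "\<exists>\<^sub>F t in sequentially. \<bar>q t - u\<bar> < e" by (rule frequently_elim1) auto
    qed
    have ls: "l \<in> supp"
    proof (rule in_supp)
      fix e :: real assume "e > 0"
      have "\<exists>\<^sub>F t in sequentially. q t < l + e \<and> l - e < q t"
        using frequently_eventually_frequently[OF l2[of "l + e"] l1[of "l - e"]] \<open>e > 0\<close> by simp
      then show "\<exists>\<^sub>F t in sequentially. \<bar>q t - l\<bar> < e" by (rule frequently_elim1) auto
    qed
    have not_ev_le: "\<not> (\<forall>\<^sub>F t in sequentially. q t \<le> x)" if "x < u" for x
      using u2[OF that] by (simp add: not_eventually not_le)
    have ge: "(1 - r) * mid_ge m \<le> (tail m)\<^sup>2" if "m \<in> levels" "l < m" "m < u" for m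
      using below[OF that(1) _ l2'[OF that(2)]] not_ev_le[OF that(3)] by linarith
    have rat: "s \<in> levels" if "s \<in> \<rat>" for s using that by (simp add: levels_def)
    have False
    proof (cases "\<exists>m\<in>levels. l < m \<and> m < u \<and> (1 - r) * mid_ge m < (tail m)\<^sup>2")
      case True
      then obtain m where m: "m \<in> levels" "l < m" "m < u" "(1 - r) * mid_ge m < (tail m)\<^sup>2" by blast
      have ratio: "(1 - r) * mid_ge s \<le> (tail s)\<^sup>2" if "s \<in> \<rat>" "m < s" "s < u" for s
        using that m by (intro ge rat) auto
      note ud = uniform_drift[OF m(3) us ratio m(4)]
      obtain e1 where e1: "e1 > 0" "\<forall>q\<in>supp. m < q \<and> q \<le> u \<longrightarrow> (1 - r + e1) * mid_ge q \<le> joint_ge m q"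
        using ud(1) by blast
      have "\<exists>e>0. \<exists>w\<in>levels. (\<forall>x\<in>supp. m < x \<and> x \<le> w \<longrightarrow> (1 - r + e) * mid_ge x \<le> joint_ge m x) \<and> (\<forall>\<^sub>F t in sequentially. q t \<le> w)"
      proof -
        consider "\<not> 0 < tail u" | "0 < tail u" "measure Z {z. mid z = u} = 0 \<or> (1 - r) * mid_ge u \<le> (tail u)\<^sup>2"
          | "measure Z {z. mid z = u} \<noteq> 0" "(tail u)\<^sup>2 < (1 - r) * mid_ge u" by fastforce
        then show ?thesis
        proof cases
          case 1
          then have "x \<le> u" if "x \<in> supp" for x using that by (auto simp: tail_pos_iff not_less)
          moreover obtain w where "w \<in> \<rat>" "u < w" using Rats_dense_in_real[of u "u + 1"] by auto
          ultimately show ?thesis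
            using e1 rat u1[of w] by (intro exI[of _ e1] conjI bexI[of _ w]) (auto elim!: eventually_mono)
        next
          case 2
          obtain e w where "e > 0" "w > u" "w \<in> \<rat>" "\<forall>q\<in>supp. m < q \<and> q \<le> w \<longrightarrow> (1 - r + e) * mid_ge q \<le> joint_ge m q"
            using uniform_drift_beyond[OF m(3) us 2(1) ratio m(4) 2(2)] by blast
          then show ?thesis
            using rat u1[of w] by (intro exI[of _ e] conjI bexI[of _ w]) (auto elim!: eventually_mono)
        next
          case 3
          then have "u \<in> levels" by (simp add: levels_def)
          moreover from below[OF this 3(2) l2'[OF lu]] have "\<forall>\<^sub>F t in sequentially. q t \<le> u" .
          ultimately show ?thesis using e1 by (intro exI[of _ e1] conjI bexI[of _ u]) auto
        qed
      qed
      then obtain e w where ew: "e > 0" "w \<in> levels"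
        "\<forall>x\<in>supp. m < x \<and> x \<le> w \<longrightarrow> (1 - r + e) * mid_ge x \<le> joint_ge m x" "\<forall>\<^sub>F t in sequentially. q t \<le> w" by blast
      have "\<forall>\<^sub>F t in sequentially. q t \<in> supp \<inter> {..w}"
        using evs ew(4) by eventually_elim auto
      then have "\<forall>\<^sub>F t in sequentially. m < q t"
        by (rule respects_sourcesD[OF sources m(1) ew(2,1,3)]) (rule u2[OF m(3)])
      then show False using l2'[OF m(2)] by (simp add: frequently_def not_le)
    next
      case False
      have eq: "(tail m)\<^sup>2 = (1 - r) * mid_ge m" if "m \<in> levels" "l < m" "m < u" for m
        using False ge[OF that] that by force
      have lim: "(tail s)\<^sup>2 = (1 - r) * mid_gt s" if s: "l < s" "s < u" for s
      proof (rule antisym)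
        show "(tail s)\<^sup>2 \<le> (1 - r) * mid_gt s"
          by (rule rat_limit_right[OF tendsto_power[OF tail_at_right] tendsto_mult[OF tendsto_const mid_ge_at_right] s(2)])
             (use eq rat s in auto)
        show "(1 - r) * mid_gt s \<le> (tail s)\<^sup>2"
          by (rule rat_limit_right[OF tendsto_mult[OF tendsto_const mid_ge_at_right] tendsto_power[OF tail_at_right] s(2)])
             (use eq rat s in auto)
      qed
      have noatom: "measure \<mu> {s} = 0" if s: "l < s" "s < u" for s
      proof (rule ccontr)
        assume "measure \<mu> {s} \<noteq> 0"
        then have a: "measure Z {z. mid z = s} \<noteq> 0" by (rule atom_in_levels)
        then have "(tail s)\<^sup>2 = (1 - r) * mid_ge s" using s by (intro eq) (auto simp: levels_def)
        then have "mid_ge s = mid_gt s" using lim[OF s] r by simp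
        then show False using a mid_ge_minus_mid_gt[of s] by simp
      qed
      have neg: "(tail s)\<^sup>2 \<le> (1 - r) * mid_ge s" if s: "l < s" "s < u" for s
        unfolding lim[OF s] using mid_gt_le_mid_ge r by (intro mult_left_mono) auto
      have "\<exists>y\<in>supp. l < y \<and> y < u"
      proof (rule ccontr)
        assume "\<not> ?thesis"
        then have 0: "measure \<mu> {l<..<u} = 0" by (intro measure_off_supp) auto
        obtain s where s: "s \<in> \<rat>" "l < s" "s < (l + u) / 2" using Rats_dense_in_real[of l "(l + u) / 2"] lu by auto
        obtain s' where s': "s' \<in> \<rat>" "(l + u) / 2 < s'" "s' < u" using Rats_dense_in_real[of "(l + u) / 2" u] lu by auto
        have "measure \<mu> {s<..s'} \<le> measure \<mu> {l<..<u}" using s s' by (intro D.finite_measure_mono) auto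
        then have "tail s = tail s'" using tail_diff[of s s'] 0 s s' by (simp add: measure_le_0_iff)
        moreover have "(tail s)\<^sup>2 = (1 - r) * mid_ge s" "(tail s')\<^sup>2 = (1 - r) * mid_ge s'"
          using s s' rat lu by (auto intro!: eq)
        ultimately have "mid_ge s = mid_ge s'" using r by simp
        then show False using mid_ge_strict[OF ls us s(3) s'(2)] by simp
      qed
      then obtain y where y: "y \<in> supp" "l < y" "y < u" by blast
      obtain m where m: "m \<in> \<rat>" "l < m" "m < y" using Rats_dense_in_real[OF y(2)] by auto
      obtain m' where m': "m' \<in> \<rat>" "y < m'" "m' < u" using Rats_dense_in_real[OF y(3)] by auto
      have "0 < measure \<mu> {m<..<m'}" using y m m' by (intro supp_interval_pos) auto
      also have "\<dots> \<le> measure \<mu> {m<..m'}" by (intro D.finite_measure_mono) auto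
      also have "\<dots> = tail m - tail m'" using m m' by (intro tail_diff[symmetric]) simp
      finally have "tail m' < tail m" by simp
      then have "neutral m m'" unfolding neutral_def using m m' noatom neg by auto
      then have "\<forall>\<^sub>F t in sequentially. q t \<le> m'"
        using neutral m(1) m'(1) l2'[OF m(2)] unfolding respects_neutral_def by blast
      then show False using not_ev_le[OF m'(3)] by simp
    qed
    then show ?thesis ..
  qed
qed

end

section \<open>Typical trajectories\<close>

lemma run_members: "s \<in># run r C z t \<Longrightarrow> s \<in># C \<or> (\<exists>i<t. s = low (z i))"
  by (induction t) (auto simp: step_def less_Suc_eq split: if_splits)

lemma size_run_empty: "real (size (run r {#} z t)) = (\<Sum>i<t. of_bool (admits r (run r {#} z i) (z i)))"
  by (induction t) (auto simp: step_def)

lemma above_run_empty: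
  "above s (run r {#} z t) = (\<Sum>i<t. of_bool (admits r (run r {#} z i) (z i) \<and> s < low (z i)))"
  by (induction t) (auto simp: step_def above_add)

context nonneg_opinions
begin

abbreviation "quant \<omega> t \<equiv> quantile r (traj \<omega> t)"

lemma quant_le_iff: "1 \<le> t \<Longrightarrow> quant \<omega> t \<le> m \<longleftrightarrow> excess r m (traj \<omega> t) \<le> 0"
  using r by (intro quantile_le_iff run_nonempty) auto

lemma eventually_quant:
  "(\<forall>\<^sub>F t in sequentially. quant \<omega> t \<le> m) \<longleftrightarrow> (\<forall>\<^sub>F t in sequentially. excess r m (traj \<omega> t) \<le> 0)"
  "(\<forall>\<^sub>F t in sequentially. m < quant \<omega> t) \<longleftrightarrow> (\<forall>\<^sub>F t in sequentially. 0 < excess r m (traj \<omega> t))"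
  using quant_le_iff by (auto intro!: eventually_cong[OF eventually_ge_at_top[of 1]] simp: not_le[symmetric])

lemma frequently_quant:
  "(\<exists>\<^sub>F t in sequentially. quant \<omega> t \<le> m) \<longleftrightarrow> (\<exists>\<^sub>\<infinity>t. excess r m (traj \<omega> t) \<le> 0)"
  "(\<exists>\<^sub>F t in sequentially. m < quant \<omega> t) \<longleftrightarrow> (\<exists>\<^sub>\<infinity>t. 0 < excess r m (traj \<omega> t))"
  using eventually_quant[where \<omega> = \<omega> and m = m]
  by (simp_all add: frequently_def cofinite_eq_sequentially not_le not_less)

lemma AE_draws: "AE z in Z. P z \<Longrightarrow> AE \<omega> in \<S>. \<forall>t. P (\<omega> t)"
  unfolding AE_all_countable
  by (intro allI AE_PiM_component) (auto intro: Z.P.prob_space_axioms)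

lemma AE_respects_sinks: "AE \<omega> in \<S>. respects_sinks (quant \<omega>)"
  unfolding respects_sinks_def
  unfolding eventually_quant frequently_quant
proof (subst AE_ball_countable[OF countable_levels], intro ballI)
  fix m show "AE \<omega> in \<S>. (tail m)\<^sup>2 < (1 - r) * mid_ge m \<longrightarrow> (\<exists>\<^sub>\<infinity>t. excess r m (traj \<omega> t) \<le> 0) \<longrightarrow>
      (\<forall>\<^sub>F t in sequentially. excess r m (traj \<omega> t) \<le> 0)"
    using AE_stay_below[of m] by (cases "(tail m)\<^sup>2 < (1 - r) * mid_ge m") auto
qed

lemma AE_respects_sources: "AE \<omega> in \<S>. respects_sources (quant \<omega>)"
  unfolding respects_sources_def
  unfolding eventually_quant(2) frequently_quant
  unfolding AE_ball_countable[OF countable_levels] AE_all_countable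
proof (intro ballI allI)
  fix m w :: real and n :: nat
  show "AE \<omega> in \<S>. (\<forall>x\<in>supp. m < x \<and> x \<le> w \<longrightarrow> (1 - r + 1 / real (Suc n)) * mid_ge x \<le> joint_ge m x) \<longrightarrow>
    (\<forall>\<^sub>F t in sequentially. quant \<omega> t \<in> supp \<inter> {..w}) \<longrightarrow> (\<exists>\<^sub>\<infinity>t. 0 < excess r m (traj \<omega> t)) \<longrightarrow>
    (\<forall>\<^sub>F t in sequentially. 0 < excess r m (traj \<omega> t))"
  proof (cases "\<forall>x\<in>supp. m < x \<and> x \<le> w \<longrightarrow> (1 - r + 1 / real (Suc n)) * mid_ge x \<le> joint_ge m x")
    case True
    have "supp \<inter> {..w} \<in> sets borel" using closed_supp by (intro sets.Int) auto
    then have "AE \<omega> in \<S>. (\<forall>\<^sub>F t in sequentially. quant \<omega> t \<in> supp \<inter> {..w}) \<longrightarrow> (\<exists>\<^sub>\<infinity>t. 0 < excess r m (traj \<omega> t)) \<longrightarrow>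
        (\<forall>\<^sub>F t in sequentially. 0 < excess r m (traj \<omega> t))"
      by (rule AE_stay_above[where e = "1 / real (Suc n)"]) (use True in \<open>auto simp: joint_ge_def\<close>)
    then show ?thesis by eventually_elim blast
  next
    case False
    then show ?thesis by (intro AE_I2) blast
  qed
qed

lemma AE_respects_neutral: "AE \<omega> in \<S>. respects_neutral (quant \<omega>)"
  unfolding respects_neutral_def eventually_quant frequently_quant AE_ball_countable[OF countable_rat]
proof (intro ballI)
  fix m m' :: real
  show "AE \<omega> in \<S>. neutral m m' \<longrightarrow>
    (\<exists>\<^sub>\<infinity>t. excess r m (traj \<omega> t) \<le> 0) \<longrightarrow> (\<forall>\<^sub>F t in sequentially. excess r m' (traj \<omega> t) \<le> 0)"
  proof (cases "neutral m m'")
    case True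
    then have "AE \<omega> in \<S>. (\<exists>\<^sub>\<infinity>t. excess r m (traj \<omega> t) \<le> 0) \<longrightarrow> (\<forall>\<^sub>F t in sequentially. excess r m' (traj \<omega> t) \<le> 0)"
      unfolding neutral_def by (intro AE_cross_below) auto
    then show ?thesis by eventually_elim blast
  next
    case False
    then show ?thesis by (intro AE_I2) blast
  qed
qed

definition "in_supp \<omega> \<longleftrightarrow> (\<forall>t. fst (\<omega> t) \<in> supp \<and> snd (\<omega> t) \<in> supp)"

lemma AE_in_supp: "AE \<omega> in \<S>. in_supp \<omega>"
  unfolding in_supp_def by (rule AE_draws[OF AE_Z_supp])

lemma member_in_supp:
  assumes "in_supp \<omega>" "s \<in># traj \<omega> t"
  shows "s \<in> supp"
  using run_members[OF assms(2)] assms(1) by (auto simp: in_supp_def low_def min_def)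

lemma quant_in_supp: "in_supp \<omega> \<Longrightarrow> 1 \<le> t \<Longrightarrow> quant \<omega> t \<in> supp"
  using r by (intro member_in_supp[of \<omega> _ t] quantile_in run_nonempty) auto

lemma AE_bounded: "AE \<omega> in \<S>. \<exists>B. \<forall>\<^sub>F t in sequentially. quant \<omega> t \<le> B"
proof (cases "\<exists>B. \<forall>x\<in>supp. x \<le> B")
  case True
  then obtain B where B: "\<forall>x\<in>supp. x \<le> B" ..
  show ?thesis
    using AE_in_supp
  proof eventually_elim
    case (elim \<omega>)
    have "\<forall>\<^sub>F t in sequentially. quant \<omega> t \<le> B"
      using eventually_ge_at_top[of 1] by eventually_elim (use B quant_in_supp[OF elim] in auto)
    then show ?case ..
  qed
next
  case False
  then have unb: "0 < tail m" for m by (auto simp: tail_pos_iff not_le)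
  have "\<exists>m\<ge>real k. (tail m)\<^sup>2 \<le> (1 - r - (1 - r) / 2) * mid_ge m" for k
    using ratio_small_at_infinity[OF unb, of "(1 - r) / 2" "real k"] r by (simp add: field_simps)
  then obtain m where m: "\<And>k. real k \<le> m k" "\<And>k. (tail (m k))\<^sup>2 \<le> (1 - r - (1 - r) / 2) * mid_ge (m k)"
    by metis
  have "AE \<omega> in \<S>. \<exists>k. \<forall>\<^sub>F t in sequentially. excess r (m k) (traj \<omega> t) \<le> 0"
  proof (rule AE_stay_below_some[OF m(2)])
    show "AE \<omega> in \<S>. \<forall>t. \<exists>k. quantile r (traj \<omega> (Suc t)) \<le> m k"
    proof (intro AE_I2 allI)
      fix \<omega> t
      obtain k where "quantile r (traj \<omega> (Suc t)) \<le> real k" using real_arch_simple by blast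
      with m(1)[of k] show "\<exists>k. quantile r (traj \<omega> (Suc t)) \<le> m k" by (intro exI[of _ k]) simp
    qed
  qed (use r in auto)
  then show ?thesis by eventually_elim (auto simp: eventually_quant[symmetric])
qed

definition "top_point b \<longleftrightarrow> (\<forall>x\<in>supp. x \<le> b) \<and> (\<forall>m<b. 0 < tail m)"

lemma top_atom:
  assumes "top_point b" "measure \<mu> {b} \<noteq> 0"
  shows "(rho r \<mu> \<longlongrightarrow> r) (at_left b)" "0 < mid_ge b" "b \<in> levels"
proof -
  have a: "0 < measure \<mu> {b}" using assms(2) by (simp add: zero_less_measure_iff)
  have "measure \<mu> {b<..} = 0" using assms(1) by (intro measure_off_supp) (auto simp: top_point_def)
  moreover have eq: "{b..} = {b} \<union> {b<..}" by auto
  moreover have "tail_ge b = measure \<mu> {b} + measure \<mu> {b<..}"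
    unfolding tail_ge_def eq by (rule D.finite_measure_Union) auto
  ultimately have tle: "tail_ge b = measure \<mu> {b}" by simp
  have "mid_ge b = (tail_ge b)\<^sup>2"
    unfolding measure_low_ge[symmetric] mid_ge_def
  proof (rule Z.P.finite_measure_eq_AE)
    show "AE z in Z. z \<in> {z. b \<le> mid z} \<longleftrightarrow> z \<in> {z. b \<le> low z}"
      using AE_Z_supp
    proof eventually_elim
      case (elim z)
      then have "fst z \<le> b" "snd z \<le> b" using assms(1) by (auto simp: top_point_def)
      then show ?case by (auto simp: mid_def low_def)
    qed
    have "{z. b \<le> low z} = {b..} \<times> {b..}" by (auto simp: low_def)
    then show "{z. b \<le> low z} \<in> sets Z" by (simp only: rect_event borel_closed closed_atLeast)
  qed (rule mid_low_events)
  then have adb: "mid_ge b = (measure \<mu> {b})\<^sup>2" by (simp add: tle)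
  then show den: "0 < mid_ge b" using a by simp
  show "b \<in> levels" using atom_in_levels[OF assms(2)] by (simp add: levels_def)
  have "((\<lambda>x. (tail x)\<^sup>2 / mid_ge x - (1 - r)) \<longlongrightarrow> (tail_ge b)\<^sup>2 / mid_ge b - (1 - r)) (at_left b)"
    using den by (intro tendsto_intros tail_at_left mid_ge_at_left) simp
  then show "(rho r \<mu> \<longlongrightarrow> r) (at_left b)"
    using a by (simp add: rho_eq[abs_def] adb tle)
qed

lemma AE_low_neq: "measure \<mu> {b} = 0 \<Longrightarrow> AE z in Z. low z \<noteq> b"
proof -
  assume noatom: "measure \<mu> {b} = 0"
  have "measure Z ({b} \<times> UNIV) = 0" "measure Z (UNIV \<times> {b}) = 0"
    using noatom by (auto simp del: UNIV_Times_UNIV simp: measure_rect)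
  moreover have "{b} \<times> UNIV \<in> sets Z" "UNIV \<times> {b} \<in> sets Z" by (intro rect_event; simp)+
  ultimately have "AE z in Z. z \<notin> {b} \<times> UNIV" "AE z in Z. z \<notin> UNIV \<times> {b}"
    by (auto simp: Z.P.prob_eq_0[symmetric])
  then show ?thesis by eventually_elim (auto simp: low_def min_def mem_Times_iff)
qed

text \<open>
An atom at \<open>b\<close> would make \<open>rho\<close> tend to \<open>r\<close>. Without an atom, all members lie strictly below
\<open>b\<close>, so at every time the quantile is below one of the levels close to \<open>b\<close> where \<open>rho\<close> is
at most a fixed negative number.
\<close>

lemma AE_not_to_top:
  assumes b: "top_point b" and neg: "\<not> 0 \<le> Liminf (at_left b) (\<lambda>x. ereal (rho r \<mu> x))"
  shows "AE \<omega> in \<S>. \<not> (quant \<omega> \<longlonglongrightarrow> b)"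
proof -
  obtain y where y: "y < 0" "\<not> (\<forall>\<^sub>F x in at_left b. y < ereal (rho r \<mu> x))"
    using neg unfolding le_Liminf_iff by auto
  have fr: "\<exists>\<^sub>F x in at_left b. ereal (rho r \<mu> x) \<le> y"
    using y(2) by (simp add: not_eventually not_less)
  have noatom: "measure \<mu> {b} = 0"
  proof (rule ccontr)
    assume "measure \<mu> {b} \<noteq> 0"
    from top_atom(1)[OF b this] have "\<forall>\<^sub>F x in at_left b. 0 < rho r \<mu> x"
      using r by (intro order_tendstoD) auto
    then have "\<forall>\<^sub>F x in at_left b. \<not> ereal (rho r \<mu> x) \<le> y"
    proof eventually_elim
      case (elim x)
      then have "0 < ereal (rho r \<mu> x)" by simp
      with y(1) have "y < ereal (rho r \<mu> x)" by (rule less_trans)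
      then show ?case by (simp add: not_le)
    qed
    then show False using fr by (simp add: frequently_def)
  qed
  obtain y' where y': "y = ereal y'"
  proof (cases y)
    case MInf
    then show ?thesis using frequently_ex[OF fr] by auto
  qed (use y(1) that in auto)
  \<comment> \<open>the cap at \<open>1 - r\<close> is harmless since \<open>rho\<close> is never below \<open>r - 1\<close>\<close>
  define e where "e = min (- y') (1 - r)"
  have e: "0 < e" "e \<le> 1 - r" using y(1) y' r by (auto simp: e_def)
  have "\<exists>x. b - 1 / real (Suc k) < x \<and> x < b \<and> (tail x)\<^sup>2 \<le> (1 - r - e) * mid_ge x" for k
  proof -
    have "\<forall>\<^sub>F x in at_left b. b - 1 / real (Suc k) < x \<and> x < b"
      unfolding eventually_at_left_field by (intro exI[of _ "b - 1 / real (Suc k)"]) auto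
    from frequently_ex[OF frequently_eventually_frequently[OF fr this]] obtain x where
      x: "ereal (rho r \<mu> x) \<le> y" "b - 1 / real (Suc k) < x" "x < b" by blast
    have "0 < mid_ge x" using b x(3) by (intro mid_ge_pos) (auto simp: top_point_def)
    moreover have "(tail x)\<^sup>2 / mid_ge x \<le> 1 - r - e" using x(1) by (simp add: y' rho_eq e_def)
    ultimately have "(tail x)\<^sup>2 \<le> (1 - r - e) * mid_ge x" by (simp add: pos_divide_le_eq)
    with x show ?thesis by blast
  qed
  then obtain m where m: "\<And>k. b - 1 / real (Suc k) < m k" "\<And>k. m k < b" "\<And>k. (tail (m k))\<^sup>2 \<le> (1 - r - e) * mid_ge (m k)"
    by metis
  from AE_draws[OF AE_low_neq[OF noatom]] AE_in_supp
  have bd: "AE \<omega> in \<S>. \<forall>t. \<exists>k. quantile r (traj \<omega> (Suc t)) \<le> m k"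
  proof eventually_elim
    case (elim \<omega>)
    show ?case
    proof
      fix t
      have qm: "quant \<omega> (Suc t) \<in># traj \<omega> (Suc t)" using r by (intro quantile_in run_nonempty) auto
      then have "quant \<omega> (Suc t) \<noteq> b" using run_members[OF qm] elim(1) by auto
      moreover have "quant \<omega> (Suc t) \<le> b" using member_in_supp[OF elim(2) qm] b by (simp add: top_point_def)
      ultimately have "0 < b - quant \<omega> (Suc t)" by simp
      then obtain k where "1 / real (Suc k) < b - quant \<omega> (Suc t)" using nat_approx_posE by blast
      then have "quant \<omega> (Suc t) \<le> m k" using m(1)[of k] by simp
      then show "\<exists>k. quantile r (traj \<omega> (Suc t)) \<le> m k" ..
    qed
  qed
  from AE_stay_below_some[OF m(3) e bd] show ?thesis
  proof eventually_elim
    case (elim \<omega>)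
    then obtain k where "\<forall>\<^sub>F t in sequentially. quant \<omega> t \<le> m k" by (auto simp: eventually_quant)
    then show ?case
      using m(2)[of k] by (auto intro: tendsto_upperbound dest!: tendsto_upperbound[rotated])
  qed
qed

end

section \<open>Limits of the empirical distributions\<close>

context nonneg_opinions
begin

definition "freqs \<omega> \<longleftrightarrow> (\<forall>s\<in>levels. \<forall>m\<in>levels.
   (\<lambda>t. (\<Sum>i<t. of_bool (s < low (\<omega> i) \<and> m \<le> mid (\<omega> i))) / real t) \<longlonglongrightarrow> joint_ge s m \<and>
   (\<lambda>t. (\<Sum>i<t. of_bool (s < low (\<omega> i) \<and> m < mid (\<omega> i))) / real t) \<longlonglongrightarrow> joint_gt s m)"

lemma AE_freqs: "AE \<omega> in \<S>. freqs \<omega>"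
  unfolding freqs_def AE_ball_countable[OF countable_levels]
proof (intro ballI AE_conjI)
  fix s m :: real
  show "AE \<omega> in \<S>. (\<lambda>t. (\<Sum>i<t. of_bool (s < low (\<omega> i) \<and> m \<le> mid (\<omega> i))) / real t) \<longlonglongrightarrow> joint_ge s m"
    using SP.frequency_tendsto[OF joint_ge_events(1)[of s m]] by (simp add: joint_ge_def indicator_def of_bool_def)
  show "AE \<omega> in \<S>. (\<lambda>t. (\<Sum>i<t. of_bool (s < low (\<omega> i) \<and> m < mid (\<omega> i))) / real t) \<longlonglongrightarrow> joint_gt s m"
    using SP.frequency_tendsto[OF joint_ge_events(2)[of s m]] by (simp add: joint_gt_def indicator_def of_bool_def)
qed

lemma admits_iff_quant: "1 \<le> t \<Longrightarrow> admits r (traj \<omega> t) z \<longleftrightarrow> quant \<omega> t \<le> mid z"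
  using r by (intro admits_iff_quantile run_nonempty) auto

lemma sum_of_bool_less: "(\<Sum>i<t. of_bool (i < N)) \<le> real N"
proof -
  have "(\<Sum>i<t. of_bool (i < N)) = real (card {i\<in>{..<t}. i < N})" by (simp add: Collect_conj_eq lessThan_def)
  also have "\<dots> \<le> real (card {..<N})" by (intro of_nat_mono card_mono) auto
  finally show ?thesis by simp
qed

text \<open>
If from some time on all pairs satisfying \<open>P\<close> are admitted, then up to finitely many terms the number of
members above \<open>s\<close> is at least the number of pairs above \<open>s\<close> satisfying \<open>P\<close>. As \<open>P\<close> does not refer to the
club, the law of large numbers applies to these pairs.
\<close>

lemma above_rate_lower:
  assumes ev: "\<forall>\<^sub>F t in sequentially. P (\<omega> t) \<longrightarrow> admits r (traj \<omega> t) (\<omega> t)"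
    and lim: "(\<lambda>t. (\<Sum>i<t. of_bool (s < low (\<omega> i) \<and> P (\<omega> i))) / real t) \<longlonglongrightarrow> k" and y: "y < k"
  shows "\<forall>\<^sub>F t in sequentially. y < above s (traj \<omega> t) / real t"
proof -
  obtain N where N: "\<And>t. N \<le> t \<Longrightarrow> P (\<omega> t) \<Longrightarrow> admits r (traj \<omega> t) (\<omega> t)"
    using ev by (auto simp: eventually_sequentially)
  have le: "(\<Sum>i<t. of_bool (s < low (\<omega> i) \<and> P (\<omega> i))) - real N \<le> above s (traj \<omega> t)" for t
  proof -
    have "(\<Sum>i<t. of_bool (s < low (\<omega> i) \<and> P (\<omega> i))) \<le>
        (\<Sum>i<t. of_bool (admits r (traj \<omega> i) (\<omega> i) \<and> s < low (\<omega> i)) + of_bool (i < N) :: real)"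
      using N by (intro sum_mono) (auto simp: not_less)
    also have "\<dots> \<le> above s (traj \<omega> t) + real N"
      unfolding above_run_empty sum.distrib by (intro add_left_mono sum_of_bool_less)
    finally show ?thesis by simp
  qed
  have "(\<lambda>t. (\<Sum>i<t. of_bool (s < low (\<omega> i) \<and> P (\<omega> i))) / real t - real N / real t) \<longlonglongrightarrow> k - 0"
    by (intro tendsto_diff lim lim_const_over_n)
  then have "\<forall>\<^sub>F t in sequentially. y < (\<Sum>i<t. of_bool (s < low (\<omega> i) \<and> P (\<omega> i))) / real t - real N / real t"
    using y by (intro order_tendstoD(1)) auto
  then show ?thesis
  proof eventually_elim
    case (elim t)
    also have "(\<Sum>i<t. of_bool (s < low (\<omega> i) \<and> P (\<omega> i))) / real t - real N / real t \<le> above s (traj \<omega> t) / real t"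
      unfolding diff_divide_distrib[symmetric] using le by (intro divide_right_mono) auto
    finally show ?case .
  qed
qed

lemma above_rate_upper:
  assumes ev: "\<forall>\<^sub>F t in sequentially. admits r (traj \<omega> t) (\<omega> t) \<longrightarrow> P (\<omega> t)"
    and lim: "(\<lambda>t. (\<Sum>i<t. of_bool (s < low (\<omega> i) \<and> P (\<omega> i))) / real t) \<longlonglongrightarrow> k" and y: "k < y"
  shows "\<forall>\<^sub>F t in sequentially. above s (traj \<omega> t) / real t < y"
proof -
  obtain N where N: "\<And>t. N \<le> t \<Longrightarrow> admits r (traj \<omega> t) (\<omega> t) \<Longrightarrow> P (\<omega> t)"
    using ev by (auto simp: eventually_sequentially)
  have le: "above s (traj \<omega> t) \<le> (\<Sum>i<t. of_bool (s < low (\<omega> i) \<and> P (\<omega> i))) + real N" for t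
  proof -
    have "above s (traj \<omega> t) \<le> (\<Sum>i<t. of_bool (s < low (\<omega> i) \<and> P (\<omega> i)) + of_bool (i < N))"
      unfolding above_run_empty using N by (intro sum_mono) (auto simp: not_less)
    also have "\<dots> \<le> (\<Sum>i<t. of_bool (s < low (\<omega> i) \<and> P (\<omega> i))) + real N"
      unfolding sum.distrib by (intro add_left_mono sum_of_bool_less)
    finally show ?thesis .
  qed
  have "(\<lambda>t. (\<Sum>i<t. of_bool (s < low (\<omega> i) \<and> P (\<omega> i))) / real t + real N / real t) \<longlonglongrightarrow> k + 0"
    by (intro tendsto_add lim lim_const_over_n)
  then have "\<forall>\<^sub>F t in sequentially. (\<Sum>i<t. of_bool (s < low (\<omega> i) \<and> P (\<omega> i))) / real t + real N / real t < y"
    using y by (intro order_tendstoD(2)) auto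
  then show ?thesis
  proof eventually_elim
    case (elim t)
    have "above s (traj \<omega> t) / real t \<le> (\<Sum>i<t. of_bool (s < low (\<omega> i) \<and> P (\<omega> i))) / real t + real N / real t"
      unfolding add_divide_distrib[symmetric] using le by (intro divide_right_mono) auto
    with elim show ?case by simp
  qed
qed

lemma rat_in_levels: "s \<in> \<rat> \<Longrightarrow> s \<in> levels" by (simp add: levels_def)

context
  fixes \<omega> m
  assumes fr: "freqs \<omega>" and qm: "quant \<omega> \<longlonglongrightarrow> m"
begin

text \<open>
These bounds describe the number of members above \<open>s\<close> per round as the quantile converges to \<open>m\<close>. The law of
large numbers is available at the countably many \<open>levels\<close> only. At \<open>m\<close> itself it is used if the quantile
remains on one side of \<open>m\<close>, and otherwise \<open>m\<close> is approximated by rational numbers.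
\<close>

lemma rate_lower_closed:
  assumes "m \<in> levels" "\<forall>\<^sub>F t in sequentially. quant \<omega> t \<le> m" "s \<in> levels" "y < joint_ge s m"
  shows "\<forall>\<^sub>F t in sequentially. y < above s (traj \<omega> t) / real t"
proof (rule above_rate_lower[where P = "\<lambda>z. m \<le> mid z"])
  show "\<forall>\<^sub>F t in sequentially. m \<le> mid (\<omega> t) \<longrightarrow> admits r (traj \<omega> t) (\<omega> t)"
    using assms(2) eventually_ge_at_top[of 1] by eventually_elim (simp add: admits_iff_quant)
  show "(\<lambda>t. (\<Sum>i<t. of_bool (s < low (\<omega> i) \<and> m \<le> mid (\<omega> i))) / real t) \<longlonglongrightarrow> joint_ge s m"
    using fr assms by (simp add: freqs_def)
qed fact

lemma rate_lower_open:
  assumes "s \<in> levels" "y < joint_gt s m"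
  shows "\<forall>\<^sub>F t in sequentially. y < above s (traj \<omega> t) / real t"
proof -
  have "\<forall>\<^sub>F w in at_right m. y < joint_ge s w" by (rule order_tendstoD(1)[OF joint_ge_at_right assms(2)])
  then obtain b where b: "m < b" "\<And>w. m < w \<Longrightarrow> w < b \<Longrightarrow> y < joint_ge s w"
    unfolding eventually_at_right_field by auto
  obtain w where w: "w \<in> \<rat>" "m < w" "w < b" using Rats_dense_in_real[OF b(1)] by blast
  show ?thesis
  proof (rule above_rate_lower[where P = "\<lambda>z. w \<le> mid z"])
    show "\<forall>\<^sub>F t in sequentially. w \<le> mid (\<omega> t) \<longrightarrow> admits r (traj \<omega> t) (\<omega> t)"
      using order_tendstoD(2)[OF qm w(2)] eventually_ge_at_top[of 1] by eventually_elim (simp add: admits_iff_quant)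
    show "(\<lambda>t. (\<Sum>i<t. of_bool (s < low (\<omega> i) \<and> w \<le> mid (\<omega> i))) / real t) \<longlonglongrightarrow> joint_ge s w"
      using fr assms rat_in_levels[OF w(1)] by (simp add: freqs_def)
  qed (use b w in simp)
qed

lemma rate_upper_closed:
  assumes "s \<in> levels" "joint_ge s m < y"
  shows "\<forall>\<^sub>F t in sequentially. above s (traj \<omega> t) / real t < y"
proof -
  have "\<forall>\<^sub>F w in at_left m. joint_ge s w < y" by (rule order_tendstoD(2)[OF joint_ge_at_left assms(2)])
  then obtain b where b: "b < m" "\<And>w. b < w \<Longrightarrow> w < m \<Longrightarrow> joint_ge s w < y"
    unfolding eventually_at_left_field by auto
  obtain w where w: "w \<in> \<rat>" "b < w" "w < m" using Rats_dense_in_real[OF b(1)] by blast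
  show ?thesis
  proof (rule above_rate_upper[where P = "\<lambda>z. w \<le> mid z"])
    show "\<forall>\<^sub>F t in sequentially. admits r (traj \<omega> t) (\<omega> t) \<longrightarrow> w \<le> mid (\<omega> t)"
      using order_tendstoD(1)[OF qm w(3)] eventually_ge_at_top[of 1] by eventually_elim (simp add: admits_iff_quant)
    show "(\<lambda>t. (\<Sum>i<t. of_bool (s < low (\<omega> i) \<and> w \<le> mid (\<omega> i))) / real t) \<longlonglongrightarrow> joint_ge s w"
      using fr assms rat_in_levels[OF w(1)] by (simp add: freqs_def)
  qed (use b w in simp)
qed

lemma rate_upper_open:
  assumes "m \<in> levels" "\<forall>\<^sub>F t in sequentially. m < quant \<omega> t" "s \<in> levels" "joint_gt s m < y"
  shows "\<forall>\<^sub>F t in sequentially. above s (traj \<omega> t) / real t < y"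
proof (rule above_rate_upper[where P = "\<lambda>z. m < mid z"])
  show "\<forall>\<^sub>F t in sequentially. admits r (traj \<omega> t) (\<omega> t) \<longrightarrow> m < mid (\<omega> t)"
    using assms(2) eventually_ge_at_top[of 1] by eventually_elim (simp add: admits_iff_quant)
  show "(\<lambda>t. (\<Sum>i<t. of_bool (s < low (\<omega> i) \<and> m < mid (\<omega> i))) / real t) \<longlonglongrightarrow> joint_gt s m"
    using fr assms by (simp add: freqs_def)
qed fact

end

definition "share \<omega> s t = above s (traj \<omega> t) / real (size (traj \<omega> t))"

text \<open>
Opinions are nonnegative, so the size of the club is a special case of the number of members above a
level, and the level \<open>- 1\<close> gives the denominators of the limit laws.
\<close>

lemma size_eq_above: "in_supp \<omega> \<Longrightarrow> real (size (traj \<omega> t)) = above (- 1) (traj \<omega> t)"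
proof -
  assume w: "in_supp \<omega>"
  have "filter_mset (\<lambda>s. - 1 < s) (traj \<omega> t) = traj \<omega> t"
    using member_in_supp[OF w] supp_nonneg by (force simp: filter_mset_eq_conv)
  then show ?thesis by (simp add: above_def)
qed

lemma AE_low_nonneg: "AE z in Z. - 1 < low z"
  using AE_Z_supp
proof eventually_elim
  case (elim z)
  then have "0 \<le> fst z" "0 \<le> snd z" using supp_nonneg by auto
  then show ?case by (simp add: low_def)
qed

lemma joint_ge_minus1: "joint_ge (- 1) m = mid_ge m" "joint_gt (- 1) m = mid_gt m"
  unfolding joint_ge_def joint_gt_def mid_ge_def mid_gt_def
  by (rule Z.P.finite_measure_eq_AE; use AE_low_nonneg in \<open>auto elim!: eventually_mono intro: joint_ge_events mid_low_events\<close>)+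

lemma share_tendsto:
  assumes "in_supp \<omega>" and lim: "\<And>s. s \<in> levels \<Longrightarrow> (\<lambda>t. above s (traj \<omega> t) / real t) \<longlonglongrightarrow> k s"
    and "k (- 1) \<noteq> 0" "s \<in> levels"
  shows "share \<omega> s \<longlonglongrightarrow> k s / k (- 1)"
proof -
  have "(\<lambda>t. (above s (traj \<omega> t) / real t) / (above (- 1) (traj \<omega> t) / real t)) \<longlonglongrightarrow> k s / k (- 1)"
    using assms by (intro tendsto_divide lim) (auto intro: rat_in_levels)
  moreover have "\<forall>\<^sub>F t in sequentially. (above s (traj \<omega> t) / real t) / (above (- 1) (traj \<omega> t) / real t) = share \<omega> s t"
    using eventually_gt_at_top[of 0]
    by eventually_elim (simp add: share_def size_eq_above[OF assms(1)])
  ultimately show ?thesis by (rule Lim_transform_eventually)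
qed

lemma share_le_iff: "1 \<le> t \<Longrightarrow> share \<omega> s t \<le> 1 - r \<longleftrightarrow> quant \<omega> t \<le> s"
proof -
  assume t: "1 \<le> t"
  then have "0 < real (size (traj \<omega> t))" using run_nonempty[OF t, of r "{#}" \<omega>] by (simp add: nonempty_has_size)
  then show ?thesis
    using quant_le_iff[OF t] by (simp add: share_def excess_def pos_divide_le_eq)
qed

definition "law G = distr (uniform_measure Z G) borel low"

lemma law:
  assumes G: "G \<in> sets Z" "measure Z G > 0"
  shows "prob_space (law G)" "sets (law G) = sets borel" "measure (law G) {s<..} = measure Z (G \<inter> {z. s < low z}) / measure Z G"
proof -
  have lm: "low \<in> uniform_measure Z G \<rightarrow>\<^sub>M borel" by measurable
  interpret U: prob_space "uniform_measure Z G"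
    using G by (intro prob_space_uniform_measure) (auto simp: Z.P.emeasure_eq_measure)
  show "prob_space (law G)" unfolding law_def by (rule U.prob_space_distr[OF lm])
  show "sets (law G) = sets borel" by (simp add: law_def)
  have "measure (law G) {s<..} = measure (uniform_measure Z G) {z. s < low z}"
    unfolding law_def by (subst measure_distr[OF lm]) (auto intro!: arg_cong[where f = "measure _"])
  also have "\<dots> = measure Z (G \<inter> {z. s < low z}) / measure Z G"
    using G mid_low_events by (subst measure_uniform_measure) (auto simp: Z.P.emeasure_eq_measure)
  finally show "measure (law G) {s<..} = measure Z (G \<inter> {z. s < low z}) / measure Z G" .
qed

lemma closed_law:
  assumes m: "0 < tail m"
  shows "measure (law {z. m \<le> mid z}) {s<..} = joint_ge s m / mid_ge m"
    and "measure (law {z. m \<le> mid z}) {s<..} = \<P>(z in Z. fst z > s \<and> snd z > s \<bar> fst z + snd z \<ge> 2 * m)"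
proof -
  have "{z. m \<le> mid z} \<inter> {z. s < low z} = {z. s < low z \<and> m \<le> mid z}" by auto
  then show 1: "measure (law {z. m \<le> mid z}) {s<..} = joint_ge s m / mid_ge m"
    using law(3)[OF mid_low_events(2), of m s] mid_ge_pos[OF m] by (simp add: joint_ge_def mid_ge_def)
  have "{z. s < low z \<and> m \<le> mid z} = {z. (fst z > s \<and> snd z > s) \<and> fst z + snd z \<ge> 2 * m}"
    "{z. m \<le> mid z} = {z. fst z + snd z \<ge> 2 * m}"
    by (auto simp: low_def mid_def)
  then show "measure (law {z. m \<le> mid z}) {s<..} = \<P>(z in Z. fst z > s \<and> snd z > s \<bar> fst z + snd z \<ge> 2 * m)"
    unfolding 1 cond_prob_def joint_ge_def mid_ge_def by simp
qed

lemma open_law: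
  assumes m: "0 < tail m"
  shows "measure (law {z. m < mid z}) {s<..} = joint_gt s m / mid_gt m"
    and "measure (law {z. m < mid z}) {s<..} = \<P>(z in Z. fst z > s \<and> snd z > s \<bar> fst z + snd z > 2 * m)"
proof -
  have "{z. m < mid z} \<inter> {z. s < low z} = {z. s < low z \<and> m < mid z}" by auto
  then show 1: "measure (law {z. m < mid z}) {s<..} = joint_gt s m / mid_gt m"
    using law(3)[OF mid_low_events(3), of m s] mid_gt_pos[OF m] by (simp add: joint_gt_def mid_gt_def)
  have "{z. s < low z \<and> m < mid z} = {z. (fst z > s \<and> snd z > s) \<and> fst z + snd z > 2 * m}"
    "{z. m < mid z} = {z. fst z + snd z > 2 * m}"
    by (auto simp: low_def mid_def)
  then show "measure (law {z. m < mid z}) {s<..} = \<P>(z in Z. fst z > s \<and> snd z > s \<bar> fst z + snd z > 2 * m)"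
    unfolding 1 cond_prob_def joint_gt_def mid_gt_def by simp
qed

lemma joint_ge_above:
  assumes "m \<le> s"
  shows "joint_ge s m = (tail s)\<^sup>2" "joint_gt s m = (tail s)\<^sup>2"
proof -
  have *: "m \<le> mid z \<and> m < mid z" if "s < low z" for z
    using that low_le_mid[of z] assms by linarith
  have "{z. s < low z \<and> m \<le> mid z} = {z. s < low z}" "{z. s < low z \<and> m < mid z} = {z. s < low z}"
    using * by blast+
  then show "joint_ge s m = (tail s)\<^sup>2" "joint_gt s m = (tail s)\<^sup>2"
    by (simp_all add: joint_ge_def joint_gt_def measure_low)
qed

lemma joint_ge_level_at_left: "((\<lambda>s. joint_ge s m) \<longlongrightarrow> (tail_ge m)\<^sup>2) (at_left m)"
proof -
  have lz: "low \<in> borel_measurable Z" by measurable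
  have eq: "{z \<in> {z. m \<le> mid z}. s < low z} = {z. s < low z \<and> m \<le> mid z}" for s by auto
  have eq2: "{z \<in> {z. m \<le> mid z}. m \<le> low z} = {z. m \<le> low z}"
    using low_le_mid by (auto intro: order_trans)
  show ?thesis
    using Z.P.tail_at_left(2)[OF lz mid_low_events(2)[of m], of m]
    unfolding eq eq2 measure_low_ge joint_ge_def .
qed

definition "typical \<omega> \<longleftrightarrow> in_supp \<omega> \<and> freqs \<omega> \<and>
  respects_sinks (quant \<omega>) \<and> respects_sources (quant \<omega>) \<and> respects_neutral (quant \<omega>) \<and>
  (\<exists>B. \<forall>\<^sub>F t in sequentially. quant \<omega> t \<le> B) \<and>
  (\<forall>b. top_point b \<longrightarrow> \<not> 0 \<le> Liminf (at_left b) (\<lambda>x. ereal (rho r \<mu> x)) \<longrightarrow> \<not> (quant \<omega> \<longlonglongrightarrow> b)) \<and>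
  (\<forall>b. measure \<mu> {b} = 0 \<longrightarrow> top_point b \<longrightarrow> (\<forall>t. low (\<omega> t) \<noteq> b))"

lemma top_point_unique: "top_point b \<Longrightarrow> top_point c \<Longrightarrow> b = c"
proof -
  have "b \<le> c" if "top_point b" "top_point c" for b c
  proof (rule ccontr)
    assume "\<not> b \<le> c"
    then have "0 < tail c" using that(1) by (simp add: top_point_def)
    then show False using that(2) by (auto simp: tail_pos_iff top_point_def)
  qed
  then show "top_point b \<Longrightarrow> top_point c \<Longrightarrow> b = c" by (meson antisym)
qed

lemma AE_typical: "AE \<omega> in \<S>. typical \<omega>"
proof -
  have 1: "AE \<omega> in \<S>. \<forall>b. top_point b \<longrightarrow> \<not> 0 \<le> Liminf (at_left b) (\<lambda>x. ereal (rho r \<mu> x)) \<longrightarrow> \<not> (quant \<omega> \<longlonglongrightarrow> b)"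
  proof (cases "\<exists>b. top_point b \<and> \<not> 0 \<le> Liminf (at_left b) (\<lambda>x. ereal (rho r \<mu> x))")
    case True
    then obtain b where b: "top_point b" "\<not> 0 \<le> Liminf (at_left b) (\<lambda>x. ereal (rho r \<mu> x))" by blast
    from AE_not_to_top[OF this] show ?thesis
    proof eventually_elim
      case (elim \<omega>)
      then show ?case using top_point_unique[OF b(1)] by blast
    qed
  next
    case False
    then show ?thesis by (intro AE_I2) blast
  qed
  have 2: "AE \<omega> in \<S>. \<forall>b. measure \<mu> {b} = 0 \<longrightarrow> top_point b \<longrightarrow> (\<forall>t. low (\<omega> t) \<noteq> b)"
  proof (cases "\<exists>b. measure \<mu> {b} = 0 \<and> top_point b")
    case True
    then obtain b where b: "measure \<mu> {b} = 0" "top_point b" by blast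
    from AE_draws[OF AE_low_neq[OF b(1)]] show ?thesis
    proof eventually_elim
      case (elim \<omega>)
      then show ?case using top_point_unique[OF b(2)] by blast
    qed
  next
    case False
    then show ?thesis by (intro AE_I2) blast
  qed
  show ?thesis
    using AE_in_supp AE_freqs AE_respects_sinks AE_respects_sources AE_respects_neutral AE_bounded 1 2
    unfolding typical_def by eventually_elim (intro conjI)
qed

lemma typical_convergent:
  assumes "typical \<omega>"
  obtains m where "quant \<omega> \<longlonglongrightarrow> m" "m \<in> supp"
proof -
  obtain B where B: "\<forall>\<^sub>F t in sequentially. quant \<omega> t \<le> B" using assms unfolding typical_def by blast
  have w: "in_supp \<omega>" using assms by (simp add: typical_def)
  have "convergent (quant \<omega>)"
    by (rule quantile_convergent[OF quant_in_supp[OF w] B]) (use assms in \<open>simp_all add: typical_def\<close>)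
  then obtain m where m: "quant \<omega> \<longlonglongrightarrow> m" by (auto simp: convergent_def)
  moreover have "m \<in> supp"
    by (rule Lim_in_closed_set[OF closed_supp _ _ m])
       (use quant_in_supp[OF w] in \<open>auto simp: eventually_sequentially intro!: exI[of _ 1]\<close>)
  ultimately show ?thesis by (rule that)
qed

text \<open>
Rational levels above \<open>m\<close> have a limiting share of at most \<open>1 - r\<close>, those below \<open>m\<close> one of at least
\<open>1 - r\<close>. Letting them tend to \<open>m\<close> gives the two inequalities for \<open>rho\<close>.
\<close>

lemma limit_closed_form:
  assumes w: "in_supp \<omega>" and qm: "quant \<omega> \<longlonglongrightarrow> m" and m: "0 < tail m"
    and lim: "\<And>s. s \<in> levels \<Longrightarrow> (\<lambda>t. above s (traj \<omega> t) / real t) \<longlonglongrightarrow> joint_ge s m"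
  shows "limit_form_i r \<mu> (law {z. m \<le> mid z})"
    and "s \<in> levels \<Longrightarrow> share \<omega> s \<longlonglongrightarrow> measure (law {z. m \<le> mid z}) {s<..}"
proof -
  have den: "0 < mid_ge m" by (rule mid_ge_pos[OF m])
  have sh: "share \<omega> s \<longlonglongrightarrow> joint_ge s m / mid_ge m" if "s \<in> levels" for s
    using share_tendsto[of \<omega> "\<lambda>s. joint_ge s m", OF w lim _ that] den by (simp add: joint_ge_minus1)
  then show "s \<in> levels \<Longrightarrow> share \<omega> s \<longlonglongrightarrow> measure (law {z. m \<le> mid z}) {s<..}"
    by (simp add: closed_law(1)[OF m])
  have hi: "(tail s)\<^sup>2 \<le> (1 - r) * mid_ge m" if "s \<in> \<rat>" "m < s" for s
  proof -
    have "\<forall>\<^sub>F t in sequentially. share \<omega> s t \<le> 1 - r"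
      using order_tendstoD(2)[OF qm that(2)] eventually_ge_at_top[of 1]
      by eventually_elim (simp add: share_le_iff)
    then have "joint_ge s m / mid_ge m \<le> 1 - r"
      by (rule tendsto_upperbound[OF sh[OF rat_in_levels[OF that(1)]]]) simp
    then show ?thesis using den that(2) by (simp add: pos_divide_le_eq joint_ge_above(1))
  qed
  have lo: "(1 - r) * mid_ge m \<le> joint_ge s m" if "s \<in> \<rat>" "s < m" for s
  proof -
    have "\<forall>\<^sub>F t in sequentially. 1 - r \<le> share \<omega> s t"
      using order_tendstoD(1)[OF qm that(2)] eventually_ge_at_top[of 1]
      by eventually_elim (metis share_le_iff linorder_not_less less_imp_le)
    then have "1 - r \<le> joint_ge s m / mid_ge m"
      by (rule tendsto_lowerbound[OF sh[OF rat_in_levels[OF that(1)]]]) simp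
    then show ?thesis using den by (simp add: pos_le_divide_eq)
  qed
  have "(tail m)\<^sup>2 \<le> (1 - r) * mid_ge m"
    by (rule rat_limit_right[OF tendsto_power[OF tail_at_right] tendsto_const, of m "m + 1"]) (use hi in auto)
  then have "rho r \<mu> m \<le> 0" using den by (simp add: rho_eq pos_divide_le_eq)
  moreover have "(1 - r) * mid_ge m \<le> (tail_ge m)\<^sup>2"
    by (rule rat_limit_left[OF tendsto_const joint_ge_level_at_left, of "m - 1"]) (use lo in auto)
  then have "0 \<le> (tail_ge m)\<^sup>2 / mid_ge m - (1 - r)" using den by (simp add: pos_le_divide_eq)
  moreover have "((\<lambda>x. (tail x)\<^sup>2 / mid_ge x - (1 - r)) \<longlongrightarrow> (tail_ge m)\<^sup>2 / mid_ge m - (1 - r)) (at_left m)"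
    using den by (intro tendsto_intros tail_at_left mid_ge_at_left) simp
  then have "(rho r \<mu> \<longlongrightarrow> (tail_ge m)\<^sup>2 / mid_ge m - (1 - r)) (at_left m)" by (simp add: rho_eq[abs_def])
  ultimately have "rho r \<mu> m \<le> 0" "\<exists>l. (rho r \<mu> \<longlongrightarrow> l) (at_left m) \<and> 0 \<le> l" by blast+
  then show "limit_form_i r \<mu> (law {z. m \<le> mid z})"
    unfolding limit_form_i_def using m closed_law(2)[OF m] tail_pos_iff_mu_max by blast
qed

text \<open>
As in \<open>limit_closed_form\<close>, but the quantile stays above \<open>m\<close>. The share above \<open>m\<close> itself is then at least
\<open>1 - r\<close>, so the limit of \<open>rho\<close> from the right is exactly 0.
\<close>

lemma limit_open_form:
  assumes w: "in_supp \<omega>" and qm: "quant \<omega> \<longlonglongrightarrow> m" and m: "0 < tail m" "m \<in> levels"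
    and ev: "\<forall>\<^sub>F t in sequentially. m < quant \<omega> t"
    and lim: "\<And>s. s \<in> levels \<Longrightarrow> (\<lambda>t. above s (traj \<omega> t) / real t) \<longlonglongrightarrow> joint_gt s m"
  shows "limit_form_ii r \<mu> (law {z. m < mid z})"
    and "s \<in> levels \<Longrightarrow> share \<omega> s \<longlonglongrightarrow> measure (law {z. m < mid z}) {s<..}"
proof -
  have den: "0 < mid_gt m" by (rule mid_gt_pos[OF m(1)])
  have sh: "share \<omega> s \<longlonglongrightarrow> joint_gt s m / mid_gt m" if "s \<in> levels" for s
    using share_tendsto[of \<omega> "\<lambda>s. joint_gt s m", OF w lim _ that] den by (simp add: joint_ge_minus1)
  then show "s \<in> levels \<Longrightarrow> share \<omega> s \<longlonglongrightarrow> measure (law {z. m < mid z}) {s<..}"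
    by (simp add: open_law(1)[OF m(1)])
  have hi: "(tail s)\<^sup>2 \<le> (1 - r) * mid_gt m" if "s \<in> \<rat>" "m < s" for s
  proof -
    have "\<forall>\<^sub>F t in sequentially. share \<omega> s t \<le> 1 - r"
      using order_tendstoD(2)[OF qm that(2)] eventually_ge_at_top[of 1]
      by eventually_elim (simp add: share_le_iff)
    then have "joint_gt s m / mid_gt m \<le> 1 - r"
      by (rule tendsto_upperbound[OF sh[OF rat_in_levels[OF that(1)]]]) simp
    then show ?thesis using den that(2) by (simp add: pos_divide_le_eq joint_ge_above(2))
  qed
  have up: "(tail m)\<^sup>2 \<le> (1 - r) * mid_gt m"
    by (rule rat_limit_right[OF tendsto_power[OF tail_at_right] tendsto_const, of m "m + 1"]) (use hi in auto)
  have "\<forall>\<^sub>F t in sequentially. 1 - r \<le> share \<omega> m t"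
    using ev eventually_ge_at_top[of 1]
    by eventually_elim (metis share_le_iff linorder_not_less less_imp_le)
  then have "1 - r \<le> joint_gt m m / mid_gt m"
    by (rule tendsto_lowerbound[OF sh[OF m(2)]]) simp
  then have "(1 - r) * mid_gt m \<le> (tail m)\<^sup>2" using den by (simp add: pos_le_divide_eq joint_ge_above(2))
  with up have eq: "(tail m)\<^sup>2 = (1 - r) * mid_gt m" by simp
  have "(tail m)\<^sup>2 \<le> (1 - r) * mid_ge m" unfolding eq using mid_gt_le_mid_ge r by (intro mult_left_mono) auto
  then have "rho r \<mu> m \<le> 0" using mid_ge_pos[OF m(1)] by (simp add: rho_eq pos_divide_le_eq)
  moreover have "((\<lambda>x. (tail x)\<^sup>2 / mid_ge x - (1 - r)) \<longlongrightarrow> (tail m)\<^sup>2 / mid_gt m - (1 - r)) (at_right m)"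
    using den by (intro tendsto_intros tail_at_right mid_ge_at_right) simp
  then have "(rho r \<mu> \<longlongrightarrow> 0) (at_right m)" using den by (simp add: rho_eq[abs_def] eq)
  ultimately show "limit_form_ii r \<mu> (law {z. m < mid z})"
    unfolding limit_form_ii_def using m(1) open_law(2)[OF m(1)] tail_pos_iff_mu_max by blast
qed

lemma mu_max_top: "top_point b \<Longrightarrow> b \<in> supp \<Longrightarrow> mu_max \<mu> = ereal b"
  unfolding mu_max_def by (rule SUP_eqI) (auto simp: top_point_def)

text \<open>
If the club stopped growing, its quantile \<open>c\<close> would be constant, so pairs with midpoint at least
\<open>c\<close> would have probability 0. But \<open>c\<close> is a member, so either there is mass above \<open>c\<close> or there is an atom at \<open>c\<close>.
\<close>

lemma infinitely_many_admissions:
  assumes t: "typical \<omega>"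
  shows "\<exists>i\<ge>N. admits r (traj \<omega> i) (\<omega> i)"
proof (rule ccontr)
  assume no: "\<not> ?thesis"
  define N' where "N' = max 1 N"
  define C where "C = traj \<omega> N'"
  define c where "c = quantile r C"
  have const: "traj \<omega> i = C" if "N' \<le> i" for i
    using that
  proof (induction rule: dec_induct)
    case (step n)
    then have "\<not> admits r (traj \<omega> n) (\<omega> n)" using no by (auto simp: N'_def)
    then show ?case using step by (simp add: Submission.step_def)
  qed (simp add: C_def)
  have w: "in_supp \<omega>" and fr: "freqs \<omega>" using t by (auto simp: typical_def)
  have mid: "mid (\<omega> i) < c" if "N' \<le> i" for i
  proof -
    have "\<not> admits r (traj \<omega> i) (\<omega> i)" "1 \<le> i" using no that by (auto simp: N'_def)
    then show ?thesis using admits_iff_quant[of i \<omega> "\<omega> i"] const[OF that] by (simp add: c_def not_le)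
  qed
  have zero: "mid_ge x = 0" if x: "x \<in> levels" "c \<le> x" for x
  proof -
    have "(\<lambda>t. (\<Sum>i<t. of_bool (- 1 < low (\<omega> i) \<and> x \<le> mid (\<omega> i))) / real t) \<longlonglongrightarrow> mid_ge x"
      using fr x rat_in_levels[of "- 1"] by (simp add: freqs_def joint_ge_minus1[symmetric])
    then have "mid_ge x \<le> 0"
    proof (rule LIMSEQ_le[OF _ lim_const_over_n[of "real N'"]], intro exI[of _ 0] allI impI)
      fix t :: nat
      have "(\<Sum>i<t. of_bool (- 1 < low (\<omega> i) \<and> x \<le> mid (\<omega> i))) \<le> (\<Sum>i<t. of_bool (i < N') :: real)"
      proof (rule sum_mono)
        fix i
        show "of_bool (- 1 < low (\<omega> i) \<and> x \<le> mid (\<omega> i)) \<le> (of_bool (i < N') :: real)"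
          using mid[of i] x(2) by (cases "i < N'") auto
      qed
      also have "\<dots> \<le> real N'" by (rule sum_of_bool_less)
      finally show "(\<Sum>i<t. of_bool (- 1 < low (\<omega> i) \<and> x \<le> mid (\<omega> i))) / real t \<le> real N' / real t"
        by (rule divide_right_mono) simp
    qed
    then show ?thesis by (simp add: mid_ge_def measure_le_0_iff)
  qed
  have cC: "c \<in># traj \<omega> N'" using r unfolding c_def C_def by (intro quantile_in run_nonempty) (auto simp: N'_def)
  show False
  proof (cases "0 < tail c")
    case True
    then obtain \<eta> where "\<eta> > 0" "0 < tail (c + \<eta>)" using rect_right_pos by blast
    moreover obtain x where "x \<in> \<rat>" "c < x" "x < c + \<eta>" using Rats_dense_in_real[of c "c + \<eta>"] \<open>\<eta> > 0\<close> by auto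
    ultimately have "0 < tail x" using tail_antimono[of x "c + \<eta>"] by simp
    then show False using zero[of x] mid_ge_pos[of x] \<open>x \<in> \<rat>\<close> \<open>c < x\<close> by (simp add: rat_in_levels)
  next
    case False
    have cs: "c \<in> supp" by (rule member_in_supp[OF w cC])
    have top: "top_point c"
      using False cs by (auto simp: top_point_def tail_pos_iff not_less)
    obtain i where "c = low (\<omega> i)" using run_members[OF cC] by auto
    then have "measure \<mu> {c} \<noteq> 0" using t top unfolding typical_def by blast
    then show False using top_atom[OF top] zero[of c] by simp
  qed
qed

lemma size_unbounded:
  assumes t: "typical \<omega>"
  shows "filterlim (\<lambda>t. real (size (traj \<omega> t))) at_top sequentially"
proof -
  have "\<exists>i. n \<le> size (traj \<omega> i)" for n
  proof (induction n)
    case (Suc n)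
    then obtain i where i: "n \<le> size (traj \<omega> i)" by blast
    obtain j where j: "i \<le> j" "admits r (traj \<omega> j) (\<omega> j)" using infinitely_many_admissions[OF t] by blast
    have "size (traj \<omega> i) \<le> size (traj \<omega> j)" by (rule run_size_mono[OF j(1)])
    then have "Suc n \<le> size (traj \<omega> (Suc j))" using i j(2) by (simp add: step_def)
    then show ?case by blast
  qed simp
  then have "filterlim (\<lambda>t. size (traj \<omega> t)) at_top sequentially"
    unfolding filterlim_at_top eventually_sequentially by (blast intro: order_trans[OF _ run_size_mono])
  then show ?thesis by (rule filterlim_compose[OF filterlim_real_sequentially])
qed

text \<open>
No candidate exceeds \<open>b\<close>, so a pair whose midpoint is close to \<open>b\<close> has both candidates close to \<open>b\<close>: once
the quantile is near \<open>b\<close>, every new member is too, and the growth of the set makes the early members negligible.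
\<close>

lemma limit_top_form:
  assumes t: "typical \<omega>" and qm: "quant \<omega> \<longlonglongrightarrow> b" and b: "b \<in> supp" "\<not> 0 < tail b"
  shows "limit_form_iii r \<mu> (return borel b)"
    and "share \<omega> s \<longlonglongrightarrow> measure (return borel b) {s<..}"
proof -
  have w: "in_supp \<omega>" using t by (simp add: typical_def)
  have top: "top_point b" using b by (auto simp: top_point_def tail_pos_iff not_less)
  then have "0 \<le> Liminf (at_left b) (\<lambda>x. ereal (rho r \<mu> x))" using t qm unfolding typical_def by blast
  then show "limit_form_iii r \<mu> (return borel b)"
    unfolding limit_form_iii_def using mu_max_top[OF top b(1)] by blast
  have le_b: "x \<le> b" if "x \<in> supp" for x using top that by (simp add: top_point_def)
  show "share \<omega> s \<longlonglongrightarrow> measure (return borel b) {s<..}"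
  proof (cases "s < b")
    case False
    have "filter_mset (\<lambda>x. s < x) (traj \<omega> t) = filter_mset (\<lambda>_. False) (traj \<omega> t)" for t
    proof (rule filter_mset_cong[OF refl])
      fix x assume "x \<in># traj \<omega> t"
      then show "s < x \<longleftrightarrow> False" using le_b[OF member_in_supp[OF w]] False by force
    qed
    then have "above s (traj \<omega> t) = 0" for t unfolding above_def by simp
    then show ?thesis using False by (simp add: share_def[abs_def] measure_return)
  next
    case True
    have "(s + b) / 2 < b" using True by simp
    from order_tendstoD(1)[OF qm this] obtain N where N: "\<And>t. N \<le> t \<Longrightarrow> (s + b) / 2 < quant \<omega> t"
      by (auto simp: eventually_sequentially)
    define N' where "N' = max 1 N"
    have lowb: "s < low (\<omega> i)" if "N' \<le> i" "admits r (traj \<omega> i) (\<omega> i)" for i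
    proof -
      have "quant \<omega> i \<le> mid (\<omega> i)" using that admits_iff_quant[of i \<omega> "\<omega> i"] by (simp add: N'_def)
      then have "s + b < fst (\<omega> i) + snd (\<omega> i)" using N[of i] that(1) by (simp add: N'_def mid_def)
      moreover have "fst (\<omega> i) \<le> b" "snd (\<omega> i) \<le> b" using w le_b by (auto simp: in_supp_def)
      ultimately show ?thesis by (simp add: low_def)
    qed
    have bound: "real (size (traj \<omega> t)) - real N' \<le> above s (traj \<omega> t)" for t
    proof -
      have "real (size (traj \<omega> t)) \<le> (\<Sum>i<t. of_bool (admits r (traj \<omega> i) (\<omega> i) \<and> s < low (\<omega> i)) + of_bool (i < N'))"
        unfolding size_run_empty using lowb by (intro sum_mono) (auto simp: not_less)
      also have "\<dots> \<le> above s (traj \<omega> t) + real N'"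
        unfolding above_run_empty sum.distrib by (intro add_left_mono sum_of_bool_less)
      finally show ?thesis by simp
    qed
    have lo: "(\<lambda>t. 1 - real N' / real (size (traj \<omega> t))) \<longlonglongrightarrow> 1 - 0"
      by (intro tendsto_diff tendsto_const real_tendsto_divide_at_top[OF tendsto_const size_unbounded[OF t]])
    have "share \<omega> s \<longlonglongrightarrow> 1"
    proof (rule real_tendsto_sandwich)
      show "(\<lambda>t. 1 - real N' / real (size (traj \<omega> t))) \<longlonglongrightarrow> 1" using lo by simp
      show "(\<lambda>_. 1 :: real) \<longlonglongrightarrow> 1" by (rule tendsto_const)
      show "\<forall>\<^sub>F t in sequentially. 1 - real N' / real (size (traj \<omega> t)) \<le> share \<omega> s t"
        using eventually_ge_at_top[of 1]
      proof eventually_elim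
        case (elim t)
        have "1 - real N' / real (size (traj \<omega> t)) = (real (size (traj \<omega> t)) - real N') / real (size (traj \<omega> t))"
          using run_nonempty[OF elim, of r "{#}" \<omega>] by (simp add: diff_divide_distrib)
        also have "\<dots> \<le> share \<omega> s t"
          unfolding share_def using bound[of t] by (rule divide_right_mono) simp
        finally show ?case .
      qed
      show "\<forall>\<^sub>F t in sequentially. share \<omega> s t \<le> 1"
        by (intro always_eventually allI) (auto simp: share_def divide_le_eq_1 above_le_size nonempty_has_size)
    qed
    then show ?thesis using True by (simp add: measure_return)
  qed
qed

text \<open>
Let \<open>m\<close> be the limit of the quantile. If midpoints equal to \<open>m\<close> have probability 0, the closed and the open
condition agree. Otherwise \<open>m\<close> is one of the \<open>levels\<close>, and the quantile is eventually on one side of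
\<open>m\<close>: it may oscillate neither if \<open>rho m < 0\<close> nor if the limit of \<open>rho\<close> at \<open>m\<close> from
the right is positive, and since \<open>rho\<close> jumps up at \<open>m\<close>, one of the two is the case.
\<close>

lemma typical_limit:
  assumes t: "typical \<omega>"
  shows "\<exists>\<nu>. prob_space \<nu> \<and> sets \<nu> = sets borel \<and> (\<forall>s\<in>\<rat>. share \<omega> s \<longlonglongrightarrow> measure \<nu> {s<..}) \<and>
    (limit_form_i r \<mu> \<nu> \<or> limit_form_ii r \<mu> \<nu> \<or> limit_form_iii r \<mu> \<nu>)"
proof -
  obtain m where m: "quant \<omega> \<longlonglongrightarrow> m" "m \<in> supp" using typical_convergent[OF t] .
  have w: "in_supp \<omega>" and fr: "freqs \<omega>" using t by (auto simp: typical_def)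
  show ?thesis
  proof (cases "0 < tail m")
    case False
    note top = limit_top_form[OF t m False]
    show ?thesis using top
      by (intro exI[of _ "return borel m"]) (auto intro: prob_space_return)
  next
    case pos: True
    have closed: ?thesis if "\<And>s. s \<in> levels \<Longrightarrow> (\<lambda>t. above s (traj \<omega> t) / real t) \<longlonglongrightarrow> joint_ge s m"
      using limit_closed_form[OF w m(1) pos that] law(1,2)[OF mid_low_events(2)[of m]] mid_ge_pos[OF pos]
      by (intro exI[of _ "law {z. m \<le> mid z}"]) (auto simp: mid_ge_def rat_in_levels)
    show ?thesis
    proof (cases "measure Z {z. mid z = m} = 0")
      case True
      have "AE z in Z. mid z \<noteq> m" using True mid_eq_event[of m] by (simp add: Z.P.prob_eq_0)
      then have eq: "joint_ge s m = joint_gt s m" for s unfolding joint_ge_def joint_gt_def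
        by (intro Z.P.finite_measure_eq_AE joint_ge_events) (auto elim!: eventually_mono)
      show ?thesis
        by (rule closed, rule order_tendstoI)
           (auto intro: rate_lower_open[OF fr m(1)] rate_upper_closed[OF fr m(1)] simp: eq)
    next
      case False
      then have ml: "m \<in> levels" by (simp add: levels_def)
      show ?thesis
      proof (cases "\<forall>\<^sub>F t in sequentially. quant \<omega> t \<le> m")
        case True
        show ?thesis
          by (rule closed, rule order_tendstoI)
             (auto intro: rate_lower_closed[OF fr m(1) ml True] rate_upper_closed[OF fr m(1)])
      next
        case nle: False
        then have fq: "\<exists>\<^sub>F t in sequentially. m < quant \<omega> t" by (simp add: not_eventually not_le)
        have ev: "\<forall>\<^sub>F t in sequentially. m < quant \<omega> t"
        proof (cases "(tail m)\<^sup>2 < (1 - r) * mid_ge m")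
          case True
          then have "\<not> (\<exists>\<^sub>F t in sequentially. quant \<omega> t \<le> m)"
            using t ml nle unfolding typical_def respects_sinks_def by blast
          then show ?thesis by (simp add: not_frequently not_le)
        next
          case F: False
          have "mid_gt m < mid_ge m"
            using False mid_ge_minus_mid_gt[of m] by (metis diff_gt_0_iff_gt zero_less_measure_iff)
          then have "(1 - r) * mid_gt m < (1 - r) * mid_ge m" using r by simp
          then have "(1 - r) * mid_gt m < joint_gt m m" using F by (simp add: joint_ge_above)
          from drift_at[OF joint_ge_at_right mid_ge_at_right this] obtain e where
            e: "e > 0" "\<forall>\<^sub>F x in at_right m. (1 - r + e) * mid_ge x \<le> joint_ge m x" by blast
          then obtain c where c: "m < c" "\<And>x. m < x \<Longrightarrow> x < c \<Longrightarrow> (1 - r + e) * mid_ge x \<le> joint_ge m x"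
            unfolding eventually_at_right_field by auto
          obtain v where v: "v \<in> \<rat>" "m < v" "v < c" using Rats_dense_in_real[OF c(1)] by blast
          show ?thesis
          proof (rule respects_sourcesD[OF _ ml rat_in_levels[OF v(1)] e(1) _ _ fq])
            show "respects_sources (quant \<omega>)" using t by (simp add: typical_def)
            show "\<forall>x\<in>supp. m < x \<and> x \<le> v \<longrightarrow> (1 - r + e) * mid_ge x \<le> joint_ge m x" using c(2) v by auto
            show "\<forall>\<^sub>F t in sequentially. quant \<omega> t \<in> supp \<inter> {..v}"
              using order_tendstoD(2)[OF m(1) v(2)] eventually_ge_at_top[of 1]
              by eventually_elim (use quant_in_supp[OF w] in auto)
          qed
        qed
        have "(\<lambda>t. above s (traj \<omega> t) / real t) \<longlonglongrightarrow> joint_gt s m" if "s \<in> levels" for s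
          by (rule order_tendstoI)
             (use that in \<open>auto intro: rate_lower_open[OF fr m(1)] rate_upper_open[OF fr m(1) ml ev]\<close>)
        from limit_open_form[OF w m(1) pos ml ev this] show ?thesis
          using law(1,2)[OF mid_low_events(3)[of m]] mid_gt_pos[OF pos]
          by (intro exI[of _ "law {z. m < mid z}"]) (auto simp: mid_gt_def rat_in_levels)
      qed
    qed
  qed
qed

end

section \<open>Weak convergence and measurability of the limit\<close>

lemma empirical_tail:
  assumes "C \<noteq> {#}"
  shows "measure (empirical C) {s<..} = above s C / real (size C)"
proof -
  have "measure (empirical C) {s<..} = measure (measure_pmf (pmf_of_multiset C)) {s<..}"
    unfolding empirical_def by (subst measure_distr) auto
  also have "\<dots> = measure (measure_pmf (pmf_of_multiset C)) ({s<..} \<inter> set_mset C)"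
    using measure_Int_set_pmf[of "pmf_of_multiset C" "{s<..}"] assms by simp
  also have "\<dots> = (\<Sum>x\<in>{s<..} \<inter> set_mset C. real (count C x) / real (size C))"
    using assms by (subst measure_measure_pmf_finite) auto
  also have "\<dots> = real (\<Sum>x\<in>{s<..} \<inter> set_mset C. count C x) / real (size C)"
    by (simp add: sum_divide_distrib)
  also have "(\<Sum>x\<in>{s<..} \<inter> set_mset C. count C x) = size (filter_mset (\<lambda>x. s < x) C)"
    unfolding size_multiset_overloaded_eq by (intro sum.cong) auto
  finally show ?thesis by (simp add: above_def)
qed

lemma prob_space_empirical: "prob_space (empirical C)"
  unfolding empirical_def by (intro prob_space.prob_space_distr) (auto intro: prob_space_measure_pmf)

lemma sets_empirical [simp]: "sets (empirical C) = sets borel"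
  by (simp add: empirical_def)

lemma cdf_eq_tail:
  assumes "prob_space \<nu>" "sets \<nu> = sets borel"
  shows "cdf \<nu> x = 1 - measure \<nu> {x<..}"
proof -
  interpret prob_space \<nu> by fact
  have "space \<nu> = UNIV" using sets_eq_imp_space_eq[OF assms(2)] by simp
  moreover have "space \<nu> - {x<..} = {..x}" using calculation by auto
  ultimately show ?thesis
    using prob_compl[of "{x<..}"] assms(2) by (simp add: cdf_def)
qed

text \<open>
At a continuity point of the limit the distribution functions are squeezed between their values at nearby
rational points. Asking for rational \<open>s\<close> only lets a countable union of null sets suffice.
\<close>

lemma weak_conv_if_rational_tails:
  assumes M: "\<And>t. prob_space (M t)" "\<And>t. sets (M t) = sets borel"
    and \<nu>: "prob_space \<nu>" "sets \<nu> = sets borel"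
    and lim: "\<And>s. s \<in> \<rat> \<Longrightarrow> (\<lambda>t. measure (M t) {s<..}) \<longlonglongrightarrow> measure \<nu> {s<..}"
  shows "weak_conv_m M \<nu>"
  unfolding weak_conv_m_def weak_conv_def
proof (intro allI impI)
  fix x assume cont: "isCont (cdf \<nu>) x"
  have lim': "(\<lambda>t. cdf (M t) s) \<longlonglongrightarrow> cdf \<nu> s" if "s \<in> \<rat>" for s
    unfolding cdf_eq_tail[OF M] cdf_eq_tail[OF \<nu>] by (intro tendsto_intros lim that)
  have mono: "cdf (M t) a \<le> cdf (M t) b" if "a \<le> b" for a b t
  proof -
    interpret prob_space "M t" by (rule M)
    show ?thesis unfolding cdf_def using that M(2) by (intro finite_measure_mono) auto
  qed
  show "(\<lambda>t. cdf (M t) x) \<longlonglongrightarrow> cdf \<nu> x"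
  proof (rule order_tendstoI)
    fix y assume "y < cdf \<nu> x"
    moreover have "(cdf \<nu> \<longlongrightarrow> cdf \<nu> x) (at_left x)"
      using cont unfolding isCont_def by (rule filterlim_mono) (auto simp: at_le)
    ultimately have "\<forall>\<^sub>F s in at_left x. y < cdf \<nu> s" by (intro order_tendstoD)
    then obtain b where b: "b < x" "\<And>s. b < s \<Longrightarrow> s < x \<Longrightarrow> y < cdf \<nu> s"
      unfolding eventually_at_left_field by auto
    obtain s where s: "s \<in> \<rat>" "b < s" "s < x" using Rats_dense_in_real[OF b(1)] by blast
    have "\<forall>\<^sub>F t in sequentially. y < cdf (M t) s" using lim'[OF s(1)] b(2)[OF s(2,3)] by (rule order_tendstoD)
    then show "\<forall>\<^sub>F t in sequentially. y < cdf (M t) x"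
      by eventually_elim (use mono[of s x] s(3) in \<open>auto intro: less_le_trans\<close>)
  next
    fix y assume "cdf \<nu> x < y"
    moreover have "(cdf \<nu> \<longlongrightarrow> cdf \<nu> x) (at_right x)"
      using cont unfolding isCont_def by (rule filterlim_mono) (auto simp: at_le)
    ultimately have "\<forall>\<^sub>F s in at_right x. cdf \<nu> s < y" by (intro order_tendstoD)
    then obtain b where b: "x < b" "\<And>s. x < s \<Longrightarrow> s < b \<Longrightarrow> cdf \<nu> s < y"
      unfolding eventually_at_right_field by auto
    obtain s where s: "s \<in> \<rat>" "x < s" "s < b" using Rats_dense_in_real[OF b(1)] by blast
    have "\<forall>\<^sub>F t in sequentially. cdf (M t) s < y" using lim'[OF s(1)] b(2)[OF s(2,3)] by (rule order_tendstoD)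
    then show "\<forall>\<^sub>F t in sequentially. cdf (M t) x < y"
      by eventually_elim (use mono[of x s] s(2) in \<open>auto intro: le_less_trans\<close>)
  qed
qed

text \<open>
The limit law is obtained by choice, so its measurability has to come from the convergence of the empirical
tails at rational points. Tails at other points are limits of those from the right.
\<close>

lemma measurable_if_rational_tails:
  assumes \<nu>: "\<And>\<omega>. \<omega> \<in> space P \<Longrightarrow> prob_space (\<nu> \<omega>)" "\<And>\<omega>. \<omega> \<in> space P \<Longrightarrow> sets (\<nu> \<omega>) = sets borel"
    and meas: "\<And>s. s \<in> \<rat> \<Longrightarrow> (\<lambda>\<omega>. measure (\<nu> \<omega>) {s<..}) \<in> borel_measurable P"
  shows "\<nu> \<in> P \<rightarrow>\<^sub>M prob_algebra (borel :: real measure)"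
proof (rule measurable_prob_algebra_generated[where \<Omega> = UNIV and G = "range greaterThan"])
  show "sets (borel :: real measure) = sigma_sets UNIV (range greaterThan)"
    by (subst borel_Ioi) simp
  show "Int_stable (range greaterThan :: real set set)"
  proof (rule Int_stableI)
    fix a b :: "real set" assume "a \<in> range greaterThan" "b \<in> range greaterThan"
    then obtain x y where "a = {x<..}" "b = {y<..}" by auto
    then have "a \<inter> b = {max x y<..}" by auto
    then show "a \<inter> b \<in> range greaterThan" by blast
  qed
  fix A :: "real set" assume "A \<in> range greaterThan"
  then obtain s where A: "A = {s<..}" by auto
  have "\<exists>x. x \<in> \<rat> \<and> s < x \<and> x < s + 1 / real (Suc n)" for n
    using Rats_dense_in_real[of s "s + 1 / real (Suc n)"] by auto
  then obtain x where x: "\<And>n. x n \<in> \<rat>" "\<And>n. s < x n" "\<And>n. x n < s + 1 / real (Suc n)" by metis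
  have xs: "x \<longlonglongrightarrow> s"
  proof (rule real_tendsto_sandwich[OF _ _ tendsto_const])
    have "(\<lambda>n. s + 1 / real (Suc n)) \<longlonglongrightarrow> s + 0" by (intro tendsto_intros LIMSEQ_Suc[OF lim_1_over_n])
    then show "(\<lambda>n. s + 1 / real (Suc n)) \<longlonglongrightarrow> s" by simp
    show "\<forall>\<^sub>F n in sequentially. s \<le> x n" by (simp add: less_imp_le[OF x(2)])
    show "\<forall>\<^sub>F n in sequentially. x n \<le> s + 1 / real (Suc n)" by (simp only: less_imp_le[OF x(3)] eventually_True)
  qed
  have "(\<lambda>\<omega>. measure (\<nu> \<omega>) {s<..}) \<in> borel_measurable P"
  proof (rule borel_measurable_LIMSEQ_real)
    show "(\<lambda>\<omega>. measure (\<nu> \<omega>) {x n<..}) \<in> borel_measurable P" for n by (intro meas x)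
    fix \<omega> assume w: "\<omega> \<in> space P"
    interpret prob_space "\<nu> \<omega>" by (rule \<nu>[OF w])
    have m: "(\<lambda>x. x) \<in> borel_measurable (\<nu> \<omega>)" using \<nu>(2)[OF w] by (simp add: measurable_ident_sets)
    have sp: "space (\<nu> \<omega>) = UNIV" using sets_eq_imp_space_eq[OF \<nu>(2)[OF w]] by simp
    have "((\<lambda>q. measure (\<nu> \<omega>) {q<..}) \<longlongrightarrow> measure (\<nu> \<omega>) {s<..}) (at_right s)"
      using tail_at_right(2)[OF m sets.top, of s] by (simp add: sp greaterThan_def)
    moreover have "filterlim x (at_right s) sequentially"
      unfolding filterlim_at using xs x(2) by (auto intro!: always_eventually simp: less_imp_neq[symmetric])
    ultimately show "(\<lambda>n. measure (\<nu> \<omega>) {x n<..}) \<longlonglongrightarrow> measure (\<nu> \<omega>) {s<..}"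
      by (rule filterlim_compose)
  qed
  then have "(\<lambda>\<omega>. ennreal (measure (\<nu> \<omega>) {s<..})) \<in> borel_measurable P" by measurable
  also have "?this \<longleftrightarrow> (\<lambda>\<omega>. emeasure (\<nu> \<omega>) A) \<in> borel_measurable P"
  proof (rule measurable_cong)
    fix \<omega> assume "\<omega> \<in> space P"
    then interpret prob_space "\<nu> \<omega>" by (rule \<nu>)
    show "ennreal (measure (\<nu> \<omega>) {s<..}) = emeasure (\<nu> \<omega>) A" by (simp add: A emeasure_eq_measure)
  qed
  finally show "(\<lambda>\<omega>. emeasure (\<nu> \<omega>) A) \<in> borel_measurable P" .
qed (use \<nu> in auto)

text \<open>
The pairs of candidates form a sequence of independent draws from the product law, so that almost sure
statements about the sequence space transfer to the given probability space.
\<close>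

lemma distr_pairs:
  fixes P :: "'w measure" and X Y :: "nat \<Rightarrow> 'w \<Rightarrow> real"
  assumes P: "prob_space P" and mu: "sets \<mu> = sets borel"
    and ind: "prob_space.indep_vars P (\<lambda>_. borel) (\<lambda>(i, t). if i then X t else Y t) ((UNIV :: bool set) \<times> {1..})"
    and X: "\<And>t. t \<ge> 1 \<Longrightarrow> distr P borel (X t) = \<mu>" and Y: "\<And>t. t \<ge> 1 \<Longrightarrow> distr P borel (Y t) = \<mu>"
  defines "W \<equiv> \<lambda>\<omega> k. (X (Suc k) \<omega>, Y (Suc k) \<omega>)"
  shows "W \<in> P \<rightarrow>\<^sub>M (\<Pi>\<^sub>M i\<in>UNIV. \<mu> \<Otimes>\<^sub>M \<mu>)"
    and "distr P (\<Pi>\<^sub>M i\<in>UNIV. \<mu> \<Otimes>\<^sub>M \<mu>) W = (\<Pi>\<^sub>M i\<in>UNIV. \<mu> \<Otimes>\<^sub>M \<mu>)"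
proof -
  interpret prob_space P by (rule P)
  let ?F = "\<lambda>(i, t). if i then X t else Y t"
  let ?B = "borel \<Otimes>\<^sub>M borel :: (real \<times> real) measure"
  have sB: "sets (\<mu> \<Otimes>\<^sub>M \<mu>) = sets ?B" by (intro sets_pair_measure_cong mu)
  have sS: "sets (\<Pi>\<^sub>M i\<in>UNIV. \<mu> \<Otimes>\<^sub>M \<mu>) = sets (\<Pi>\<^sub>M i\<in>(UNIV::nat set). ?B)" by (intro sets_PiM_cong sB refl)
  have rvX: "X t \<in> borel_measurable P" and rvY: "Y t \<in> borel_measurable P" if "t \<ge> 1" for t
    using ind[unfolded indep_vars_def, THEN conjunct1, rule_format, of "(True, t)"]
      ind[unfolded indep_vars_def, THEN conjunct1, rule_format, of "(False, t)"] that by auto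
  have pair: "distr P ?B (\<lambda>\<omega>. (X (Suc k) \<omega>, Y (Suc k) \<omega>)) = \<mu> \<Otimes>\<^sub>M \<mu>" for k
  proof -
    have "indep_vars (\<lambda>b. PiM {(b, Suc k)} (\<lambda>_. borel)) (\<lambda>b \<omega>. restrict (\<lambda>i. ?F i \<omega>) {(b, Suc k)}) UNIV"
      by (rule indep_vars_restrict[OF ind]) (auto simp: disjoint_family_on_def)
    then have "indep_vars (\<lambda>_. borel) (\<lambda>b \<omega>. (\<lambda>g. g (b, Suc k)) (restrict (\<lambda>i. ?F i \<omega>) {(b, Suc k)})) UNIV"
      by (rule indep_vars_compose2) measurable
    then have ib: "indep_vars (\<lambda>_. borel) (\<lambda>b. ?F (b, Suc k)) UNIV" by simp
    have "indep_vars (case_bool borel borel) (case_bool (X (Suc k)) (Y (Suc k))) UNIV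
        \<longleftrightarrow> indep_vars (\<lambda>_. borel) (\<lambda>b. ?F (b, Suc k)) UNIV"
      by (intro indep_vars_cong) (auto split: bool.split)
    with ib have "indep_var borel (X (Suc k)) borel (Y (Suc k))"
      unfolding indep_var_def by blast
    then have "distr P ?B (\<lambda>\<omega>. (X (Suc k) \<omega>, Y (Suc k) \<omega>)) = distr P borel (X (Suc k)) \<Otimes>\<^sub>M distr P borel (Y (Suc k))"
      unfolding indep_var_distribution_eq by simp
    then show ?thesis by (simp add: X Y)
  qed
  have "indep_vars (\<lambda>k. PiM {(True, Suc k), (False, Suc k)} (\<lambda>_. borel))
      (\<lambda>k \<omega>. restrict (\<lambda>i. ?F i \<omega>) {(True, Suc k), (False, Suc k)}) UNIV"
    by (rule indep_vars_restrict[OF ind]) (auto simp: disjoint_family_on_def)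
  then have "indep_vars (\<lambda>_. ?B) (\<lambda>k \<omega>. (\<lambda>g. (g (True, Suc k), g (False, Suc k)))
      (restrict (\<lambda>i. ?F i \<omega>) {(True, Suc k), (False, Suc k)})) UNIV"
    by (rule indep_vars_compose2) measurable
  then have ind': "indep_vars (\<lambda>_. ?B) (\<lambda>k \<omega>. (X (Suc k) \<omega>, Y (Suc k) \<omega>)) UNIV" by simp
  have "distr P (\<Pi>\<^sub>M i\<in>UNIV. ?B) (\<lambda>\<omega>. \<lambda>k\<in>UNIV. (X (Suc k) \<omega>, Y (Suc k) \<omega>)) =
      (\<Pi>\<^sub>M k\<in>UNIV. distr P ?B (\<lambda>\<omega>. (X (Suc k) \<omega>, Y (Suc k) \<omega>)))"
    using ind' rvX rvY by (subst indep_vars_iff_distr_eq_PiM'[symmetric]) auto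
  then have eq: "distr P (\<Pi>\<^sub>M i\<in>UNIV. ?B) W = (\<Pi>\<^sub>M i\<in>UNIV. \<mu> \<Otimes>\<^sub>M \<mu>)"
    unfolding pair W_def by (simp add: restrict_UNIV)
  have "W \<in> P \<rightarrow>\<^sub>M (\<Pi>\<^sub>M i\<in>UNIV. ?B)"
    unfolding W_def using rvX rvY by (intro measurable_PiM_single') (auto simp: space_pair_measure)
  then show "W \<in> P \<rightarrow>\<^sub>M (\<Pi>\<^sub>M i\<in>UNIV. \<mu> \<Otimes>\<^sub>M \<mu>)"
    using measurable_cong_sets[OF refl sS] by blast
  show "distr P (\<Pi>\<^sub>M i\<in>UNIV. \<mu> \<Otimes>\<^sub>M \<mu>) W = (\<Pi>\<^sub>M i\<in>UNIV. \<mu> \<Otimes>\<^sub>M \<mu>)"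
    using eq distr_cong[OF refl sS refl, of P W] by simp
qed

context nonneg_opinions
begin

lemma limit_nonneg:
  assumes "typical \<omega>" "prob_space \<nu>" "sets \<nu> = sets borel" "\<forall>s\<in>\<rat>. share \<omega> s \<longlonglongrightarrow> measure \<nu> {s<..}"
  shows "measure \<nu> {0..} = 1"
proof -
  interpret N: prob_space \<nu> by (rule assms)
  have w: "in_supp \<omega>" using assms(1) by (simp add: typical_def)
  have one: "measure \<nu> {s<..} = 1" if s: "s \<in> \<rat>" "s < 0" for s
  proof -
    have "\<forall>\<^sub>F t in sequentially. share \<omega> s t = 1"
      using eventually_ge_at_top[of 1]
    proof eventually_elim
      case (elim t)
      have "filter_mset (\<lambda>x. s < x) (traj \<omega> t) = traj \<omega> t"
        using member_in_supp[OF w] supp_nonneg s(2) by (force simp: filter_mset_eq_conv)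
      then show ?case
        using run_nonempty[OF elim, of r "{#}" \<omega>] by (simp add: share_def above_def)
    qed
    then have "share \<omega> s \<longlonglongrightarrow> 1" by (rule tendsto_eventually)
    then show ?thesis using assms(4) s(1) LIMSEQ_unique by blast
  qed
  have m: "(\<lambda>x. x) \<in> borel_measurable \<nu>" using assms(3) by (simp add: measurable_ident_sets)
  have sp: "space \<nu> = UNIV" using sets_eq_imp_space_eq[OF assms(3)] by simp
  have lim: "((\<lambda>q. measure \<nu> {q<..}) \<longlongrightarrow> measure \<nu> {0..}) (at_left 0)"
    using N.tail_at_left(2)[OF m sets.top, of 0] by (simp add: sp greaterThan_def atLeast_def)
  show ?thesis
  proof (rule antisym)
    show "1 \<le> measure \<nu> {0..}" by (rule rat_limit_left[OF tendsto_const lim, of "- 1"]) (use one in auto)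
  qed simp
qed

end

theorem theorem1:
  fixes r :: real and \<mu> :: "real measure"
    and P :: "'w measure" and X Y :: "nat \<Rightarrow> 'w \<Rightarrow> real"
  assumes "0 < r" "r < 1"
    and "real_distribution \<mu>" "measure \<mu> {0..} = 1"
    and "prob_space P"
    and "prob_space.indep_vars P (\<lambda>_. borel) (\<lambda>(i, t). if i then X t else Y t)
           ((UNIV :: bool set) \<times> {1..})"
    and "\<And>t. t \<ge> 1 \<Longrightarrow> distr P borel (X t) = \<mu>"
    and "\<And>t. t \<ge> 1 \<Longrightarrow> distr P borel (Y t) = \<mu>"
  shows "\<exists>\<nu> \<in> P \<rightarrow>\<^sub>M prob_algebra borel. AE \<omega> in P.
           measure (\<nu> \<omega>) {0..} = 1 \<and>
           weak_conv_m (\<lambda>t. empirical (club r (\<lambda>k. X k \<omega>) (\<lambda>k. Y k \<omega>) t)) (\<nu> \<omega>) \<and>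
           (limit_form_i r \<mu> (\<nu> \<omega>) \<or> limit_form_ii r \<mu> (\<nu> \<omega>) \<or> limit_form_iii r \<mu> (\<nu> \<omega>))"
proof -
  interpret nonneg_opinions r \<mu>
    using assms(1-4) by (intro nonneg_opinions.intro opinions.intro nonneg_opinions_axioms.intro)
  define W where "W \<omega> k = (X (Suc k) \<omega>, Y (Suc k) \<omega>)" for \<omega> k
  have W: "W \<in> P \<rightarrow>\<^sub>M \<S>" "distr P \<S> W = \<S>"
    using distr_pairs[OF assms(5) D.events_eq_borel assms(6-8)] unfolding W_def by simp_all
  have club: "club r (\<lambda>k. X k \<omega>) (\<lambda>k. Y k \<omega>) t = traj (W \<omega>) t" for \<omega> t
    by (simp add: club_eq_run W_def[abs_def])
  have "AE \<omega> in distr P \<S> W. typical \<omega>" unfolding W(2) by (rule AE_typical)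
  then have "AE \<omega> in P. typical (W \<omega>)" by (rule AE_distrD[OF W(1)])
  then obtain N where N: "{\<omega> \<in> space P. \<not> typical (W \<omega>)} \<subseteq> N" "emeasure P N = 0" "N \<in> sets P" by (rule AE_E)
  define good where "good \<omega> \<nu> \<longleftrightarrow> prob_space \<nu> \<and> sets \<nu> = sets borel \<and> (\<forall>s\<in>\<rat>. share (W \<omega>) s \<longlonglongrightarrow> measure \<nu> {s<..}) \<and>
    (limit_form_i r \<mu> \<nu> \<or> limit_form_ii r \<mu> \<nu> \<or> limit_form_iii r \<mu> \<nu>)" for \<omega> and \<nu> :: "real measure"
  \<comment> \<open>on the exceptional null set any fixed law will do\<close>
  define \<nu> where "\<nu> \<omega> = (if \<omega> \<in> N then return borel 0 else (SOME \<nu>. good \<omega> \<nu>))" for \<omega>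
  have good: "good \<omega> (\<nu> \<omega>)" if "\<omega> \<in> space P" "\<omega> \<notin> N" for \<omega>
  proof -
    have "typical (W \<omega>)" using N(1) that by blast
    then have "\<exists>\<nu>. good \<omega> \<nu>" unfolding good_def by (rule typical_limit)
    then show ?thesis using that by (simp add: \<nu>_def someI_ex)
  qed
  have \<nu>: "prob_space (\<nu> \<omega>)" "sets (\<nu> \<omega>) = sets borel" if "\<omega> \<in> space P" for \<omega>
    using good[OF that] by (cases "\<omega> \<in> N"; auto simp: \<nu>_def good_def intro: prob_space_return)+
  have "\<nu> \<in> P \<rightarrow>\<^sub>M prob_algebra borel"
  proof (rule measurable_if_rational_tails[OF \<nu>])
    fix s :: real assume s: "s \<in> \<rat>"
    define u where "u t \<omega> = (if \<omega> \<in> N then measure (return borel 0) {s<..} else share (W \<omega>) s t)" for t \<omega>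
    show "(\<lambda>\<omega>. measure (\<nu> \<omega>) {s<..}) \<in> borel_measurable P"
    proof (rule borel_measurable_LIMSEQ_real)
      have "(\<lambda>\<omega>. share (W \<omega>) s t) \<in> borel_measurable P" for t
        unfolding share_def using measurable_run[OF W(1), where C = "{#}" and t = t] by (intro borel_measurable_divide) auto
      then show "u t \<in> borel_measurable P" for t
        unfolding u_def[abs_def] using N(3) by (intro measurable_If) auto
      show "(\<lambda>t. u t \<omega>) \<longlonglongrightarrow> measure (\<nu> \<omega>) {s<..}" if "\<omega> \<in> space P" for \<omega>
        using good[OF that] s by (cases "\<omega> \<in> N") (auto simp: u_def \<nu>_def good_def)
    qed
  qed auto
  moreover have "AE \<omega> in P. measure (\<nu> \<omega>) {0..} = 1 \<and>
           weak_conv_m (\<lambda>t. empirical (club r (\<lambda>k. X k \<omega>) (\<lambda>k. Y k \<omega>) t)) (\<nu> \<omega>) \<and>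
           (limit_form_i r \<mu> (\<nu> \<omega>) \<or> limit_form_ii r \<mu> (\<nu> \<omega>) \<or> limit_form_iii r \<mu> (\<nu> \<omega>))"
  proof (rule AE_I'[of N])
    show "N \<in> null_sets P" using N by auto
    show "{\<omega> \<in> space P. \<not> (measure (\<nu> \<omega>) {0..} = 1 \<and>
           weak_conv_m (\<lambda>t. empirical (club r (\<lambda>k. X k \<omega>) (\<lambda>k. Y k \<omega>) t)) (\<nu> \<omega>) \<and>
           (limit_form_i r \<mu> (\<nu> \<omega>) \<or> limit_form_ii r \<mu> (\<nu> \<omega>) \<or> limit_form_iii r \<mu> (\<nu> \<omega>)))} \<subseteq> N"
    proof (rule subsetI, rule ccontr)
      fix \<omega> assume bad: "\<omega> \<in> {\<omega> \<in> space P. \<not> (measure (\<nu> \<omega>) {0..} = 1 \<and>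
           weak_conv_m (\<lambda>t. empirical (club r (\<lambda>k. X k \<omega>) (\<lambda>k. Y k \<omega>) t)) (\<nu> \<omega>) \<and>
           (limit_form_i r \<mu> (\<nu> \<omega>) \<or> limit_form_ii r \<mu> (\<nu> \<omega>) \<or> limit_form_iii r \<mu> (\<nu> \<omega>)))}" and "\<omega> \<notin> N"
      then have g: "good \<omega> (\<nu> \<omega>)" and t: "typical (W \<omega>)" using good N(1) by auto
      have "weak_conv_m (\<lambda>t. empirical (traj (W \<omega>) t)) (\<nu> \<omega>)"
      proof (rule weak_conv_if_rational_tails)
        fix s :: real assume "s \<in> \<rat>"
        then have "share (W \<omega>) s \<longlonglongrightarrow> measure (\<nu> \<omega>) {s<..}" using g by (simp add: good_def)
        moreover have "\<forall>\<^sub>F t in sequentially. share (W \<omega>) s t = measure (empirical (traj (W \<omega>) t)) {s<..}"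
          using eventually_ge_at_top[of 1]
          by eventually_elim (simp add: share_def empirical_tail run_nonempty)
        ultimately show "(\<lambda>t. measure (empirical (traj (W \<omega>) t)) {s<..}) \<longlonglongrightarrow> measure (\<nu> \<omega>) {s<..}"
          by (rule Lim_transform_eventually)
      qed (use g in \<open>auto simp: good_def prob_space_empirical\<close>)
      moreover have "measure (\<nu> \<omega>) {0..} = 1"
        using g by (intro limit_nonneg[OF t]) (auto simp: good_def)
      ultimately show False using bad g by (auto simp: club good_def)
    qed
  qed
  ultimately show ?thesis by blast
qed

end
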